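(* Let $M$ be a term of the CCV $\lambda\mu$-calculus. Then $M$ is normalizable (i.e., $M\to^* M'$ for some $M'$ containing no redex of any reduction rule) if and only if its CPS translation $[\![M]\!]$ has a $\beta\eta$-normal form in the target calculus.
   Context: CCV $\lambda\mu$-calculus. Ordinary variables $x,y,z,\dots$ and continuation variables $k,l,\dots$ are disjoint. Terms $M ::= x \mid \lambda x.M \mid MM \mid (M\ \mathsf{where}\ x:=M) \mid \mu k.J$, jumps $J ::= [k]M \mid (J\ \mathsf{where}\ x:=M)$, where $(L\ \mathsf{where}\ x:=M)$ means $\mathsf{let}\ x=M\ \mathsf{in}\ L$ ($x$ bound in $L$ only); $\lambda x$, $\mu k$ bind as usual. Terms are identified up to $\alpha$-conversion and the congruence generated by (E1) $(L\ \mathsf{where}\ x:=(M\ \mathsf{where}\ y:=N))=((L\ \mathsf{where}\ x:=M)\ \mathsf{where}\ y:=N)$ if $y$ not free in $L$; (E2) $((\mu k.J)\ \mathsf{where}\ x:=M)=\mu k.(J\ \mathsf{where}\ x:=M)$ if $k$ not free in $M$; (E3) $[k](L\ \mathsf{where}\ x:=M)=([k]L\ \mathsf{where}\ x:=M)$. Values $V$: variables and $\lambda$-abstractions; $N$ denotes a non-value. Reduction rules ($z$ fresh): $NM\to(zM\ \mathsf{where}\ z:=N)$; $VN\to(Vz\ \mathsf{where}\ z:=N)$; $(\lambda x.M)V\to(M\ \mathsf{where}\ x:=V)$; $(M\ \mathsf{where}\ x:=V)\to M\{V/x\}$; $(M\ \mathsf{where}\ x:=\mu k.J)\to\mu k.J\{[k]\square\mapsto[k](M\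 \mathsf{where}\ x:=\square)\}$; $[l]\mu k.J\to J\{l/k\}$; $\lambda x.Vx\to V$ ($x$ not free in $V$); $(x\ \mathsf{where}\ x:=M)\to M$; $\mu k.[k]M\to M$ ($k$ not free in $M$). The context substitution replaces recursively each subjump $[k]Q$ with $k$ free by $[k](M\ \mathsf{where}\ x:=Q)$; $J\{l/k\}$ replaces each such $[k]Q$ by $[l]Q$. $\to$ is the compatible closure. Target calculus: sorted $\lambda$-calculus $T::=\lambda k.Q\mid WW$, $Q::=KW\mid TK$, $W::=x\mid\lambda x.T$, $K::=k\mid\lambda x.Q$ with $\beta\eta$-reduction. CPS translation: $\langle V\rangle[K]=KV^*$; $\langle V_1V_2\rangle[K]=V_1^*V_2^*K$; $\langle VN\rangle[K]=\langle N\rangle[\lambda y.V^*yK]$; $\langle NV\rangle[K]=\langle N\rangle[\lambda x.xV^*K]$; $\langle N_1N_2\rangle[K]=\langle N_1\rangle[\lambda x.\langle N_2\rangle[\lambda y.xyK]]$; $\langle (L\ \mathsf{where}\ x:=M)\rangle[K]=\langle M\rangle[\lambda x.\langle L\rangle[K]]$ (renaming $x$ if free in $K$); $\langle\mu k.J\rangle[K]=(\lambda k.\langle J\rangle)K$; $\langle[k]M\rangle=\langle M\rangle[k]$; $\langle (J\ \mathsf{where}\ x:=M)\rangle=\langle M\rangle[\lambda x.\langle J\rangle]$; $x^*=x$; $(\lambda x.M)^*=\lambda xk.\langle M\rangle[k]$; $[\![M]\!]=\lambda k.\langle M\rangle[k]$ (fresh bound variables). $[\![M]\!]$ is computed from any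 syntax-tree representative of $M$ (the result is determined up to $\beta$-equality). *)

theory Defs
  imports Main
begin

text \<open>Two separate de Bruijn index spaces: ordinary variables are counted by the
ordinary binders (lambda and where), continuation variables by mu-binders.
Whr L M stands for (L where x:=M) with x = index 0 in L (x bound in L only).
Alpha-conversion is thus syntactic identity.\<close>

datatype trm = Var nat | Lam trm | App trm trm | Whr trm trm | Mu jmp
     and jmp = Jmp nat trm | JWhr jmp trm

fun isval :: "trm \<Rightarrow> bool" where
  "isval (Var _) = True"
| "isval (Lam _) = True"
| "isval _ = False"

primrec liftx_t :: "nat \<Rightarrow> trm \<Rightarrow> trm" and liftx_j :: "nat \<Rightarrow> jmp \<Rightarrow> jmp" where
  "liftx_t c (Var i) = Var (if i < c then i else Suc i)"
| "liftx_t c (Lam M) = Lam (liftx_t (Suc c) M)"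
| "liftx_t c (App M N) = App (liftx_t c M) (liftx_t c N)"
| "liftx_t c (Whr L M) = Whr (liftx_t (Suc c) L) (liftx_t c M)"
| "liftx_t c (Mu J) = Mu (liftx_j c J)"
| "liftx_j c (Jmp k M) = Jmp k (liftx_t c M)"
| "liftx_j c (JWhr J M) = JWhr (liftx_j (Suc c) J) (liftx_t c M)"

primrec liftk_t :: "nat \<Rightarrow> trm \<Rightarrow> trm" and liftk_j :: "nat \<Rightarrow> jmp \<Rightarrow> jmp" where
  "liftk_t c (Var i) = Var i"
| "liftk_t c (Lam M) = Lam (liftk_t c M)"
| "liftk_t c (App M N) = App (liftk_t c M) (liftk_t c N)"
| "liftk_t c (Whr L M) = Whr (liftk_t c L) (liftk_t c M)"
| "liftk_t c (Mu J) = Mu (liftk_j (Suc c) J)"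
| "liftk_j c (Jmp k M) = Jmp (if k < c then k else Suc k) (liftk_t c M)"
| "liftk_j c (JWhr J M) = JWhr (liftk_j c J) (liftk_t c M)"

primrec substx_t :: "trm \<Rightarrow> nat \<Rightarrow> trm \<Rightarrow> trm" and substx_j :: "jmp \<Rightarrow> nat \<Rightarrow> trm \<Rightarrow> jmp" where
  "substx_t (Var i) c V = (if i < c then Var i else if i = c then V else Var (i - 1))"
| "substx_t (Lam M) c V = Lam (substx_t M (Suc c) (liftx_t 0 V))"
| "substx_t (App M N) c V = App (substx_t M c V) (substx_t N c V)"
| "substx_t (Whr L M) c V = Whr (substx_t L (Suc c) (liftx_t 0 V)) (substx_t M c V)"
| "substx_t (Mu J) c V = Mu (substx_j J c (liftk_t 0 V))"
| "substx_j (Jmp k M) c V = Jmp k (substx_t M c V)"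
| "substx_j (JWhr J M) c V = JWhr (substx_j J (Suc c) (liftx_t 0 V)) (substx_t M c V)"

primrec renk_t :: "trm \<Rightarrow> nat \<Rightarrow> nat \<Rightarrow> trm" and renk_j :: "jmp \<Rightarrow> nat \<Rightarrow> nat \<Rightarrow> jmp" where
  "renk_t (Var i) c l = Var i"
| "renk_t (Lam M) c l = Lam (renk_t M c l)"
| "renk_t (App M N) c l = App (renk_t M c l) (renk_t N c l)"
| "renk_t (Whr L M) c l = Whr (renk_t L c l) (renk_t M c l)"
| "renk_t (Mu J) c l = Mu (renk_j J (Suc c) (Suc l))"
| "renk_j (Jmp i Q) c l = Jmp (if i < c then i else if i = c then l else i - 1) (renk_t Q c l)"
| "renk_j (JWhr J M) c l = JWhr (renk_j J c l) (renk_t M c l)"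

text \<open>Context substitution J{[k]\<box> \<mapsto> [k](P where x:=\<box>)}, k = index c,
recursively; P is kept correctly shifted.\<close>
primrec ctx_t :: "trm \<Rightarrow> nat \<Rightarrow> trm \<Rightarrow> trm" and ctx_j :: "jmp \<Rightarrow> nat \<Rightarrow> trm \<Rightarrow> jmp" where
  "ctx_t (Var i) c P = Var i"
| "ctx_t (Lam M) c P = Lam (ctx_t M c (liftx_t 1 P))"
| "ctx_t (App M N) c P = App (ctx_t M c P) (ctx_t N c P)"
| "ctx_t (Whr L M) c P = Whr (ctx_t L c (liftx_t 1 P)) (ctx_t M c P)"
| "ctx_t (Mu J) c P = Mu (ctx_j J (Suc c) (liftk_t 0 P))"
| "ctx_j (Jmp i Q) c P = (if i = c then Jmp i (Whr P (ctx_t Q c P)) else Jmp i (ctx_t Q c P))"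
| "ctx_j (JWhr J M) c P = JWhr (ctx_j J c (liftx_t 1 P)) (ctx_t M c P)"

inductive eqv_t :: "trm \<Rightarrow> trm \<Rightarrow> bool" and eqv_j :: "jmp \<Rightarrow> jmp \<Rightarrow> bool" where
  E1_t: "eqv_t (Whr L (Whr M N)) (Whr (Whr (liftx_t 1 L) M) N)"
| E1_j: "eqv_j (JWhr J (Whr M N)) (JWhr (JWhr (liftx_j 1 J) M) N)"
| E2: "eqv_t (Whr (Mu J) M) (Mu (JWhr J (liftk_t 0 M)))"
| E3: "eqv_j (Jmp k (Whr L M)) (JWhr (Jmp k L) M)"
| refl_t: "eqv_t M M"
| refl_j: "eqv_j J J"
| sym_t: "eqv_t M N \<Longrightarrow> eqv_t N M"
| sym_j: "eqv_j J J' \<Longrightarrow> eqv_j J' J"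
| trans_t: "eqv_t M N \<Longrightarrow> eqv_t N P \<Longrightarrow> eqv_t M P"
| trans_j: "eqv_j J J' \<Longrightarrow> eqv_j J' J'' \<Longrightarrow> eqv_j J J''"
| cLam: "eqv_t M M' \<Longrightarrow> eqv_t (Lam M) (Lam M')"
| cApp: "eqv_t M M' \<Longrightarrow> eqv_t N N' \<Longrightarrow> eqv_t (App M N) (App M' N')"
| cWhr: "eqv_t L L' \<Longrightarrow> eqv_t M M' \<Longrightarrow> eqv_t (Whr L M) (Whr L' M')"
| cMu: "eqv_j J J' \<Longrightarrow> eqv_t (Mu J) (Mu J')"
| cJmp: "eqv_t M M' \<Longrightarrow> eqv_j (Jmp k M) (Jmp k M')"
| cJWhr: "eqv_j J J' \<Longrightarrow> eqv_t M M' \<Longrightarrow> eqv_j (JWhr J M) (JWhr J' M')"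

inductive step_t :: "trm \<Rightarrow> trm \<Rightarrow> bool" and step_j :: "jmp \<Rightarrow> jmp \<Rightarrow> bool" where
  r_appN: "\<not> isval N \<Longrightarrow> step_t (App N M) (Whr (App (Var 0) (liftx_t 0 M)) N)"
| r_appV: "isval V \<Longrightarrow> \<not> isval N \<Longrightarrow> step_t (App V N) (Whr (App (liftx_t 0 V) (Var 0)) N)"
| r_beta: "isval V \<Longrightarrow> step_t (App (Lam M) V) (Whr M V)"
| r_whrV: "isval V \<Longrightarrow> step_t (Whr M V) (substx_t M 0 V)"
| r_whrMu: "step_t (Whr M (Mu J)) (Mu (ctx_j J 0 (liftk_t 0 M)))"
| r_jmpMu: "step_j (Jmp l (Mu J)) (renk_j J 0 l)"
| r_eta: "isval V \<Longrightarrow> step_t (Lam (App (liftx_t 0 V) (Var 0))) V"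
| r_whrvar: "step_t (Whr (Var 0) M) M"
| r_muJmp: "step_t (Mu (Jmp 0 (liftk_t 0 M))) M"
| s_Lam: "step_t M M' \<Longrightarrow> step_t (Lam M) (Lam M')"
| s_App1: "step_t M M' \<Longrightarrow> step_t (App M N) (App M' N)"
| s_App2: "step_t N N' \<Longrightarrow> step_t (App M N) (App M N')"
| s_Whr1: "step_t L L' \<Longrightarrow> step_t (Whr L M) (Whr L' M)"
| s_Whr2: "step_t M M' \<Longrightarrow> step_t (Whr L M) (Whr L M')"
| s_Mu: "step_j J J' \<Longrightarrow> step_t (Mu J) (Mu J')"
| s_Jmp: "step_t M M' \<Longrightarrow> step_j (Jmp k M) (Jmp k M')"
| s_JWhr1: "step_j J J' \<Longrightarrow> step_j (JWhr J M) (JWhr J' M)"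
| s_JWhr2: "step_t M M' \<Longrightarrow> step_j (JWhr J M) (JWhr J M')"

definition red :: "trm \<Rightarrow> trm \<Rightarrow> bool" where
  "red M N \<longleftrightarrow> (\<exists>M1 N1. eqv_t M M1 \<and> step_t M1 N1 \<and> eqv_t N1 N)"

definition normal_src :: "trm \<Rightarrow> bool" where
  "normal_src M \<longleftrightarrow> \<not> (\<exists>N. red M N)"

definition normalizable :: "trm \<Rightarrow> bool" where
  "normalizable M \<longleftrightarrow> (\<exists>M'. red\<^sup>*\<^sup>* M M' \<and> normal_src M')"

datatype lt = LV nat | LL lt | LA lt lt

primrec lift :: "nat \<Rightarrow> lt \<Rightarrow> lt" where
  "lift c (LV i) = LV (if i < c then i else Suc i)"
| "lift c (LL t) = LL (lift (Suc c) t)"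
| "lift c (LA s t) = LA (lift c s) (lift c t)"

primrec subst :: "lt \<Rightarrow> nat \<Rightarrow> lt \<Rightarrow> lt" where
  "subst (LV i) k s = (if i < k then LV i else if i = k then s else LV (i - 1))"
| "subst (LL t) k s = LL (subst t (Suc k) (lift 0 s))"
| "subst (LA t u) k s = LA (subst t k s) (subst u k s)"

inductive beta_eta :: "lt \<Rightarrow> lt \<Rightarrow> bool" where
  beta: "beta_eta (LA (LL t) s) (subst t 0 s)"
| eta: "beta_eta (LL (LA (lift 0 t) (LV 0))) t"
| cL: "beta_eta t t' \<Longrightarrow> beta_eta (LL t) (LL t')"
| cA1: "beta_eta t t' \<Longrightarrow> beta_eta (LA t u) (LA t' u)"
| cA2: "beta_eta u u' \<Longrightarrow> beta_eta (LA t u) (LA t u')"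

definition has_be_nf :: "lt \<Rightarrow> bool" where
  "has_be_nf t \<longleftrightarrow> (\<exists>t'. beta_eta\<^sup>*\<^sup>* t t' \<and> \<not> (\<exists>t''. beta_eta t' t''))"

text \<open>rho / sigma map free ordinary / continuation source indices to target indices;
K is the continuation (a target term in the current target context).\<close>

definition ext0 :: "(nat \<Rightarrow> nat) \<Rightarrow> nat \<Rightarrow> nat" where
  "ext0 \<rho> = (\<lambda>i. case i of 0 \<Rightarrow> 0 | Suc j \<Rightarrow> Suc (\<rho> j))"

fun cps :: "trm \<Rightarrow> (nat \<Rightarrow> nat) \<Rightarrow> (nat \<Rightarrow> nat) \<Rightarrow> lt \<Rightarrow> lt"
and vstar :: "trm \<Rightarrow> (nat \<Rightarrow> nat) \<Rightarrow> (nat \<Rightarrow> nat) \<Rightarrow> lt"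
and cpsj :: "jmp \<Rightarrow> (nat \<Rightarrow> nat) \<Rightarrow> (nat \<Rightarrow> nat) \<Rightarrow> lt" where
  "vstar (Var i) \<rho> \<sigma> = LV (\<rho> i)"
| "vstar (Lam M) \<rho> \<sigma> =
     LL (LL (cps M (\<lambda>i. case i of 0 \<Rightarrow> 1 | Suc j \<Rightarrow> \<rho> j + 2) (\<lambda>i. \<sigma> i + 2) (LV 0)))"
| "vstar (App M N) \<rho> \<sigma> = undefined"
| "vstar (Whr M N) \<rho> \<sigma> = undefined"
| "vstar (Mu J) \<rho> \<sigma> = undefined"
| "cps (Var i) \<rho> \<sigma> K = LA K (LV (\<rho> i))"
| "cps (Lam M) \<rho> \<sigma> K =
     LA K (LL (LL (cps M (\<lambda>i. case i of 0 \<Rightarrow> 1 | Suc j \<Rightarrow> \<rho> j + 2) (\<lambda>i. \<sigma> i + 2) (LV 0))))"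
| "cps (App M1 M2) \<rho> \<sigma> K =
     (if isval M1 \<and> isval M2 then LA (LA (vstar M1 \<rho> \<sigma>) (vstar M2 \<rho> \<sigma>)) K
      else if isval M1 then
        cps M2 \<rho> \<sigma> (LL (LA (LA (vstar M1 (Suc \<circ> \<rho>) (Suc \<circ> \<sigma>)) (LV 0)) (lift 0 K)))
      else if isval M2 then
        cps M1 \<rho> \<sigma> (LL (LA (LA (LV 0) (vstar M2 (Suc \<circ> \<rho>) (Suc \<circ> \<sigma>))) (lift 0 K)))
      else
        cps M1 \<rho> \<sigma> (LL (cps M2 (Suc \<circ> \<rho>) (Suc \<circ> \<sigma>)
                           (LL (LA (LA (LV 1) (LV 0)) (lift 0 (lift 0 K)))))))"
| "cps (Whr L M) \<rho> \<sigma> K = cps M \<rho> \<sigma> (LL (cps L (ext0 \<rho>) (Suc \<circ> \<sigma>) (lift 0 K)))"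
| "cps (Mu J) \<rho> \<sigma> K = LA (LL (cpsj J (Suc \<circ> \<rho>) (ext0 \<sigma>))) K"
| "cpsj (Jmp k M) \<rho> \<sigma> = cps M \<rho> \<sigma> (LV (\<sigma> k))"
| "cpsj (JWhr J M) \<rho> \<sigma> = cps M \<rho> \<sigma> (LL (cpsj J (ext0 \<rho>) (Suc \<circ> \<sigma>)))"

text \<open>[[M]] = \<lambda>k. <M>[k]; free ordinary variable i is sent to the target free
variable 2i and free continuation variable j to 2j+1 (injective, disjoint),
seen from under the outer binder.\<close>
definition cps_top :: "trm \<Rightarrow> lt" where
  "cps_top M = LL (cps M (\<lambda>i. Suc (2 * i)) (\<lambda>j. Suc (2 * j + 1)) (LV 0))"

end

theory Submission
  imports Defs "HOL-Library.Confluence"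
begin

text \<open>For the forward direction, the translation is rephrased as an interpretation with environments
that is invariant under the congruence and maps source reductions to beta-eta conversions; a source
normal form is interpreted by a beta-normal term, on which eta-reduction terminates, and confluence
of beta-eta transports the normal form back.

For the converse, target terms are read back as source terms: \<open>\<lambda>k.Q\<close> becomes \<open>\<mu>k.Q\<close>, a continuation
\<open>\<lambda>x.Q\<close> applied to \<open>M\<close> becomes \<open>Q where x:=M\<close>, and \<open>k M\<close> becomes \<open>[k]M\<close>. A source term reduces to a
read-back of its translation, every target reduction step is simulated by source reductions, and
the read-back of a normal target term is normal up to steps \<open>\<mu>k.[k]M \<rightarrow> M\<close>.\<close>

section \<open>Renaming and substitution in the target calculus\<close>

text \<open>The congruence is the obstacle in both directions: a redex may appear only after
  bindings are rearranged, and the given translation respects (E2) only up to beta. What makes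
  reading back work is that a target command has exactly one tail: in K W and T K follow K, entering
  its body while K is an abstraction, until a continuation variable is reached. By (E3) a source
  jump is likewise congruent to some [k]M with k in front. So a command can be read as a term M with
  the tail split off, and a continuation lambda x.Q becomes a where-context around such terms.
  Reading is a relation and not a function: if k occurs in q only as the tail, lambda k.q has the
  two readings mu k.[k]M and M, and the source step from the first to the second is the passage
  between them. The tail of a command is not stable under target reduction, because (lambda k.q) h
  may contract to a command with another tail. Therefore commands and continuations satisfy only a
  weaker form of simulation than terms and values.\<close>

definition up :: "(nat \<Rightarrow> nat) \<Rightarrow> nat \<Rightarrow> nat" where
  "up f = case_nat 0 (\<lambda>i. Suc (f i))"

lemma up_simps [simp]: "up f 0 = 0" "up f (Suc i) = Suc (f i)"
  by (simp_all add: up_def)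

lemma up_id [simp]: "up id = id" "up (\<lambda>i. i) = (\<lambda>i. i)"
  by (auto simp: fun_eq_iff up_def split: nat.split)

lemma up_comp: "up f (up g i) = up (f \<circ> g) i"
  by (cases i) auto

primrec ren :: "(nat \<Rightarrow> nat) \<Rightarrow> lt \<Rightarrow> lt" where
  "ren f (LV i) = LV (f i)"
| "ren f (LL t) = LL (ren (up f) t)"
| "ren f (LA s t) = LA (ren f s) (ren f t)"

definition ups :: "(nat \<Rightarrow> lt) \<Rightarrow> nat \<Rightarrow> lt" where
  "ups \<theta> = case_nat (LV 0) (\<lambda>i. ren Suc (\<theta> i))"

lemma ups_simps [simp]: "ups \<theta> 0 = LV 0" "ups \<theta> (Suc i) = ren Suc (\<theta> i)"
  by (simp_all add: ups_def)

primrec psub :: "(nat \<Rightarrow> lt) \<Rightarrow> lt \<Rightarrow> lt" where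
  "psub \<theta> (LV i) = \<theta> i"
| "psub \<theta> (LL t) = LL (psub (ups \<theta>) t)"
| "psub \<theta> (LA s t) = LA (psub \<theta> s) (psub \<theta> t)"

primrec fv :: "lt \<Rightarrow> nat set" where
  "fv (LV i) = {i}"
| "fv (LL t) = {i. Suc i \<in> fv t}"
| "fv (LA s t) = fv s \<union> fv t"

lemma ren_cong: "(\<And>i. i \<in> fv t \<Longrightarrow> f i = g i) \<Longrightarrow> ren f t = ren g t"
proof (induction t arbitrary: f g)
  case (LL t)
  have "ren (up f) t = ren (up g) t"
    using LL.prems by (intro LL.IH) (auto simp: up_def split: nat.split)
  then show ?case by simp
next
  case (LA s t)
  then show ?case by (metis Un_iff fv.simps(3) ren.simps(3))
qed auto

lemma psub_cong: "(\<And>i. i \<in> fv t \<Longrightarrow> \<theta> i = \<theta>' i) \<Longrightarrow> psub \<theta> t = psub \<theta>' t"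
proof (induction t arbitrary: \<theta> \<theta>')
  case (LL t)
  have "psub (ups \<theta>) t = psub (ups \<theta>') t"
    using LL.prems by (intro LL.IH) (auto simp: ups_def split: nat.split)
  then show ?case by simp
next
  case (LA s t)
  then show ?case by (metis Un_iff fv.simps(3) psub.simps(3))
qed auto

lemma ren_id [simp]: "ren id t = t" "ren (\<lambda>i. i) t = t"
proof -
  show "ren id t = t" by (induction t) auto
  then show "ren (\<lambda>i. i) t = t" by (simp add: id_def)
qed

lemma size_ren [simp]: "size (ren f t) = size t"
  by (induction t arbitrary: f) auto

lemma ren_ren: "ren f (ren g t) = ren (\<lambda>i. f (g i)) t"
proof (induction t arbitrary: f g)
  case (LL t)
  have "(\<lambda>i. up f (up g i)) = up (\<lambda>i. f (g i))"
    by (auto simp: fun_eq_iff up_comp comp_def)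
  then show ?case using LL by simp
qed auto

lemma ren_conv_psub: "ren f t = psub (\<lambda>i. LV (f i)) t"
proof (induction t arbitrary: f)
  case (LL t)
  have "(\<lambda>i. LV (up f i)) = ups (\<lambda>i. LV (f i))"
    by (auto simp: fun_eq_iff up_def ups_def split: nat.split)
  then show ?case using LL by simp
qed auto

lemma psub_LV [simp]: "psub LV t = t"
  using ren_conv_psub[of id t] by (simp add: comp_def)

lemma psub_ren: "psub \<theta> (ren f t) = psub (\<lambda>i. \<theta> (f i)) t"
proof (induction t arbitrary: f \<theta>)
  case (LL t)
  have "(\<lambda>i. ups \<theta> (up f i)) = ups (\<lambda>i. \<theta> (f i))"
    by (auto simp: fun_eq_iff up_def ups_def split: nat.split)
  then show ?case using LL by simp
qed auto

lemma ren_psub: "ren f (psub \<theta> t) = psub (\<lambda>i. ren f (\<theta> i)) t"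
proof (induction t arbitrary: f \<theta>)
  case (LL t)
  have "(\<lambda>i. ren (up f) (ups \<theta> i)) = ups (\<lambda>i. ren f (\<theta> i))"
    by (auto simp: fun_eq_iff ups_def ren_ren split: nat.split)
  then show ?case using LL by simp
qed auto

lemma psub_psub: "psub \<theta> (psub \<theta>' t) = psub (\<lambda>i. psub \<theta> (\<theta>' i)) t"
proof (induction t arbitrary: \<theta> \<theta>')
  case (LL t)
  have "(\<lambda>i. psub (ups \<theta>) (ups \<theta>' i)) = ups (\<lambda>i. psub \<theta> (\<theta>' i))"
    by (auto simp: fun_eq_iff ups_def psub_ren ren_psub split: nat.split)
  then show ?case using LL by simp
qed auto

definition skip :: "nat \<Rightarrow> nat \<Rightarrow> nat" where
  "skip c i = (if i < c then i else Suc i)"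

lemma up_skip [simp]: "up (skip c) = skip (Suc c)"
  by (auto simp: fun_eq_iff up_def skip_def split: nat.split)

lemma skip_0 [simp]: "skip 0 = Suc"
  by (auto simp: fun_eq_iff skip_def)

lemma lift_conv_ren: "lift c t = ren (skip c) t"
  by (induction t arbitrary: c) (auto simp: skip_def)

lemma lift_0 [simp]: "lift 0 = ren Suc"
  by (simp add: fun_eq_iff lift_conv_ren)

lemma subst_conv_psub:
  "subst t k s = psub (\<lambda>i. if i < k then LV i else if i = k then s else LV (i - 1)) t"
proof (induction t arbitrary: k s)
  case (LL t)
  have "ups (\<lambda>i. if i < k then LV i else if i = k then s else LV (i - 1)) =
    (\<lambda>i. if i < Suc k then LV i else if i = Suc k then ren Suc s else LV (i - 1))"
    by (auto simp: fun_eq_iff ups_def split: nat.split)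
  then show ?case using LL[of "Suc k" "ren Suc s"] by simp
qed auto

lemma subst_0: "subst t 0 s = psub (case_nat s LV) t"
  unfolding subst_conv_psub by (rule arg_cong2[where f = psub]) (auto simp: fun_eq_iff split: nat.split)

lemma fv_ren: "fv (ren f t) = f ` fv t"
proof (induction t arbitrary: f)
  case (LL t)
  show ?case
  proof (intro set_eqI iffI)
    fix i assume "i \<in> fv (ren f (LL t))"
    then obtain j where "j \<in> fv t" "Suc i = up f j" using LL by auto
    then show "i \<in> f ` fv (LL t)" by (cases j) auto
  next
    fix i assume "i \<in> f ` fv (LL t)"
    then obtain j where "Suc j \<in> fv t" "i = f j" by auto
    then have "Suc i \<in> up f ` fv t" by (metis imageI up_simps(2))
    then show "i \<in> fv (ren f (LL t))" using LL by simp
  qed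
qed auto

lemma fv_psub: "fv (psub \<theta> t) = (\<Union>i\<in>fv t. fv (\<theta> i))"
proof (induction t arbitrary: \<theta>)
  case (LL t)
  show ?case
  proof (intro set_eqI iffI)
    fix i assume "i \<in> fv (psub \<theta> (LL t))"
    then obtain j where "j \<in> fv t" "Suc i \<in> fv (ups \<theta> j)" using LL by auto
    then show "i \<in> (\<Union>i\<in>fv (LL t). fv (\<theta> i))" by (cases j) (auto simp: fv_ren)
  next
    fix i assume "i \<in> (\<Union>i\<in>fv (LL t). fv (\<theta> i))"
    then obtain j where "Suc j \<in> fv t" "i \<in> fv (\<theta> j)" by auto
    then have "Suc i \<in> (\<Union>i\<in>fv t. fv (ups \<theta> i))"
      by (intro UN_I[of "Suc j"]) (auto simp: fv_ren)
    then show "i \<in> fv (psub \<theta> (LL t))" using LL by simp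
  qed
qed auto

text \<open>A left inverse of the shift \<open>ren Suc\<close>. It is a right inverse only where
  index 0 is not free, since truncated subtraction sends both 0 and 1 to 0.\<close>

abbreviation dn :: "lt \<Rightarrow> lt" where "dn \<equiv> ren (\<lambda>i. i - Suc 0)"

lemma ren_Suc_dn: "0 \<notin> fv t \<Longrightarrow> ren Suc (dn t) = t"
  by (metis (no_types, lifting) Suc_pred gr0I ren_cong ren_id(2) ren_ren)

lemma dn_ren_Suc [simp]: "dn (ren Suc t) = t"
  by (simp add: ren_ren)

lemma psub_ren_Suc [simp]: "psub (case_nat s \<theta>) (ren Suc t) = psub \<theta> t"
  by (simp add: psub_ren)

section \<open>Confluence of beta-eta reduction\<close>

text \<open>Parallel contraction of beta and eta redexes. \<open>pE\<close> tests freeness in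
  \<open>t\<close> but lowers \<open>t'\<close>, which is sound because parallel steps create no
  free variables (\<open>par_fv\<close>).\<close>

inductive par :: "lt \<Rightarrow> lt \<Rightarrow> bool" where
  pV: "par (LV i) (LV i)"
| pL: "par t t' \<Longrightarrow> par (LL t) (LL t')"
| pA: "par s s' \<Longrightarrow> par t t' \<Longrightarrow> par (LA s t) (LA s' t')"
| pB: "par t t' \<Longrightarrow> par s s' \<Longrightarrow> par (LA (LL t) s) (psub (case_nat s' LV) t')"
| pE: "par t t' \<Longrightarrow> 0 \<notin> fv t \<Longrightarrow> par (LL (LA t (LV 0))) (dn t')"

lemma par_refl [simp, intro]: "par t t"
  by (induction t) (auto intro: par.intros)

lemma par_fv: "par t t' \<Longrightarrow> fv t' \<subseteq> fv t"
proof (induction rule: par.induct)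
  case (pB t t' s s')
  then show ?case by (auto simp: fv_psub split: nat.splits)
next
  case (pE t t')
  then show ?case by (auto simp: fv_ren) (metis Suc_pred gr0I in_mono)
qed auto

lemma par_ren: "par t t' \<Longrightarrow> par (ren f t) (ren f t')"
proof (induction arbitrary: f rule: par.induct)
  case (pB t t' s s')
  have "ren f (psub (case_nat s' LV) t') = psub (case_nat (ren f s') LV) (ren (up f) t')"
    unfolding ren_psub psub_ren
    by (rule psub_cong) (auto split: nat.split)
  then show ?case using par.pB[OF pB.IH(1)[of "up f"] pB.IH(2)[of f]] by simp
next
  case (pE t t')
  have "0 \<notin> fv t'" using pE par_fv by blast
  then have "ren f (dn t') = dn (ren (up f) t')"
    unfolding ren_ren by (intro ren_cong) (auto simp: up_def split: nat.split)
  moreover have "0 \<notin> fv (ren (up f) t)"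
    using pE by (auto simp: fv_ren up_def split: nat.splits)
  ultimately show ?case using par.pE[OF pE.IH[of "up f"]] by simp
qed (auto intro: par.intros)

lemma par_ups: "(\<And>i. par (\<theta> i) (\<theta>' i)) \<Longrightarrow> par (ups \<theta> i) (ups \<theta>' i)"
  by (cases i) (auto intro: par_ren)

lemma par_psub: "par t t' \<Longrightarrow> (\<And>i. par (\<theta> i) (\<theta>' i)) \<Longrightarrow> par (psub \<theta> t) (psub \<theta>' t')"
proof (induction arbitrary: \<theta> \<theta>' rule: par.induct)
  case (pL t t')
  then show ?case by (auto intro!: par.pL par_ups)
next
  case (pB t t' s s')
  have "psub \<theta>' (psub (case_nat s' LV) t') = psub (case_nat (psub \<theta>' s') LV) (psub (ups \<theta>') t')"
    unfolding psub_psub by (rule psub_cong) (auto split: nat.split)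
  moreover have "par (psub (ups \<theta>) t) (psub (ups \<theta>') t')"
    using pB by (auto intro!: pB.IH par_ups)
  ultimately show ?case using par.pB pB by simp
next
  case (pE t t')
  have "0 \<notin> fv t'" using pE par_fv by blast
  then have "psub \<theta>' (dn t') = dn (psub (ups \<theta>') t')"
    unfolding psub_ren ren_psub
    by (intro psub_cong) (auto simp: ups_def split: nat.split)
  moreover have "0 \<notin> fv (psub (ups \<theta>) t)"
    using pE by (auto simp: fv_psub fv_ren ups_def intro!: gr0I split: nat.splits)
  moreover have "par (psub (ups \<theta>) t) (psub (ups \<theta>') t')"
    using pE by (auto intro!: pE.IH par_ups)
  ultimately show ?case using par.pE by simp
qed (auto intro: par.intros)

lemma par_subst: "par t t' \<Longrightarrow> par s s' \<Longrightarrow> par (psub (case_nat s LV) t) (psub (case_nat s' LV) t')"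
  by (rule par_psub) (auto split: nat.split)

inductive_cases par_LV [elim!]: "par (LV i) u"
inductive_cases par_LL: "par (LL t) u"
inductive_cases par_LA: "par (LA s t) u"

text \<open>Takahashi's complete development, extended by eta. Beta and eta overlap in two ways: in
  lambda x.(lambda y.r) x with x not free in r eta is preferred, in (lambda x.p x) s beta. Either
  contraction gives the same term, so the preference is harmless.\<close>

fun cd :: "lt \<Rightarrow> lt" where
  "cd (LV i) = LV i"
| "cd (LL t) = (case t of LA s (LV 0) \<Rightarrow> if 0 \<notin> fv s then dn (cd s) else LL (cd t) | _ \<Rightarrow> LL (cd t))"
| "cd (LA (LL t) s) = psub (case_nat (cd s) LV) (cd t)"
| "cd (LA (LV i) s) = LA (LV i) (cd s)"
| "cd (LA (LA t u) s) = LA (cd (LA t u)) (cd s)"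

lemma cd_LL:
  "(\<exists>s. t = LA s (LV 0) \<and> 0 \<notin> fv s \<and> cd (LL t) = dn (cd s)) \<or>
   (\<not> (\<exists>s. t = LA s (LV 0) \<and> 0 \<notin> fv s) \<and> cd (LL t) = LL (cd t))"
  by (auto split: lt.split nat.split)

lemma cd_LA: "(\<exists>t. s = LL t) \<or> cd (LA s u) = LA (cd s) (cd u)"
  by (cases s) auto

lemma par_cd_refl: "par t (cd t)"
proof (induction "size t" arbitrary: t rule: less_induct)
  case less
  show ?case
  proof (cases t)
    case (LL r)
    show ?thesis
    proof (cases "\<exists>s. r = LA s (LV 0) \<and> 0 \<notin> fv s")
      case True
      then obtain s where "r = LA s (LV 0)" "0 \<notin> fv s" by auto
      then show ?thesis using LL less by (auto intro: par.pE)
    next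
      case False
      then show ?thesis using cd_LL[of r] LL less par.pL[of r "cd r"] by auto
    qed
  next
    case (LA u v)
    have "par u (cd u)" "par v (cd v)" using less LA by auto
    moreover have "par w (cd w)" if "u = LL w" for w using less LA that by auto
    ultimately show ?thesis using LA by (cases u) (auto intro: par.intros)
  qed auto
qed

text \<open>The overlap of beta and eta compares the developments of a term and of its shift, so
  \<open>cd\<close> must commute with renaming. The danger is a renaming that creates an eta redex;
  \<open>up f\<close> sends only 0 to 0, which excludes this.\<close>

lemma cd_ren: "cd (ren f t) = ren f (cd t)"
proof (induction "size t" arbitrary: t f rule: less_induct)
  case less
  show ?case
  proof (cases t)
    case (LV i)
    then show ?thesis by simp
  next
    case (LA u v)
    then have IH: "cd (ren g u) = ren g (cd u)" "cd (ren g v) = ren g (cd v)" for g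
      using less by auto
    show ?thesis
    proof (cases u)
      case (LL w)
      then have "cd (ren g w) = ren g (cd w)" for g using less LA by auto
      then show ?thesis
        using LA LL IH by (auto simp: psub_ren ren_psub intro!: psub_cong split: nat.split)
    qed (use LA IH in auto)
  next
    case (LL r)
    show ?thesis
    proof (cases "\<exists>s. r = LA s (LV 0) \<and> 0 \<notin> fv s")
      case True
      then obtain s where s: "r = LA s (LV 0)" "0 \<notin> fv s" by auto
      then have "0 \<notin> fv (ren (up f) s)" by (auto simp: fv_ren up_def split: nat.splits)
      moreover have "0 \<notin> fv (cd s)" using par_fv[OF par_cd_refl] s by blast
      then have "dn (ren (up f) (cd s)) = ren f (dn (cd s))"
        unfolding ren_ren by (intro ren_cong) (auto simp: up_def split: nat.split)
      moreover have "cd (ren (up f) s) = ren (up f) (cd s)" using less LL s by auto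
      ultimately show ?thesis using s LL by simp
    next
      case False
      have "\<not> (\<exists>s. ren (up f) r = LA s (LV 0) \<and> 0 \<notin> fv s)"
      proof
        assume "\<exists>s. ren (up f) r = LA s (LV 0) \<and> 0 \<notin> fv s"
        then obtain s where s: "ren (up f) r = LA s (LV 0)" "0 \<notin> fv s" by auto
        then obtain s0 t0 where t0: "r = LA s0 t0" "s = ren (up f) s0" "ren (up f) t0 = LV 0"
          by (cases r) auto
        then obtain i where t: "t0 = LV i" "up f i = 0"
          by (cases t0) auto
        then have "i = 0" by (cases i) auto
        moreover have "0 \<notin> fv s0" using s t0 by (auto simp: fv_ren image_iff)
        ultimately show False using False t0 t by blast
      qed
      then have "cd (ren f (LL r)) = LL (cd (ren (up f) r))" "cd (LL r) = LL (cd r)"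
        using cd_LL[of r] cd_LL[of "ren (up f) r"] False by auto
      moreover have "cd (ren (up f) r) = ren (up f) (cd r)"
        using less LL by auto
      ultimately show ?thesis using LL by simp
    qed
  qed
qed

text \<open>The triangle property: all parallel reducts of \<open>t\<close> meet in
  \<open>cd t\<close>, which yields the diamond property. Induction is on size because in the
  overlap (lambda x.p x) v the hypothesis is applied to p v, which is smaller but not a
  subterm.\<close>

lemma par_cd: "par t u \<Longrightarrow> par u (cd t)"
proof (induction "size t" arbitrary: t u rule: less_induct)
  case less
  note IH = less.hyps
  from less.prems show ?case
  proof (cases rule: par.cases)
    case (pV i)
    then show ?thesis by auto
  next
    case (pA s s' v v')
    show ?thesis
    proof (cases "\<exists>r. s = LL r")
      case False
      then have "cd t = LA (cd s) (cd v)" using cd_LA pA by blast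
      then show ?thesis using pA IH by (auto intro!: par.pA)
    next
      case True
      then obtain r where r: "s = LL r" by auto
      have v: "par v' (cd v)" using IH pA by auto
      have cdt: "cd t = psub (case_nat (cd v) LV) (cd r)" using pA r by simp
      consider (1) r' where "s' = LL r'" "par r r'"
        | (2) p p' where "r = LA p (LV 0)" "s' = dn p'" "par p p'" "0 \<notin> fv p"
        using pA(3)[unfolded r] by (blast elim: par_LL)
      then show ?thesis
      proof cases
        case (1 r')
        then have "par r' (cd r)" using IH pA r by auto
        then show ?thesis using 1 pA v cdt by (auto intro: par.pB)
      next
        case (2 p p')
        then have r': "r = LA p (LV 0)" by simp
        let ?p = "dn p"
        have p: "ren Suc ?p = p" using 2 ren_Suc_dn by blast
        have "par (LA ?p v) (LA (dn p') v')" using 2 pA par_ren by (auto intro!: par.pA)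
        moreover have "size (LA ?p v) < size t" using pA r r' by simp
        ultimately have "par (LA (dn p') v') (cd (LA ?p v))" using IH by blast
        moreover have "cd (LA ?p v) = cd t"
        proof (cases "\<exists>q. ?p = LL q")
          case False
          then have "\<not> (\<exists>q. p = LL q)" by (metis p lt.exhaust lt.distinct ren.simps)
          then have "cd r = LA (cd p) (LV 0)" using r' cd_LA[of p "LV 0"] by auto
          moreover have "cd p = ren Suc (cd ?p)" using p cd_ren by metis
          moreover have "cd (LA ?p v) = LA (cd ?p) (cd v)" using False cd_LA by blast
          ultimately show ?thesis using cdt by simp
        next
          case True
          then obtain q where q: "?p = LL q" by auto
          then have "p = LL (ren (up Suc) q)" using p by (metis ren.simps(2))
          then have "cd r = psub (case_nat (LV 0) LV) (ren (up Suc) (cd q))" using r' cd_ren by simp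
          then have "cd r = cd q"
            unfolding psub_ren by (simp, subst (2) psub_LV[symmetric])
              (rule psub_cong, auto simp: up_def split: nat.split)
          then show ?thesis using cdt q by simp
        qed
        ultimately show ?thesis using 2 pA by simp
      qed
    qed
  next
    case (pB s s' v v')
    then show ?thesis using IH by (auto intro!: par_subst)
  next
    case (pE s s')
    then have "cd t = dn (cd s)" by simp
    moreover have "par s' (cd s)" using IH pE by auto
    ultimately show ?thesis using pE par_ren by simp
  next
    case (pL s s')
    show ?thesis
    proof (cases "\<exists>p. s = LA p (LV 0) \<and> 0 \<notin> fv p")
      case False
      then have "cd t = LL (cd s)" using cd_LL[of s] pL by auto
      then show ?thesis using IH pL by (auto intro!: par.pL)
    next
      case True
      then obtain p where p: "s = LA p (LV 0)" "0 \<notin> fv p" by auto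
      have cdt: "cd t = dn (cd p)" using pL p by simp
      consider (1) p' z where "s' = LA p' z" "par p p'" "par (LV 0) z"
        | (2) r r' z where "p = LL r" "s' = psub (case_nat z LV) r'" "par r r'" "par (LV 0) z"
        using pL(3)[unfolded p(1)] by (blast elim: par_LA)
      then show ?thesis
      proof cases
        case (1 p' z)
        then have "par p' (cd p)" "0 \<notin> fv p'" using IH pL p par_fv[of p p'] by auto
        then show ?thesis using pL 1 cdt par.pE by auto
      next
        case (2 r r' z)
        have "0 \<notin> fv (LL r)" using 2 p by simp
        have "par (LL r) (LL r')" using 2 by (auto intro: par.pL)
        moreover have "size (LL r) < size t" using pL p 2 by simp
        ultimately have "par (LL r') (cd p)" using IH 2(1) by blast
        then have "par (dn (LL r')) (dn (cd p))" by (rule par_ren)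
        \<comment> \<open>Contracting beta in lambda x.(lambda y.r) x only renames the bound
          variable, so the reduct is the eta contractum in disguise.\<close>
        moreover have "dn (LL r') = LL s'"
        proof -
          have z: "z = LV 0" using 2 by auto
          have "0 \<notin> fv (LL r')" using \<open>par (LL r) (LL r')\<close> \<open>0 \<notin> fv (LL r)\<close> par_fv by blast
          then have "ren (up (\<lambda>i. i - Suc 0)) r' = psub (case_nat (LV 0) LV) r'"
            unfolding ren_conv_psub
            by (intro psub_cong) (auto simp: up_def split: nat.split intro!: Suc_pred gr0I)
          then show ?thesis using 2 z by simp
        qed
        ultimately show ?thesis using cdt pL by simp
      qed
    qed
  qed
qed

section \<open>Confluence and convertibility\<close>

lemma be_LL: "beta_eta\<^sup>*\<^sup>* t t' \<Longrightarrow> beta_eta\<^sup>*\<^sup>* (LL t) (LL t')"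
  by (induction rule: rtranclp_induct) (auto intro: beta_eta.cL rtranclp.rtrancl_into_rtrancl)

lemma be_LA: "beta_eta\<^sup>*\<^sup>* s s' \<Longrightarrow> beta_eta\<^sup>*\<^sup>* t t' \<Longrightarrow> beta_eta\<^sup>*\<^sup>* (LA s t) (LA s' t')"
proof -
  assume "beta_eta\<^sup>*\<^sup>* s s'"
  then have "beta_eta\<^sup>*\<^sup>* (LA s t) (LA s' t)"
    by (induction rule: rtranclp_induct) (auto intro: beta_eta.cA1 rtranclp.rtrancl_into_rtrancl)
  moreover assume "beta_eta\<^sup>*\<^sup>* t t'"
  then have "beta_eta\<^sup>*\<^sup>* (LA s' t) (LA s' t')"
    by (induction rule: rtranclp_induct) (auto intro: beta_eta.cA2 rtranclp.rtrancl_into_rtrancl)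
  ultimately show ?thesis by simp
qed

lemma be_beta: "beta_eta (LA (LL t) s) (psub (case_nat s LV) t)"
  using beta_eta.beta subst_0 by metis

lemma be_eta: "beta_eta (LL (LA (ren Suc t) (LV 0))) t"
  using beta_eta.eta[of t] by simp

lemma beta_eta_par: "beta_eta t t' \<Longrightarrow> par t t'"
proof (induction rule: beta_eta.induct)
  case (eta t)
  then show ?case using par.pE[of "ren Suc t" "ren Suc t"] by (auto simp: fv_ren)
qed (auto intro: par.intros simp: subst_0)

lemma par_beta_eta: "par t t' \<Longrightarrow> beta_eta\<^sup>*\<^sup>* t t'"
proof (induction rule: par.induct)
  case (pB t t' s s')
  then have "beta_eta\<^sup>*\<^sup>* (LA (LL t) s) (LA (LL t') s')" by (intro be_LA be_LL)
  then show ?case using be_beta by (auto intro: rtranclp.rtrancl_into_rtrancl)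
next
  case (pE t t')
  then have "beta_eta\<^sup>*\<^sup>* (LL (LA t (LV 0))) (LL (LA t' (LV 0)))" by (intro be_LA be_LL) auto
  moreover have "ren Suc (dn t') = t'" using pE par_fv ren_Suc_dn by blast
  ultimately show ?case using be_eta[of "dn t'"] by (auto intro: rtranclp.rtrancl_into_rtrancl)
qed (auto intro: be_LL be_LA)

lemma confluentp_beta_eta: "confluentp beta_eta"
proof -
  have "strong_confluentp par"
    by (rule strong_confluentpI) (blast intro: par_cd)
  then have "confluentp par" by (rule strong_confluentp_imp_confluentp)
  moreover have "par\<^sup>*\<^sup>* = beta_eta\<^sup>*\<^sup>*"
  proof (rule antisym)
    show "par\<^sup>*\<^sup>* \<le> beta_eta\<^sup>*\<^sup>*"
      by (metis par_beta_eta predicate2I rtranclp_idemp rtranclp_mono)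
    show "beta_eta\<^sup>*\<^sup>* \<le> par\<^sup>*\<^sup>*"
      by (intro rtranclp_mono) (auto intro: beta_eta_par)
  qed
  ultimately show ?thesis by (metis confluentp_conv_strong_confluentp_rtranclp)
qed

text \<open>Joinability makes compatibility with the term constructors immediate; confluence then
  supplies transitivity.\<close>

definition conv :: "lt \<Rightarrow> lt \<Rightarrow> bool"  (infix "\<approx>" 50) where
  "s \<approx> t \<longleftrightarrow> (\<exists>u. beta_eta\<^sup>*\<^sup>* s u \<and> beta_eta\<^sup>*\<^sup>* t u)"

lemma conv_refl [simp, intro]: "t \<approx> t"
  by (auto simp: conv_def)

lemma conv_sym: "s \<approx> t \<Longrightarrow> t \<approx> s"
  by (auto simp: conv_def)

lemma conv_trans [trans]: "s \<approx> t \<Longrightarrow> t \<approx> u \<Longrightarrow> s \<approx> u"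
  unfolding conv_def by (meson confluentpD[OF confluentp_beta_eta] rtranclp_trans)

lemma conv_LL: "s \<approx> t \<Longrightarrow> LL s \<approx> LL t"
  unfolding conv_def by (meson be_LL)

lemma conv_LA: "s \<approx> s' \<Longrightarrow> t \<approx> t' \<Longrightarrow> LA s t \<approx> LA s' t'"
  unfolding conv_def by (meson be_LA)

lemma conv_beta: "LA (LL t) s \<approx> psub (case_nat s LV) t"
  unfolding conv_def using be_beta by blast

lemma conv_eta: "LL (LA (ren Suc t) (LV 0)) \<approx> t"
  unfolding conv_def using be_eta by blast

lemma be_ren: "beta_eta\<^sup>*\<^sup>* s t \<Longrightarrow> beta_eta\<^sup>*\<^sup>* (ren f s) (ren f t)"
proof (induction rule: rtranclp_induct)
  case (step t u)
  then have "beta_eta\<^sup>*\<^sup>* (ren f t) (ren f u)" by (intro par_beta_eta par_ren beta_eta_par)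
  then show ?case using step by simp
qed simp

lemma conv_ren: "s \<approx> t \<Longrightarrow> ren f s \<approx> ren f t"
  unfolding conv_def by (meson be_ren)

lemma has_be_nf_conv: "s \<approx> t \<Longrightarrow> has_be_nf t \<Longrightarrow> has_be_nf s"
  unfolding has_be_nf_def conv_def
  by (metis confluentpD[OF confluentp_beta_eta] converse_rtranclpE rtranclp_trans)

section \<open>Renaming and substitution in the source calculus\<close>

primrec ren_t :: "(nat \<Rightarrow> nat) \<Rightarrow> (nat \<Rightarrow> nat) \<Rightarrow> trm \<Rightarrow> trm"
  and ren_j :: "(nat \<Rightarrow> nat) \<Rightarrow> (nat \<Rightarrow> nat) \<Rightarrow> jmp \<Rightarrow> jmp" where
  "ren_t a b (Var i) = Var (a i)"
| "ren_t a b (Lam M) = Lam (ren_t (up a) b M)"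
| "ren_t a b (App M N) = App (ren_t a b M) (ren_t a b N)"
| "ren_t a b (Whr L M) = Whr (ren_t (up a) b L) (ren_t a b M)"
| "ren_t a b (Mu J) = Mu (ren_j a (up b) J)"
| "ren_j a b (Jmp k M) = Jmp (b k) (ren_t a b M)"
| "ren_j a b (JWhr J M) = JWhr (ren_j (up a) b J) (ren_t a b M)"

primrec fk_t :: "trm \<Rightarrow> nat set" and fk_j :: "jmp \<Rightarrow> nat set" where
  "fk_t (Var i) = {}"
| "fk_t (Lam M) = fk_t M"
| "fk_t (App M N) = fk_t M \<union> fk_t N"
| "fk_t (Whr L M) = fk_t L \<union> fk_t M"
| "fk_t (Mu J) = {k. Suc k \<in> fk_j J}"
| "fk_j (Jmp k M) = insert k (fk_t M)"
| "fk_j (JWhr J M) = fk_j J \<union> fk_t M"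

lemma ren_id_t [simp]: "ren_t id id M = M" "ren_j id id J = J"
  by (induction M and J) auto

lemma ren_ident_t [simp]: "ren_t (\<lambda>i. i) (\<lambda>i. i) M = M"
  using ren_id_t(1)[of M] by (simp add: id_def)

lemma ren_ren_t:
  "ren_t a b (ren_t a' b' M) = ren_t (\<lambda>i. a (a' i)) (\<lambda>i. b (b' i)) M"
  "ren_j a b (ren_j a' b' J) = ren_j (\<lambda>i. a (a' i)) (\<lambda>i. b (b' i)) J"
  by (induction M and J arbitrary: a b a' b' and a b a' b') (simp_all add: up_comp comp_def)

lemma ren_cong_fk:
  "(\<And>k. k \<in> fk_t M \<Longrightarrow> b k = b' k) \<Longrightarrow> ren_t a b M = ren_t a b' M"
  "(\<And>k. k \<in> fk_j J \<Longrightarrow> b k = b' k) \<Longrightarrow> ren_j a b J = ren_j a b' J"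
proof (induction M and J arbitrary: a b b' and a b b')
  case (Mu J)
  have "ren_j a (up b) J = ren_j a (up b') J"
    by (rule Mu.IH) (use Mu.prems in \<open>auto simp: up_def split: nat.split\<close>)
  then show ?case by simp
next
  case (Lam M)
  have "ren_t (up a) b M = ren_t (up a) b' M"
    by (rule Lam.IH) (auto intro: Lam.prems)
  then show ?case by simp
next
  case (App M N)
  have "ren_t a b M = ren_t a b' M"
    by (rule App.IH(1)) (auto intro: App.prems)
  moreover have "ren_t a b N = ren_t a b' N"
    by (rule App.IH(2)) (auto intro: App.prems)
  ultimately show ?case by simp
next
  case (Whr L M)
  have "ren_t (up a) b L = ren_t (up a) b' L"
    by (rule Whr.IH(1)) (auto intro: Whr.prems)
  moreover have "ren_t a b M = ren_t a b' M"
    by (rule Whr.IH(2)) (auto intro: Whr.prems)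
  ultimately show ?case by simp
next
  case (Jmp k M)
  have "ren_t a b M = ren_t a b' M"
    by (rule Jmp.IH) (auto intro: Jmp.prems)
  then show ?case using Jmp.prems[of k] by simp
next
  case (JWhr J M)
  have "ren_j (up a) b J = ren_j (up a) b' J"
    by (rule JWhr.IH(1)) (auto intro: JWhr.prems)
  moreover have "ren_t a b M = ren_t a b' M"
    by (rule JWhr.IH(2)) (auto intro: JWhr.prems)
  ultimately show ?case by simp
qed auto

lemma fk_ren:
  "fk_t (ren_t a b M) = b ` fk_t M"
  "fk_j (ren_j a b J) = b ` fk_j J"
proof (induction M and J arbitrary: a b and a b)
  case (Mu J)
  show ?case
  proof (intro set_eqI iffI)
    fix i assume "i \<in> fk_t (ren_t a b (Mu J))"
    then obtain j where "j \<in> fk_j J" "Suc i = up b j" using Mu by auto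
    then show "i \<in> b ` fk_t (Mu J)" by (cases j) auto
  next
    fix i assume "i \<in> b ` fk_t (Mu J)"
    then obtain j where "Suc j \<in> fk_j J" "i = b j" by auto
    then have "Suc i \<in> up b ` fk_j J" by (metis imageI up_simps(2))
    then show "i \<in> fk_t (ren_t a b (Mu J))" using Mu by simp
  qed
qed auto

lemma liftx_conv_ren: "liftx_t c M = ren_t (skip c) id M" "liftx_j c J = ren_j (skip c) id J"
  by (induction M and J arbitrary: c and c) (auto simp: skip_def[of c for c])

lemma liftk_conv_ren: "liftk_t c M = ren_t id (skip c) M" "liftk_j c J = ren_j id (skip c) J"
  by (induction M and J arbitrary: c and c) (auto simp: skip_def[of c for c])

definition merge :: "nat \<Rightarrow> nat \<Rightarrow> nat \<Rightarrow> nat" where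
  "merge c l i = (if i < c then i else if i = c then l else i - 1)"

lemma up_merge [simp]: "up (merge c l) = merge (Suc c) (Suc l)"
  by (auto simp: fun_eq_iff up_def merge_def split: nat.split)

lemma renk_conv_ren: "renk_t M c l = ren_t id (merge c l) M" "renk_j J c l = ren_j id (merge c l) J"
  by (induction M and J arbitrary: c l and c l) (auto simp: merge_def[of c l for c l])

text \<open>Converts a free-variable test into the shape \<open>liftk_t 0 _\<close> that
  \<open>r_muJmp\<close> matches on.\<close>

lemma not_free_liftk: "0 \<notin> fk_t M \<Longrightarrow> liftk_t 0 (ren_t id (\<lambda>i. i - Suc 0) M) = M"
proof -
  assume *: "0 \<notin> fk_t M"
  have "ren_t id (\<lambda>i. Suc (i - Suc 0)) M = ren_t id id M"
    by (rule ren_cong_fk) (use * in \<open>auto intro!: Suc_pred gr0I\<close>)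
  then show ?thesis by (simp add: liftk_conv_ren ren_ren_t id_def)
qed

lemma isval_ren [simp]: "isval (ren_t a b M) = isval M"
  by (cases M) auto

section \<open>Simultaneous substitution of values and contexts in the source\<close>

fun plug :: "trm option \<Rightarrow> trm \<Rightarrow> trm" where
  "plug None M = M"
| "plug (Some L) M = Whr L M"

definition ax :: "(nat \<Rightarrow> trm) \<Rightarrow> nat \<Rightarrow> trm" where
  "ax a = case_nat (Var 0) (\<lambda>i. liftx_t 0 (a i))"

text \<open>Index 0 of a stored context \<open>L\<close> is the variable bound by its own where,
  hence the cutoff 1.\<close>

definition kx :: "(nat \<Rightarrow> nat \<times> trm option) \<Rightarrow> nat \<Rightarrow> nat \<times> trm option" where
  "kx \<kappa> k = map_prod id (map_option (liftx_t 1)) (\<kappa> k)"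

definition kk :: "(nat \<Rightarrow> nat \<times> trm option) \<Rightarrow> nat \<Rightarrow> nat \<times> trm option" where
  "kk \<kappa> = case_nat (0, None) (\<lambda>k. map_prod Suc (map_option (liftk_t 0)) (\<kappa> k))"

text \<open>Simultaneous substitution of values for ordinary variables and, for every continuation
variable \<open>k\<close> with \<open>\<kappa> k = (j, C)\<close>, of the context \<open>[j](plug C \<box>)\<close> for \<open>[k]\<box>\<close>.\<close>

primrec msub_t :: "(nat \<Rightarrow> trm) \<Rightarrow> (nat \<Rightarrow> nat \<times> trm option) \<Rightarrow> trm \<Rightarrow> trm"
  and msub_j :: "(nat \<Rightarrow> trm) \<Rightarrow> (nat \<Rightarrow> nat \<times> trm option) \<Rightarrow> jmp \<Rightarrow> jmp" where
  "msub_t a \<kappa> (Var i) = a i"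
| "msub_t a \<kappa> (Lam M) = Lam (msub_t (ax a) (kx \<kappa>) M)"
| "msub_t a \<kappa> (App M N) = App (msub_t a \<kappa> M) (msub_t a \<kappa> N)"
| "msub_t a \<kappa> (Whr L M) = Whr (msub_t (ax a) (kx \<kappa>) L) (msub_t a \<kappa> M)"
| "msub_t a \<kappa> (Mu J) = Mu (msub_j (\<lambda>i. liftk_t 0 (a i)) (kk \<kappa>) J)"
| "msub_j a \<kappa> (Jmp k M) = Jmp (fst (\<kappa> k)) (plug (snd (\<kappa> k)) (msub_t a \<kappa> M))"
| "msub_j a \<kappa> (JWhr J M) = JWhr (msub_j (ax a) (kx \<kappa>) J) (msub_t a \<kappa> M)"

definition sx :: "nat \<Rightarrow> trm \<Rightarrow> nat \<Rightarrow> trm" where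
  "sx c V i = (if i < c then Var i else if i = c then V else Var (i - 1))"

lemma ax_sx [simp]: "ax (sx c V) = sx (Suc c) (liftx_t 0 V)"
  by (auto simp: fun_eq_iff ax_def sx_def split: nat.split)

lemma liftk_sx [simp]: "(\<lambda>i. liftk_t 0 (sx c V i)) = sx c (liftk_t 0 V)"
  by (auto simp: fun_eq_iff sx_def)

lemma kx_None [simp]: "kx (\<lambda>k. (f k, None)) = (\<lambda>k. (f k, None))"
  by (auto simp: fun_eq_iff kx_def)

lemma kk_None [simp]: "kk (\<lambda>k. (k, None)) = (\<lambda>k. (k, None))"
  by (auto simp: fun_eq_iff kk_def split: nat.split)

lemma substx_conv_msub:
  "substx_t M c V = msub_t (sx c V) (\<lambda>k. (k, None)) M"
  "substx_j J c V = msub_j (sx c V) (\<lambda>k. (k, None)) J"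
  by (induction M and J arbitrary: c V and c V) (simp_all, auto simp: sx_def)

lemma sx_0: "sx 0 V = case_nat V Var"
  by (auto simp: fun_eq_iff sx_def split: nat.split)

lemma ax_Var [simp]: "ax Var = Var"
  by (auto simp: fun_eq_iff ax_def split: nat.split)

text \<open>The environment behind \<open>ctx_t\<close>. Index \<open>c\<close> is kept, not
  removed: the surrounding mu survives structural reduction and its jumps only gain a where.\<close>

definition cx :: "nat \<Rightarrow> trm \<Rightarrow> nat \<Rightarrow> nat \<times> trm option" where
  "cx c P k = (k, if k = c then Some P else None)"

lemma kx_cx [simp]: "kx (cx c P) = cx c (liftx_t 1 P)"
  by (auto simp: fun_eq_iff kx_def cx_def)

lemma kk_cx [simp]: "kk (cx c P) = cx (Suc c) (liftk_t 0 P)"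
  by (auto simp: fun_eq_iff kk_def cx_def split: nat.split)

lemma ctx_conv_msub:
  "ctx_t M c P = msub_t Var (cx c P) M"
  "ctx_j J c P = msub_j Var (cx c P) J"
  by (induction M and J arbitrary: c P and c P) (auto simp: cx_def[of c P for c P])

section \<open>Normal forms of the source calculus\<close>

text \<open>The congruence only moves bindings around, so the shape of the term found below all
bindings is an invariant of it.\<close>

datatype shape = SVal | SApp | SMu

primrec tail :: "trm \<Rightarrow> shape" where
  "tail (Var i) = SVal"
| "tail (Lam M) = SVal"
| "tail (App M N) = SApp"
| "tail (Whr L M) = tail L"
| "tail (Mu J) = SMu"

primrec hd_j :: "jmp \<Rightarrow> nat" where
  "hd_j (Jmp k M) = k"
| "hd_j (JWhr J M) = hd_j J"

text \<open>Together with \<open>hd_j\<close> this gives the representative [k]M of a jump, obtained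
  by pulling all bindings inside with (E3).\<close>

primrec body_j :: "jmp \<Rightarrow> trm" where
  "body_j (Jmp k M) = M"
| "body_j (JWhr J M) = Whr (body_j J) M"

text \<open>A binding \<open>L where x:=M\<close> is a redex as soon as \<open>L\<close> is \<open>x\<close>, and by (E2) and (E3) also when
\<open>L\<close> is \<open>\<mu>k.[l]x\<close>.\<close>

definition isv0 :: "trm \<Rightarrow> bool" where
  "isv0 L \<longleftrightarrow> L = Var 0 \<or> (\<exists>k. L = Mu (Jmp k (Var 0)))"

text \<open>A grammar for the terms none of whose congruent variants has a redex. A bound term must
  end in an application, because (E1) floats its own bindings out and would expose a value or a mu
  to the enclosing where; likewise (E3) exposes a mu to an enclosing jump. The redex mu k.[k]M is
  looked for after all bindings have been collected in \<open>body_j\<close>.\<close>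

primrec nf_t :: "trm \<Rightarrow> bool" and nf_j :: "jmp \<Rightarrow> bool" where
  "nf_t (Var i) = True"
| "nf_t (Lam M) = (nf_t M \<and> \<not> (\<exists>i. M = App (Var (Suc i)) (Var 0)))"
| "nf_t (App M N) = ((\<exists>i. M = Var i) \<and> isval N \<and> nf_t N)"
| "nf_t (Whr L M) = (nf_t L \<and> nf_t M \<and> tail M = SApp \<and> \<not> isv0 L)"
| "nf_t (Mu J) = (nf_j J \<and> \<not> (hd_j J = 0 \<and> 0 \<notin> fk_t (body_j J)))"
| "nf_j (Jmp k M) = (nf_t M \<and> tail M \<noteq> SMu)"
| "nf_j (JWhr J M) = (nf_j J \<and> nf_t M \<and> tail M = SApp \<and> \<not> (\<exists>k. J = Jmp k (Var 0)))"

lemma tail_ren [simp]: "tail (ren_t a b M) = tail M"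
  by (induction M arbitrary: a b) auto

lemma hd_ren [simp]: "hd_j (ren_j a b J) = b (hd_j J)"
  by (induction J arbitrary: a b) auto

lemma body_ren [simp]: "body_j (ren_j a b J) = ren_t a b (body_j J)"
  by (induction J arbitrary: a b) auto

lemma ren_eq_Var_iff:
  "ren_t a b M = Var i \<longleftrightarrow> (\<exists>j. M = Var j \<and> i = a j)"
  "Var i = ren_t a b M \<longleftrightarrow> (\<exists>j. M = Var j \<and> i = a j)"
  by (cases M; auto)+

lemma ren_eq_App_iff:
  "ren_t a b M = App P Q \<longleftrightarrow> (\<exists>P' Q'. M = App P' Q' \<and> P = ren_t a b P' \<and> Q = ren_t a b Q')"
  by (cases M) auto

lemma up_eq_0 [simp]: "up f i = 0 \<longleftrightarrow> i = 0" "0 = up f i \<longleftrightarrow> i = 0"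
  by (cases i; simp)+

lemma up_eq_Suc: "Suc j = up f i \<longleftrightarrow> (\<exists>k. i = Suc k \<and> j = f k)"
  by (cases i) auto

lemma ren_j_eq_Jmp_iff:
  "ren_j a b J = Jmp k P \<longleftrightarrow> (\<exists>k' P'. J = Jmp k' P' \<and> k = b k' \<and> P = ren_t a b P')"
  by (cases J) auto

lemma isv0_simps [simp]:
  "isv0 (Var 0)" "\<not> isv0 (Lam M)" "\<not> isv0 (App M N)" "\<not> isv0 (Whr M N)"
  "isv0 (Mu J) \<longleftrightarrow> (\<exists>k. J = Jmp k (Var 0))"
  by (auto simp: isv0_def)

lemma isv0_ren [simp]: "isv0 (ren_t (up a) b M) = isv0 M"
  by (cases M) (auto simp: isv0_def ren_j_eq_Jmp_iff ren_eq_Var_iff)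

lemma isv0_ren_skip [simp]: "isv0 (ren_t (skip (Suc c)) b M) = isv0 M"
  using isv0_ren[of "skip c"] by simp

lemma nf_ren [simp]: "nf_t (ren_t a b M) = nf_t M" "nf_j (ren_j a b J) = nf_j J"
proof (induction M and J arbitrary: a b and a b)
  case (Lam M)
  have "(\<exists>i. ren_t (up a) b M = App (Var (Suc i)) (Var 0)) \<longleftrightarrow> (\<exists>i. M = App (Var (Suc i)) (Var 0))"
    by (auto simp: ren_eq_App_iff ren_eq_Var_iff up_eq_Suc)
  then show ?case using Lam by simp
next
  case (Whr L M)
  then show ?case by (auto simp: ren_eq_Var_iff)
next
  case (App M N)
  then show ?case by (auto simp: ren_eq_Var_iff)
next
  case (Mu J)
  have "0 \<in> fk_t (ren_t a (up b) (body_j J)) \<longleftrightarrow> 0 \<in> fk_t (body_j J)"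
    by (auto simp: fk_ren image_iff)
  then show ?case using Mu by simp
next
  case (JWhr J M)
  then show ?case by (auto simp: ren_j_eq_Jmp_iff ren_eq_Var_iff)
qed auto

lemma eqv_jmp_body: "eqv_j J (Jmp (hd_j J) (body_j J))"
proof (induction J rule: jmp.induct[where ?P1.0 = "\<lambda>_. True"])
  case (JWhr J M)
  then have "eqv_j (JWhr J M) (JWhr (Jmp (hd_j J) (body_j J)) M)"
    by (auto intro: cJWhr refl_t)
  then show ?case by (metis E3 body_j.simps(2) hd_j.simps(2) sym_j trans_j)
qed (auto intro: refl_j)

text \<open>The conjuncts besides \<open>nf_t\<close> record what \<open>nf_t\<close> inspects in
  subterms (shape at the end, literal variables and applications, free continuation variables). The
  compatibility rules need them to carry the invariance of \<open>nf_t\<close>.\<close>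

lemma eqv_invariants:
  "eqv_t M N \<Longrightarrow> tail M = tail N \<and> isval M = isval N \<and> fk_t M = fk_t N \<and> nf_t M = nf_t N \<and>
     (\<forall>i. M = Var i \<longleftrightarrow> N = Var i) \<and> isv0 M = isv0 N \<and> (\<forall>i j. M = App (Var i) (Var j) \<longleftrightarrow> N = App (Var i) (Var j))"
  "eqv_j J J' \<Longrightarrow> hd_j J = hd_j J' \<and> fk_t (body_j J) = fk_t (body_j J') \<and> fk_j J = fk_j J' \<and>
     nf_j J = nf_j J' \<and> (\<forall>k. J = Jmp k (Var 0) \<longleftrightarrow> J' = Jmp k (Var 0))"
proof (induction rule: eqv_t_eqv_j.inducts)
  case (E1_t L M N)
  have "nf_t (Whr L (Whr M N)) = nf_t (Whr (Whr (liftx_t 1 L) M) N)"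
    by (cases M) (auto simp: liftx_conv_ren ren_eq_Var_iff skip_def split: if_splits)
  then show ?case by (auto simp: liftx_conv_ren fk_ren)
next
  case (E1_j J M N)
  have "nf_j (JWhr J (Whr M N)) = nf_j (JWhr (JWhr (liftx_j 1 J) M) N)"
    by (cases M) (auto simp: liftx_conv_ren ren_eq_Var_iff ren_j_eq_Jmp_iff skip_def split: if_splits)
  then show ?case by (auto simp: liftx_conv_ren fk_ren)
next
  case (E2 J M)
  then show ?case by (auto simp: liftk_conv_ren fk_ren)
next
  case (E3 k L M)
  then show ?case by (auto simp: isv0_def)
qed auto

lemma nf_no_step:
  "step_t M N \<Longrightarrow> \<not> nf_t M"
  "step_j J J' \<Longrightarrow> \<not> nf_j J"
proof (induction rule: step_t_step_j.inducts)
  case (r_whrV V M)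
  then show ?case by (cases V) auto
next
  case (r_eta V)
  then show ?case by (cases V) auto
next
  case (r_muJmp M)
  then show ?case by (auto simp: liftk_conv_ren fk_ren)
next
  case (r_appN N M)
  then show ?case by (cases N) auto
qed auto

lemma nf_imp_normal_src: "nf_t M \<Longrightarrow> normal_src M"
  unfolding normal_src_def red_def by (metis eqv_invariants(1) nf_no_step(1))

section \<open>Terms outside the grammar are reducible modulo the congruence\<close>

definition rd_t :: "trm \<Rightarrow> bool" where
  "rd_t M \<longleftrightarrow> (\<exists>M1 N. eqv_t M M1 \<and> step_t M1 N)"

definition rd_j :: "jmp \<Rightarrow> bool" where
  "rd_j J \<longleftrightarrow> (\<exists>J1 J'. eqv_j J J1 \<and> step_j J1 J')"

lemma rd_step: "step_t M N \<Longrightarrow> rd_t M" "step_j J J' \<Longrightarrow> rd_j J"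
  unfolding rd_t_def rd_j_def by (blast intro: refl_t refl_j)+

lemma rd_eqv: "eqv_t M N \<Longrightarrow> rd_t N \<Longrightarrow> rd_t M" "eqv_j J J' \<Longrightarrow> rd_j J' \<Longrightarrow> rd_j J"
  unfolding rd_t_def rd_j_def by (blast intro: trans_t trans_j)+

lemma rd_cong:
  "rd_t M \<Longrightarrow> rd_t (Lam M)"
  "rd_t M \<Longrightarrow> rd_t (App M N)"
  "rd_t M \<Longrightarrow> rd_t (App N M)"
  "rd_t M \<Longrightarrow> rd_t (Whr M N)"
  "rd_t M \<Longrightarrow> rd_t (Whr N M)"
  "rd_j J \<Longrightarrow> rd_t (Mu J)"
  "rd_t M \<Longrightarrow> rd_j (Jmp k M)"
  "rd_j J \<Longrightarrow> rd_j (JWhr J N)"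
  "rd_t M \<Longrightarrow> rd_j (JWhr J M)"
  unfolding rd_t_def rd_j_def
  subgoal by (blast intro: cLam s_Lam)
  subgoal by (blast intro: cApp s_App1 refl_t)
  subgoal by (blast intro: cApp s_App2 refl_t)
  subgoal by (blast intro: cWhr s_Whr1 refl_t)
  subgoal by (blast intro: cWhr s_Whr2 refl_t)
  subgoal by (blast intro: cMu s_Mu)
  subgoal by (blast intro: cJmp s_Jmp)
  subgoal by (blast intro: cJWhr s_JWhr1 refl_t)
  subgoal by (blast intro: cJWhr s_JWhr2 refl_j)
  done

text \<open>(E1) floats the bindings of \<open>M\<close> outwards until the value or mu at its end
  faces \<open>L\<close> directly.\<close>

lemma rd_Whr: "tail M \<noteq> SApp \<Longrightarrow> rd_t (Whr L M)"
proof (induction M arbitrary: L rule: trm.induct[where ?P2.0 = "\<lambda>_. True"])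
  case (Whr L' M)
  then have "rd_t (Whr (Whr (liftx_t 1 L) L') M)" by (auto intro: rd_cong)
  then show ?case by (rule rd_eqv(1)[OF E1_t])
qed (auto intro!: rd_step(1)[OF r_whrV] rd_step(1)[OF r_whrMu])

lemma rd_Jmp: "tail M = SMu \<Longrightarrow> rd_j (Jmp k M)"
proof (induction M rule: trm.induct[where ?P2.0 = "\<lambda>_. True"])
  case (Whr L M)
  then have "rd_j (JWhr (Jmp k L) M)" by (auto intro: rd_cong)
  then show ?case by (rule rd_eqv(2)[OF E3])
qed (auto intro: rd_step r_jmpMu)

lemma not_nf_rd: "\<not> nf_t M \<Longrightarrow> rd_t M" "\<not> nf_j J \<Longrightarrow> rd_j J"
proof (induction M and J)
  case (Lam M)
  have "rd_t (Lam (App (Var (Suc i)) (Var 0)))" for i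
    using rd_step(1)[OF r_eta[of "Var i"]] by simp
  then show ?case using Lam by (auto intro: rd_cong)
next
  case (App M N)
  consider "\<not> isval M" | "isval M" "\<not> isval N" | P where "M = Lam P" "isval N" | i where "M = Var i" "isval N"
    by (cases M) auto
  then show ?case
    by cases (use App in \<open>auto intro: rd_step r_appN r_appV r_beta rd_cong\<close>)
next
  case (Whr L M)
  have *: "rd_t (Whr (Var 0) N)" for N by (auto intro: rd_step r_whrvar)
  \<comment> \<open>(E2) moves the binding under the mu, (E3) read backwards moves it into the jump,
    and [k](x where x:=M) contains a redex.\<close>
  have "rd_t (Whr (Mu (Jmp k (Var 0))) M)" for k
  proof (rule rd_eqv(1)[OF E2], rule rd_cong(6), rule rd_eqv(2)[OF sym_j[OF E3]])
    show "rd_j (Jmp k (Whr (Var 0) (liftk_t 0 M)))" by (intro rd_cong(7) *)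
  qed
  then show ?case using Whr * by (auto simp: isv0_def intro: rd_cong rd_Whr)
next
  case (Mu J)
  show ?case
  proof (cases "nf_j J")
    case True
    then have *: "hd_j J = 0" "0 \<notin> fk_t (body_j J)" using Mu by auto
    have "eqv_t (Mu J) (Mu (Jmp 0 (body_j J)))" using eqv_jmp_body[of J] * by (auto intro: cMu)
    moreover have "rd_t (Mu (Jmp 0 (body_j J)))"
      using rd_step(1)[OF r_muJmp[of "ren_t id (\<lambda>i. i - Suc 0) (body_j J)"]] not_free_liftk[OF *(2)]
      by simp
    ultimately show ?thesis by (rule rd_eqv(1))
  next
    case False
    then show ?thesis using Mu by (auto intro: rd_cong)
  qed
next
  case (Jmp k M)
  then show ?case by (auto intro: rd_cong rd_Jmp)
next
  case (JWhr J M)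
  have *: "eqv_j (JWhr J M) (Jmp (hd_j J) (Whr (body_j J) M))"
    using eqv_jmp_body[of "JWhr J M"] by simp
  have "rd_j (JWhr J M)" if "tail M \<noteq> SApp \<or> (\<exists>k. J = Jmp k (Var 0))"
    using that by (intro rd_eqv(2)[OF *] rd_cong(7)) (auto intro: rd_Whr rd_step(1)[OF r_whrvar])
  then show ?case using JWhr by (auto intro: rd_cong)
qed auto

lemma normal_src_iff_nf: "normal_src M \<longleftrightarrow> nf_t M"
proof
  assume "normal_src M"
  then have "\<not> rd_t M" unfolding normal_src_def red_def rd_t_def by (blast intro: refl_t)
  then show "nf_t M" using not_nf_rd by blast
qed (rule nf_imp_normal_src)

section \<open>The translation as an interpretation with environments\<close>

abbreviation rs :: "(nat \<Rightarrow> lt) \<Rightarrow> nat \<Rightarrow> lt" where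
  "rs \<rho> \<equiv> (\<lambda>i. ren Suc (\<rho> i))"

text \<open>Compared with the given translation, variables denote target terms, and \<open>\<mu>k.J\<close> binds \<open>k\<close> to the
continuation in the environment instead of creating a beta-redex. This makes the interpretation
strictly invariant under the congruence and compatible with all substitutions.\<close>

fun sem :: "trm \<Rightarrow> (nat \<Rightarrow> lt) \<Rightarrow> (nat \<Rightarrow> lt) \<Rightarrow> lt \<Rightarrow> lt"
and star :: "trm \<Rightarrow> (nat \<Rightarrow> lt) \<Rightarrow> (nat \<Rightarrow> lt) \<Rightarrow> lt"
and semj :: "jmp \<Rightarrow> (nat \<Rightarrow> lt) \<Rightarrow> (nat \<Rightarrow> lt) \<Rightarrow> lt" where
  "star (Var i) \<rho> \<sigma> = \<rho> i"
| "star (Lam M) \<rho> \<sigma> = LL (LL (sem M (rs (ups \<rho>)) (rs (rs \<sigma>)) (LV 0)))"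
| "star (App M N) \<rho> \<sigma> = undefined"
| "star (Whr M N) \<rho> \<sigma> = undefined"
| "star (Mu J) \<rho> \<sigma> = undefined"
| "sem (Var i) \<rho> \<sigma> K = LA K (\<rho> i)"
| "sem (Lam M) \<rho> \<sigma> K = LA K (LL (LL (sem M (rs (ups \<rho>)) (rs (rs \<sigma>)) (LV 0))))"
| "sem (App M N) \<rho> \<sigma> K =
     (if isval M \<and> isval N then LA (LA (star M \<rho> \<sigma>) (star N \<rho> \<sigma>)) K
      else if isval M then
        sem N \<rho> \<sigma> (LL (LA (LA (star M (rs \<rho>) (rs \<sigma>)) (LV 0)) (ren Suc K)))
      else if isval N then
        sem M \<rho> \<sigma> (LL (LA (LA (LV 0) (star N (rs \<rho>) (rs \<sigma>))) (ren Suc K)))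
      else
        sem M \<rho> \<sigma> (LL (sem N (rs \<rho>) (rs \<sigma>) (LL (LA (LA (LV 1) (LV 0)) (ren Suc (ren Suc K)))))))"
| "sem (Whr L M) \<rho> \<sigma> K = sem M \<rho> \<sigma> (LL (sem L (ups \<rho>) (rs \<sigma>) (ren Suc K)))"
| "sem (Mu J) \<rho> \<sigma> K = semj J \<rho> (case_nat K \<sigma>)"
| "semj (Jmp k M) \<rho> \<sigma> = sem M \<rho> \<sigma> (\<sigma> k)"
| "semj (JWhr J M) \<rho> \<sigma> = sem M \<rho> \<sigma> (LL (semj J (ups \<rho>) (rs \<sigma>)))"

lemma sem_val: "isval V \<Longrightarrow> sem V \<rho> \<sigma> K = LA K (star V \<rho> \<sigma>)"
  by (cases V) auto

text \<open>\<open>sem\<close> of a value is \<open>K\<close> applied to its \<open>star\<close>, so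
  equalities of \<open>star\<close> can be read off from equalities of \<open>sem\<close>.
  Inductions on terms can then speak of \<open>sem\<close> and \<open>semj\<close> alone.\<close>

lemma star_eqI: "isval V \<Longrightarrow> isval W \<Longrightarrow> sem V \<rho> \<sigma> K = sem W \<rho>' \<sigma>' K \<Longrightarrow> star V \<rho> \<sigma> = star W \<rho>' \<sigma>'"
  by (simp add: sem_val)

lemma psub_ups_ren [simp]: "psub (ups \<theta>) (ren Suc t) = ren Suc (psub \<theta> t)"
  by (simp add: psub_ren ren_psub)

lemma psub_ups_ups [simp]: "(\<lambda>i. psub (ups \<theta>) (ups \<rho> i)) = ups (\<lambda>i. psub \<theta> (\<rho> i))"
  by (auto simp: fun_eq_iff ups_def psub_ren ren_psub split: nat.split)

lemma psub_case_nat [simp]: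
  "(\<lambda>i. psub \<theta> (case_nat K \<sigma> i)) = case_nat (psub \<theta> K) (\<lambda>i. psub \<theta> (\<sigma> i))"
  by (auto simp: fun_eq_iff split: nat.split)

lemma rs_psub_ups [simp]:
  "(\<lambda>i. psub (ups (ups \<theta>)) (ren Suc (ups \<rho> i))) = rs (ups (\<lambda>i. psub \<theta> (\<rho> i)))"
proof -
  have "psub (ups \<theta>) (ups \<rho> i) = ups (\<lambda>i. psub \<theta> (\<rho> i)) i" for i
    using psub_ups_ups[of \<theta> \<rho>] by (rule fun_cong)
  then show ?thesis by simp
qed

lemma psub_sem:
  "psub \<theta> (sem M \<rho> \<sigma> K) = sem M (\<lambda>i. psub \<theta> (\<rho> i)) (\<lambda>i. psub \<theta> (\<sigma> i)) (psub \<theta> K)"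
  "isval V \<Longrightarrow> psub \<theta> (star V \<rho> \<sigma>) = star V (\<lambda>i. psub \<theta> (\<rho> i)) (\<lambda>i. psub \<theta> (\<sigma> i))"
  "psub \<theta> (semj J \<rho> \<sigma>) = semj J (\<lambda>i. psub \<theta> (\<rho> i)) (\<lambda>i. psub \<theta> (\<sigma> i))"
  by (induction M \<rho> \<sigma> K and V \<rho> \<sigma> and J \<rho> \<sigma> arbitrary: \<theta> and \<theta> and \<theta> rule: sem_star_semj.induct)
    (simp_all del: psub_ups_ups add: psub_ups_ups[unfolded fun_eq_iff, rule_format])

lemma ren_sem:
  "ren f (sem M \<rho> \<sigma> K) = sem M (\<lambda>i. ren f (\<rho> i)) (\<lambda>i. ren f (\<sigma> i)) (ren f K)"
  "isval V \<Longrightarrow> ren f (star V \<rho> \<sigma>) = star V (\<lambda>i. ren f (\<rho> i)) (\<lambda>i. ren f (\<sigma> i))"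
  "ren f (semj J \<rho> \<sigma>) = semj J (\<lambda>i. ren f (\<rho> i)) (\<lambda>i. ren f (\<sigma> i))"
  by (simp_all add: ren_conv_psub psub_sem)

lemma ups_up [simp]: "(\<lambda>i. ups \<rho> (up a i)) = ups (\<lambda>i. \<rho> (a i))"
  by (auto simp: fun_eq_iff ups_def up_def split: nat.split)

lemma rs_ups_up [simp]: "(\<lambda>i. ren Suc (ups \<rho> (up a i))) = rs (ups (\<lambda>i. \<rho> (a i)))"
  by (auto simp: fun_eq_iff ups_def up_def split: nat.split)

lemma case_nat_up [simp]: "(\<lambda>i. case_nat K \<sigma> (up b i)) = case_nat K (\<lambda>i. \<sigma> (b i))"
  by (auto simp: fun_eq_iff up_def split: nat.split)

lemma sem_ren:
  "sem (ren_t a b M) \<rho> \<sigma> K = sem M (\<lambda>i. \<rho> (a i)) (\<lambda>i. \<sigma> (b i)) K"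
  "semj (ren_j a b J) \<rho> \<sigma> = semj J (\<lambda>i. \<rho> (a i)) (\<lambda>i. \<sigma> (b i))"
proof (induction M and J arbitrary: a b \<rho> \<sigma> K and a b \<rho> \<sigma>)
  case (App M N)
  have "star (ren_t a b P) \<rho> \<sigma> = star P (\<lambda>i. \<rho> (a i)) (\<lambda>i. \<sigma> (b i))"
    if "P \<in> {M, N}" "isval P" for P \<rho> \<sigma>
    using that App by (auto intro!: star_eqI[where K = "LV 0"])
  then show ?case using App by simp
qed simp_all

lemma star_ren:
  "isval V \<Longrightarrow> star (ren_t a b V) \<rho> \<sigma> = star V (\<lambda>i. \<rho> (a i)) (\<lambda>i. \<sigma> (b i))"
  by (rule star_eqI[where K = "LV 0"]) (auto simp: sem_ren)

text \<open>The continuation denoted by a stored context: for \<open>(j, Some L)\<close> it is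
  lambda x.<L>[K], where K is the continuation of \<open>j\<close>.\<close>

fun cont :: "nat \<times> trm option \<Rightarrow> (nat \<Rightarrow> lt) \<Rightarrow> (nat \<Rightarrow> lt) \<Rightarrow> lt" where
  "cont (j, None) \<rho> \<sigma> = \<sigma> j"
| "cont (j, Some L) \<rho> \<sigma> = LL (sem L (ups \<rho>) (rs \<sigma>) (ren Suc (\<sigma> j)))"

lemma isval_msub: "(\<And>i. isval (a i)) \<Longrightarrow> isval (msub_t a \<kappa> M) = isval M"
  by (cases M) auto

lemma star_ax: "(\<And>i. isval (a i)) \<Longrightarrow> (\<lambda>i. star (ax a i) (ups \<rho>) (rs \<sigma>)) = ups (\<lambda>i. star (a i) \<rho> \<sigma>)"
  by (auto simp: fun_eq_iff ax_def ups_def liftx_conv_ren star_ren ren_sem split: nat.split)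

lemma star_liftk: "isval V \<Longrightarrow> star (liftk_t 0 V) \<rho> (case_nat K \<sigma>) = star V \<rho> \<sigma>"
  by (simp add: liftk_conv_ren star_ren)

lemma cont_kx: "(\<lambda>k. cont (kx \<kappa> k) (ups \<rho>) (rs \<sigma>)) = rs (\<lambda>k. cont (\<kappa> k) \<rho> \<sigma>)"
proof
  fix k
  obtain j C where k: "\<kappa> k = (j, C)" by fastforce
  have 1: "(\<lambda>i. ups (ups \<rho>) (skip (Suc 0) i)) = (\<lambda>i. ren (up Suc) (ups \<rho> i))"
    by (auto simp: fun_eq_iff ups_def skip_def ren_ren split: nat.split)
  have 2: "rs (rs \<sigma>) = (\<lambda>i. ren (up Suc) (rs \<sigma> i))"
    by (auto simp: fun_eq_iff ren_ren)
  show "cont (kx \<kappa> k) (ups \<rho>) (rs \<sigma>) = ren Suc (cont (\<kappa> k) \<rho> \<sigma>)"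
    using k by (cases C) (simp_all add: kx_def liftx_conv_ren sem_ren ren_sem 1 2 ren_ren)
qed

lemma cont_kk: "(\<lambda>k. cont (kk \<kappa> k) \<rho> (case_nat K \<sigma>)) = case_nat K (\<lambda>k. cont (\<kappa> k) \<rho> \<sigma>)"
proof
  fix k
  show "cont (kk \<kappa> k) \<rho> (case_nat K \<sigma>) = case_nat K (\<lambda>k. cont (\<kappa> k) \<rho> \<sigma>) k"
  proof (cases k)
    case (Suc l)
    obtain j C where k: "\<kappa> l = (j, C)" by fastforce
    then show ?thesis using Suc by (cases C) (auto simp: kk_def liftk_conv_ren sem_ren)
  qed (simp add: kk_def)
qed

lemma ren_up_ups: "(\<lambda>i. ren (up f) (ups \<rho> i)) = ups (\<lambda>i. ren f (\<rho> i))"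
  by (auto simp: fun_eq_iff ups_def ren_ren split: nat.split)

lemma ren_cont: "ren f (cont c \<rho> \<sigma>) = cont c (\<lambda>i. ren f (\<rho> i)) (\<lambda>i. ren f (\<sigma> i))"
proof -
  obtain j C where "c = (j, C)" by fastforce
  then show ?thesis by (cases C) (simp_all add: ren_sem ren_up_ups ren_ren)
qed

text \<open>Substituting in the syntax amounts to changing the environment: values become their
  denotations and contexts become continuations. It is an equality since mu-bound variables live in
  the environment, and it covers value substitution and structural substitution at once.\<close>

lemma sem_msub:
  "(\<And>i. isval (a i)) \<Longrightarrow>
    sem (msub_t a \<kappa> M) \<rho> \<sigma> K = sem M (\<lambda>i. star (a i) \<rho> \<sigma>) (\<lambda>k. cont (\<kappa> k) \<rho> \<sigma>) K"
  "(\<And>i. isval (a i)) \<Longrightarrow>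
    semj (msub_j a \<kappa> J) \<rho> \<sigma> = semj J (\<lambda>i. star (a i) \<rho> \<sigma>) (\<lambda>k. cont (\<kappa> k) \<rho> \<sigma>)"
proof (induction M and J arbitrary: a \<kappa> \<rho> \<sigma> K and a \<kappa> \<rho> \<sigma>)
  have ax: "\<And>i. isval (ax a i)" if "\<And>i. isval (a i)" for a
    using that by (auto simp: ax_def liftx_conv_ren split: nat.split)
  {
    case (Var i)
    then show ?case by (simp add: sem_val)
  next
    case (Lam M)
    have "rs (ups (\<lambda>i. star (a i) \<rho> \<sigma>)) = (\<lambda>i. star (ax a i) (rs (ups \<rho>)) (rs (rs \<sigma>)))"
      using star_ax[of a \<rho> \<sigma>, unfolded fun_eq_iff] ax Lam.prems by (simp flip: ren_sem)
    moreover have "(\<lambda>k. ren Suc (ren Suc (cont (\<kappa> k) \<rho> \<sigma>))) = (\<lambda>k. cont (kx \<kappa> k) (rs (ups \<rho>)) (rs (rs \<sigma>)))"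
    proof -
      have "ren Suc (ren Suc (cont (\<kappa> k) \<rho> \<sigma>)) = ren Suc (cont (kx \<kappa> k) (ups \<rho>) (rs \<sigma>))" for k
        using cont_kx[of \<kappa> \<rho> \<sigma>, unfolded fun_eq_iff] by simp
      then show ?thesis by (simp add: ren_cont)
    qed
    ultimately show ?case using Lam ax by simp
  next
    case (App M N)
    have "star (msub_t a \<kappa> P) \<rho> \<sigma> = star P (\<lambda>i. star (a i) \<rho> \<sigma>) (\<lambda>k. cont (\<kappa> k) \<rho> \<sigma>)"
      if "P \<in> {M, N}" "isval P" for P \<rho> \<sigma>
      using that App by (auto intro!: star_eqI[where K = "LV 0"] simp: isval_msub)
    moreover have "star (a i) (rs \<rho>) (rs \<sigma>) = ren Suc (star (a i) \<rho> \<sigma>)" for i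
      using App.prems by (simp add: ren_sem)
    moreover have "cont c (rs \<rho>) (rs \<sigma>) = ren Suc (cont c \<rho> \<sigma>)" for c
      by (simp add: ren_cont)
    ultimately show ?case using App by (simp add: isval_msub)
  next
    case (Whr L M)
    then show ?case using ax by (simp add: star_ax cont_kx)
  next
    case (Mu J)
    have "(\<lambda>i. star (liftk_t 0 (a i)) \<rho> (case_nat K \<sigma>)) = (\<lambda>i. star (a i) \<rho> \<sigma>)"
      using Mu.prems by (simp add: star_liftk)
    moreover have "isval (liftk_t 0 (a i))" for i
      using Mu.prems by (simp add: liftk_conv_ren)
    ultimately show ?case
      using Mu.IH[of "\<lambda>i. liftk_t 0 (a i)" "kk \<kappa>" \<rho> "case_nat K \<sigma>"] by (simp add: cont_kk)
  next
    case (Jmp k M)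
    obtain j C where k: "\<kappa> k = (j, C)" by fastforce
    then show ?case using Jmp by (cases C) auto
  next
    case (JWhr J M)
    then show ?case using ax by (simp add: star_ax cont_kx)
  }
qed

lemma sem_substx: "isval V \<Longrightarrow> sem (substx_t M 0 V) \<rho> \<sigma> K = sem M (case_nat (star V \<rho> \<sigma>) \<rho>) \<sigma> K"
proof -
  assume V: "isval V"
  have "(\<lambda>i. star (sx 0 V i) \<rho> \<sigma>) = case_nat (star V \<rho> \<sigma>) \<rho>"
    by (auto simp: fun_eq_iff sx_0 split: nat.split)
  moreover have "isval (sx 0 V i)" for i using V by (auto simp: sx_def)
  ultimately show ?thesis by (simp add: substx_conv_msub sem_msub)
qed

text \<open>The right-hand side unfolds from the interpretation of \<open>Whr L (Mu J)\<close>, so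
  structural reduction leaves the interpretation unchanged.\<close>

lemma semj_ctx:
  "semj (ctx_j J 0 (liftk_t 0 L)) \<rho> (case_nat K \<sigma>) =
   semj J \<rho> (case_nat (LL (sem L (ups \<rho>) (rs \<sigma>) (ren Suc K))) \<sigma>)"
proof -
  have "(\<lambda>k. cont (cx 0 (liftk_t 0 L) k) \<rho> (case_nat K \<sigma>)) =
      case_nat (LL (sem L (ups \<rho>) (rs \<sigma>) (ren Suc K))) \<sigma>"
    by (auto simp: fun_eq_iff cx_def liftk_conv_ren sem_ren split: nat.split)
  then show ?thesis by (simp add: ctx_conv_msub sem_msub)
qed

text \<open>Bindings only nest continuations, and regrouping the bindings yields the same nesting.
  (E2) and (E3) hold literally because mu extends the environment and a jump looks up its
  continuation there.\<close>

lemma eqv_sem: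
  "eqv_t M N \<Longrightarrow> sem M \<rho> \<sigma> K = sem N \<rho> \<sigma> K"
  "eqv_j J J' \<Longrightarrow> semj J \<rho> \<sigma> = semj J' \<rho> \<sigma>"
proof (induction arbitrary: \<rho> \<sigma> K and \<rho> \<sigma> rule: eqv_t_eqv_j.inducts)
  case (E1_t L M N)
  have "(\<lambda>i. ups (ups \<rho>) (skip (Suc 0) i)) = (\<lambda>i. ren (up Suc) (ups \<rho> i))"
    by (auto simp: fun_eq_iff ups_def skip_def ren_ren split: nat.split)
  then show ?case by (simp add: liftx_conv_ren sem_ren ren_sem ren_ren)
next
  case (E1_j J M N)
  have "(\<lambda>i. ups (ups \<rho>) (skip (Suc 0) i)) = (\<lambda>i. ren (up Suc) (ups \<rho> i))"
    by (auto simp: fun_eq_iff ups_def skip_def ren_ren split: nat.split)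
  then show ?case by (simp add: liftx_conv_ren sem_ren ren_sem ren_ren)
next
  case (E2 J M)
  have "(\<lambda>i. ren Suc (case_nat K \<sigma> i)) = case_nat (ren Suc K) (rs \<sigma>)"
    by (auto simp: fun_eq_iff split: nat.split)
  then show ?case by (simp add: liftk_conv_ren sem_ren)
next
  case (cApp M M' N N')
  have "isval M = isval M'" "isval N = isval N'"
    using cApp.hyps eqv_invariants(1) by blast+
  moreover have "star M \<rho> \<sigma> = star M' \<rho> \<sigma>" if "isval M" for \<rho> \<sigma>
    using that calculation cApp.IH by (intro star_eqI[where K = "LV 0"]) auto
  moreover have "star N \<rho> \<sigma> = star N' \<rho> \<sigma>" if "isval N" for \<rho> \<sigma>
    using that calculation cApp.IH by (intro star_eqI[where K = "LV 0"]) auto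
  ultimately show ?case using cApp.IH by simp
next
  case (sym_t M N)
  show ?case using sym_t.IH[of \<rho> \<sigma> K] by (rule sym)
next
  case (sym_j J J')
  show ?case using sym_j.IH[of \<rho> \<sigma>] by (rule sym)
next
  case (trans_t M N P)
  show ?case using trans_t.IH(1)[of \<rho> \<sigma> K] trans_t.IH(2)[of \<rho> \<sigma> K] by (rule trans)
next
  case (trans_j J J' J'')
  show ?case using trans_j.IH(1)[of \<rho> \<sigma>] trans_j.IH(2)[of \<rho> \<sigma>] by (rule trans)
qed auto

section \<open>Reduction steps become conversions\<close>

lemma conv_case_nat:
  "K \<approx> K' \<Longrightarrow> (\<And>i. \<sigma> i \<approx> \<sigma>' i) \<Longrightarrow> case_nat K \<sigma> i \<approx> case_nat K' \<sigma>' i"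
  by (auto split: nat.split)

lemma conv_sem:
  "(\<And>i. \<sigma> i \<approx> \<sigma>' i) \<Longrightarrow>
     (\<forall>K K'. K \<approx> K' \<longrightarrow> sem M \<rho> \<sigma> K \<approx> sem M \<rho> \<sigma>' K') \<and> (isval M \<longrightarrow> star M \<rho> \<sigma> \<approx> star M \<rho> \<sigma>')"
  "(\<And>i. \<sigma> i \<approx> \<sigma>' i) \<Longrightarrow> semj J \<rho> \<sigma> \<approx> semj J \<rho> \<sigma>'"
proof (induction M and J arbitrary: \<rho> \<sigma> \<sigma>' and \<rho> \<sigma> \<sigma>')
  case (Lam M)
  have "sem M (rs (ups \<rho>)) (rs (rs \<sigma>)) (LV 0) \<approx> sem M (rs (ups \<rho>)) (rs (rs \<sigma>')) (LV 0)"
    using Lam.IH[of "rs (rs \<sigma>)" "rs (rs \<sigma>')"] Lam.prems by (simp add: conv_ren)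
  then show ?case by (auto intro: conv_LA conv_LL)
next
  case (App M N)
  have M: "K \<approx> K' \<Longrightarrow> sem M \<rho> \<sigma> K \<approx> sem M \<rho> \<sigma>' K'" "isval M \<Longrightarrow> star M \<rho> \<sigma> \<approx> star M \<rho> \<sigma>'"
    and N: "K \<approx> K' \<Longrightarrow> sem N \<rho> \<sigma> K \<approx> sem N \<rho> \<sigma>' K'" "isval N \<Longrightarrow> star N \<rho> \<sigma> \<approx> star N \<rho> \<sigma>'"
    and M': "isval M \<Longrightarrow> star M (rs \<rho>) (rs \<sigma>) \<approx> star M (rs \<rho>) (rs \<sigma>')"
    and N': "K \<approx> K' \<Longrightarrow> sem N (rs \<rho>) (rs \<sigma>) K \<approx> sem N (rs \<rho>) (rs \<sigma>') K'"
      "isval N \<Longrightarrow> star N (rs \<rho>) (rs \<sigma>) \<approx> star N (rs \<rho>) (rs \<sigma>')" for K K'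
    using App.IH[of \<sigma> \<sigma>'] App.IH[of "rs \<sigma>" "rs \<sigma>'"] App.prems by (simp_all add: conv_ren)
  show ?case
    by (auto intro!: conv_LA conv_LL conv_ren M N M' N')
next
  case (Whr L M)
  have "sem L (ups \<rho>) (rs \<sigma>) (ren Suc K) \<approx> sem L (ups \<rho>) (rs \<sigma>') (ren Suc K')" if "K \<approx> K'" for K K'
    using Whr.IH(1)[of "rs \<sigma>" "rs \<sigma>'"] Whr.prems that by (simp add: conv_ren)
  then show ?case using Whr.IH(2)[of \<sigma> \<sigma>'] Whr.prems by (simp add: conv_LL)
next
  case (Mu J)
  then show ?case by (auto intro!: Mu.IH conv_case_nat)
next
  case (JWhr J M)
  have "semj J (ups \<rho>) (rs \<sigma>) \<approx> semj J (ups \<rho>) (rs \<sigma>')"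
    using JWhr.IH(1)[of "rs \<sigma>" "rs \<sigma>'"] JWhr.prems by (simp add: conv_ren)
  then show ?case using JWhr.IH(2)[of \<sigma> \<sigma>'] JWhr.prems by (simp add: conv_LL)
qed (auto intro: conv_LA)

lemma conv_sem_K: "K \<approx> K' \<Longrightarrow> sem M \<rho> \<sigma> K \<approx> sem M \<rho> \<sigma> K'"
  using conv_sem(1)[of \<sigma> \<sigma>] by blast

lemma conv_betaI: "psub (case_nat s LV) t = u \<Longrightarrow> LA (LL t) s \<approx> u"
  using conv_beta by blast

abbreviation appK :: "lt \<Rightarrow> lt" where
  "appK K \<equiv> LL (LA (LA (LV 1) (LV 0)) (ren Suc (ren Suc K)))"

text \<open>The clause for an application depends on which parts are values, and a step may turn a
  non-value into a value. Up to beta all four clauses agree with the one for two non-values, so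
  steps inside an application need no case distinction.\<close>

lemma sem_App: "sem (App M N) \<rho> \<sigma> K \<approx> sem M \<rho> \<sigma> (LL (sem N (rs \<rho>) (rs \<sigma>) (appK K)))"
proof -
  have M: "LA (LL (sem N (rs \<rho>) (rs \<sigma>) (appK K))) s \<approx> sem N \<rho> \<sigma> (LL (LA (LA (ren Suc s) (LV 0)) (ren Suc K)))" for s
    by (rule conv_betaI) (simp add: psub_sem)
  have N: "LA (LL (LA (LA t (LV 0)) (ren Suc K))) s \<approx> LA (LA (psub (case_nat s LV) t) s) K" for t s K
    by (rule conv_betaI) simp
  have S: "star V (rs \<rho>) (rs \<sigma>) = ren Suc (star V \<rho> \<sigma>)" if "isval V" for V
    using that by (simp add: ren_sem)
  consider "isval M" "isval N" | "isval M" "\<not> isval N" | "\<not> isval M" "isval N" | "\<not> isval M" "\<not> isval N"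
    by blast
  then show ?thesis
  proof cases
    case 1
    then have "sem (App M N) \<rho> \<sigma> K = LA (LA (star M \<rho> \<sigma>) (star N \<rho> \<sigma>)) K" by simp
    moreover have "sem N \<rho> \<sigma> (LL (LA (LA (ren Suc (star M \<rho> \<sigma>)) (LV 0)) (ren Suc K))) \<approx> LA (LA (star M \<rho> \<sigma>) (star N \<rho> \<sigma>)) K"
      using N[of "ren Suc (star M \<rho> \<sigma>)" K "star N \<rho> \<sigma>"] 1 by (simp add: sem_val)
    moreover have "sem M \<rho> \<sigma> (LL (sem N (rs \<rho>) (rs \<sigma>) (appK K))) \<approx>
        sem N \<rho> \<sigma> (LL (LA (LA (ren Suc (star M \<rho> \<sigma>)) (LV 0)) (ren Suc K)))"
      using M 1 by (simp add: sem_val)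
    ultimately show ?thesis using conv_trans conv_sym by metis
  next
    case 2
    then show ?thesis using M[of "star M \<rho> \<sigma>"] S by (simp add: sem_val[of M] conv_sym)
  next
    case 3
    have "LL (sem N (rs \<rho>) (rs \<sigma>) (appK K)) \<approx> LL (LA (LA (LV 0) (star N (rs \<rho>) (rs \<sigma>))) (ren Suc K))"
      using N[of "LV 1" "ren Suc K" "star N (rs \<rho>) (rs \<sigma>)"] 3 by (auto simp: sem_val intro: conv_LL)
    then show ?thesis using 3 by (auto intro: conv_sem_K conv_sym)
  next
    case 4
    then show ?thesis by simp
  qed
qed

lemma step_sem:
  "step_t M N \<Longrightarrow> sem M \<rho> \<sigma> K \<approx> sem N \<rho> \<sigma> K"
  "step_j J J' \<Longrightarrow> semj J \<rho> \<sigma> \<approx> semj J' \<rho> \<sigma>"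
proof (induction arbitrary: \<rho> \<sigma> K and \<rho> \<sigma> rule: step_t_step_j.inducts)
  case (r_appN N M)
  then show ?case by (simp add: liftx_conv_ren sem_ren star_ren)
next
  case (r_appV V N)
  then show ?case by (simp add: liftx_conv_ren sem_ren star_ren)
next
  case (r_beta V M)
  let ?V = "star V \<rho> \<sigma>"
  have "sem (App (Lam M) V) \<rho> \<sigma> K \<approx> LA (LA (LL (LL (sem M (rs (ups \<rho>)) (rs (rs \<sigma>)) (LV 0)))) ?V) K"
    using r_beta by simp
  also have "\<dots> \<approx> LA (LL (psub (ups (case_nat ?V LV)) (sem M (rs (ups \<rho>)) (rs (rs \<sigma>)) (LV 0)))) K"
    by (rule conv_LA[OF conv_betaI conv_refl]) simp
  also have "\<dots> \<approx> sem M (case_nat ?V \<rho>) \<sigma> K"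
  proof (rule conv_betaI)
    have 1: "(\<lambda>i. psub (case_nat ?V LV) (ups \<rho> i)) = case_nat ?V \<rho>"
      by (auto simp: fun_eq_iff ups_def split: nat.split)
    show "psub (case_nat K LV) (psub (ups (case_nat ?V LV)) (sem M (rs (ups \<rho>)) (rs (rs \<sigma>)) (LV 0))) =
      sem M (case_nat ?V \<rho>) \<sigma> K"
      by (simp add: psub_sem 1)
  qed
  also have "\<dots> \<approx> sem (Whr M V) \<rho> \<sigma> K"
  proof -
    have 1: "(\<lambda>i. psub (case_nat ?V LV) (ups \<rho> i)) = case_nat ?V \<rho>"
      by (auto simp: fun_eq_iff ups_def split: nat.split)
    have "LA (LL (sem M (ups \<rho>) (rs \<sigma>) (ren Suc K))) ?V \<approx> sem M (case_nat ?V \<rho>) \<sigma> K"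
      by (rule conv_betaI) (simp add: psub_sem 1)
    then show ?thesis using r_beta by (simp add: sem_val[of V] conv_sym)
  qed
  finally show ?case .
next
  case (r_whrV V M)
  have 1: "(\<lambda>i. psub (case_nat (star V \<rho> \<sigma>) LV) (ups \<rho> i)) = case_nat (star V \<rho> \<sigma>) \<rho>"
    by (auto simp: fun_eq_iff ups_def split: nat.split)
  have "LA (LL (sem M (ups \<rho>) (rs \<sigma>) (ren Suc K))) (star V \<rho> \<sigma>) \<approx> sem M (case_nat (star V \<rho> \<sigma>) \<rho>) \<sigma> K"
    by (rule conv_betaI) (simp add: psub_sem 1)
  then show ?case using r_whrV by (simp add: sem_val[of V] sem_substx)
next
  case (r_whrMu M J)
  then show ?case by (simp add: semj_ctx)
next
  case (r_jmpMu l J)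
  have "(\<lambda>i. \<sigma> (merge 0 l i)) = case_nat (\<sigma> l) \<sigma>"
    by (auto simp: fun_eq_iff merge_def split: nat.split)
  then show ?case by (simp add: renk_conv_ren sem_ren)
next
  case (r_eta V)
  have "star (liftx_t 0 V) (rs (ups \<rho>)) (rs (rs \<sigma>)) = ren Suc (ren Suc (star V \<rho> \<sigma>))"
    using r_eta by (simp add: liftx_conv_ren star_ren ren_sem)
  then have "sem (Lam (App (liftx_t 0 V) (Var 0))) \<rho> \<sigma> K \<approx>
      LA K (LL (LL (LA (ren Suc (LA (ren Suc (star V \<rho> \<sigma>)) (LV 0))) (LV 0))))"
    using r_eta by (simp add: liftx_conv_ren)
  \<comment> \<open>One source eta step is two target eta steps, first on the continuation variable
    and then on the ordinary one.\<close>
  also have "\<dots> \<approx> LA K (LL (LA (ren Suc (star V \<rho> \<sigma>)) (LV 0)))"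
    by (intro conv_LA conv_LL conv_eta conv_refl)
  also have "\<dots> \<approx> LA K (star V \<rho> \<sigma>)"
    by (intro conv_LA conv_eta conv_refl)
  finally show ?case using r_eta by (simp add: sem_val)
next
  case (r_whrvar M)
  then show ?case by (simp add: conv_sem_K conv_eta)
next
  case (r_muJmp M)
  then show ?case by (simp add: liftk_conv_ren sem_ren)
next
  case (s_App1 M M' N)
  show ?case by (rule conv_trans[OF sem_App conv_trans[OF s_App1.IH conv_sym[OF sem_App]]])
next
  case (s_App2 N N' M)
  have "sem M \<rho> \<sigma> (LL (sem N (rs \<rho>) (rs \<sigma>) (appK K))) \<approx> sem M \<rho> \<sigma> (LL (sem N' (rs \<rho>) (rs \<sigma>) (appK K)))"
    using s_App2 by (intro conv_sem_K conv_LL)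
  then show ?case by (rule conv_trans[OF sem_App conv_trans[OF _ conv_sym[OF sem_App]]])
next
  case (s_Lam M M')
  then show ?case by (simp add: conv_LA conv_LL)
next
  case (s_Whr1 L L' M)
  then show ?case by (simp add: conv_sem_K conv_LL)
next
  case (s_JWhr1 J J' M)
  then show ?case by (simp add: conv_sem_K conv_LL)
qed (auto intro: conv_LA conv_LL)

lemma red_sem: "red\<^sup>*\<^sup>* M N \<Longrightarrow> sem M \<rho> \<sigma> K \<approx> sem N \<rho> \<sigma> K"
proof (induction rule: rtranclp_induct)
  case (step N P)
  then obtain N1 P1 where "eqv_t N N1" "step_t N1 P1" "eqv_t P1 P" by (auto simp: red_def)
  then have "sem N \<rho> \<sigma> K \<approx> sem P \<rho> \<sigma> K" using eqv_sem(1) step_sem(1) by metis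
  then show ?case using step.IH conv_trans by blast
qed simp

text \<open>The real difference lies in the mu clause, where \<open>cps\<close> leaves the redex
  (lambda k.J) K that \<open>sem\<close> has already contracted. The other clauses propagate this
  conversion through the continuation argument.\<close>

lemma cps_conv_sem:
  "cps M r s K \<approx> sem M (\<lambda>i. LV (r i)) (\<lambda>i. LV (s i)) K"
  "isval V \<Longrightarrow> vstar V r s \<approx> star V (\<lambda>i. LV (r i)) (\<lambda>i. LV (s i))"
  "cpsj J r s \<approx> semj J (\<lambda>i. LV (r i)) (\<lambda>i. LV (s i))"
proof (induction M r s K and V r s and J r s rule: cps_vstar_cpsj.induct)
  have e: "(\<lambda>i. LV (ext0 r i)) = ups (\<lambda>i. LV (r i))" for r
    by (auto simp: fun_eq_iff ups_def ext0_def split: nat.split)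
  have l: "(\<lambda>i. LV (case i of 0 \<Rightarrow> 1 | Suc j \<Rightarrow> r j + 2)) = rs (ups (\<lambda>i. LV (r i)))" for r
    by (auto simp: fun_eq_iff ups_def split: nat.split)
  have l2: "(\<lambda>i. LV (s i + 2)) = rs (rs (\<lambda>i. LV (s i)))" for s
    by simp
  {
    case (2 M r s)
    then show ?case unfolding vstar.simps star.simps l l2 by (intro conv_LL)
  next
    case (7 M r s K)
    then show ?case unfolding cps.simps sem.simps l l2 by (intro conv_LL conv_LA conv_refl)
  next
    case (8 M N r s K)
    consider "isval M" "isval N" | "isval M" "\<not> isval N" | "\<not> isval M" "isval N" | "\<not> isval M" "\<not> isval N"
      by blast
    then show ?case
    proof cases
      case 1
      then show ?thesis using 8 by (simp add: conv_LA)
    next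
      case 2
      let ?K = "\<lambda>V. LL (LA (LA V (LV 0)) (ren Suc K))"
      have "cps N r s (?K (vstar M (Suc \<circ> r) (Suc \<circ> s))) \<approx>
          sem N (\<lambda>i. LV (r i)) (\<lambda>i. LV (s i)) (?K (vstar M (Suc \<circ> r) (Suc \<circ> s)))"
        using 8 2 by simp
      also have "\<dots> \<approx> sem N (\<lambda>i. LV (r i)) (\<lambda>i. LV (s i)) (?K (star M (\<lambda>i. LV (Suc (r i))) (\<lambda>i. LV (Suc (s i)))))"
        using 8 2 by (intro conv_sem_K conv_LL conv_LA conv_refl) (simp add: comp_def)
      finally show ?thesis using 2 by simp
    next
      case 3
      let ?K = "\<lambda>V. LL (LA (LA (LV 0) V) (ren Suc K))"
      have "cps M r s (?K (vstar N (Suc \<circ> r) (Suc \<circ> s))) \<approx>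
          sem M (\<lambda>i. LV (r i)) (\<lambda>i. LV (s i)) (?K (vstar N (Suc \<circ> r) (Suc \<circ> s)))"
        using 8 3 by simp
      also have "\<dots> \<approx> sem M (\<lambda>i. LV (r i)) (\<lambda>i. LV (s i)) (?K (star N (\<lambda>i. LV (Suc (r i))) (\<lambda>i. LV (Suc (s i)))))"
        using 8 3 by (intro conv_sem_K conv_LL conv_LA conv_refl) (simp add: comp_def)
      finally show ?thesis using 3 by simp
    next
      case 4
      have "cps M r s (LL (cps N (Suc \<circ> r) (Suc \<circ> s) (appK K))) \<approx>
          sem M (\<lambda>i. LV (r i)) (\<lambda>i. LV (s i)) (LL (cps N (Suc \<circ> r) (Suc \<circ> s) (appK K)))"
        using 8 4 by simp
      also have "\<dots> \<approx> sem M (\<lambda>i. LV (r i)) (\<lambda>i. LV (s i)) (LL (sem N (\<lambda>i. LV (Suc (r i))) (\<lambda>i. LV (Suc (s i))) (appK K)))"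
        using 8 4 by (intro conv_sem_K conv_LL) (simp add: comp_def)
      finally show ?thesis using 4 by simp
    qed
  next
    case (9 L M r s K)
    have "LL (cps L (ext0 r) (Suc \<circ> s) (ren Suc K)) \<approx> LL (sem L (ups (\<lambda>i. LV (r i))) (\<lambda>i. LV (Suc (s i))) (ren Suc K))"
      using 9 by (intro conv_LL) (simp add: e comp_def)
    then show ?case using conv_trans[OF _ conv_sem_K] 9 by simp
  next
    case (10 J r s K)
    have "LA (LL (cpsj J (Suc \<circ> r) (ext0 s))) K \<approx> LA (LL (semj J (\<lambda>i. LV (Suc (r i))) (ups (\<lambda>i. LV (s i))))) K"
      using 10 by (intro conv_LA conv_LL conv_refl) (simp add: e comp_def)
    also have "\<dots> \<approx> semj J (\<lambda>i. LV (r i)) (case_nat K (\<lambda>i. LV (s i)))"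
      by (rule conv_betaI) (auto simp: psub_sem ups_def fun_eq_iff intro!: arg_cong2[where f = "semj J"] split: nat.split)
    finally show ?case by simp
  next
    case (12 J M r s)
    have "LL (cpsj J (ext0 r) (Suc \<circ> s)) \<approx> LL (semj J (ups (\<lambda>i. LV (r i))) (\<lambda>i. LV (Suc (s i))))"
      using 12 by (intro conv_LL) (simp add: e comp_def)
    then show ?case using conv_trans[OF _ conv_sem_K] 12 by simp
  }
qed auto

section \<open>Interpretations of normal forms are normalizing\<close>

fun isLL :: "lt \<Rightarrow> bool" where
  "isLL (LL t) = True"
| "isLL _ = False"

primrec bnorm :: "lt \<Rightarrow> bool" where
  "bnorm (LV i) = True"
| "bnorm (LL t) = bnorm t"
| "bnorm (LA s t) = (bnorm s \<and> bnorm t \<and> \<not> isLL s)"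

lemma isLL_ren [simp]: "isLL (ren f t) = isLL t"
  by (cases t) auto

lemma bnorm_ren [simp]: "bnorm (ren f t) = bnorm t"
  by (induction t arbitrary: f) auto

text \<open>From a beta-normal term only eta is possible, and it shrinks the term. The last conjunct
  prevents a step in function position from producing an abstraction there, hence a new beta
  redex.\<close>

lemma bnorm_step: "beta_eta t t' \<Longrightarrow> bnorm t \<Longrightarrow> bnorm t' \<and> size t' < size t \<and> (isLL t' \<longrightarrow> isLL t)"
  by (induction rule: beta_eta.induct) auto

lemma bnorm_has_be_nf: "bnorm t \<Longrightarrow> has_be_nf t"
proof (induction "size t" arbitrary: t rule: less_induct)
  case less
  show ?case
  proof (cases "\<exists>t'. beta_eta t t'")
    case True
    then obtain t' where t': "beta_eta t t'" by blast
    then have "has_be_nf t'" using bnorm_step less by blast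
    then show ?thesis using t' unfolding has_be_nf_def by (meson converse_rtranclp_into_rtranclp)
  qed (auto simp: has_be_nf_def)
qed

text \<open>The conditions on \<open>K\<close> follow from where it ends up. A value at the end puts
  \<open>K\<close> in function position, so it must not be an abstraction; a mu stores
  \<open>K\<close> in the environment, whose entries occur in function position and must stay
  variables; an application takes \<open>K\<close> as an argument, where abstractions are
  allowed.\<close>

lemma nf_sem_bnorm:
  "nf_t M \<Longrightarrow> bnorm K \<Longrightarrow> tail M = SApp \<or> \<not> isLL K \<Longrightarrow> (tail M = SMu \<longrightarrow> (\<exists>i. K = LV i)) \<Longrightarrow>
    (\<And>i. \<exists>j. \<rho> i = LV j) \<Longrightarrow> (\<And>i. \<exists>j. \<sigma> i = LV j) \<Longrightarrow> bnorm (sem M \<rho> \<sigma> K)"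
  "nf_j J \<Longrightarrow> (\<And>i. \<exists>j. \<rho> i = LV j) \<Longrightarrow> (\<And>i. \<exists>j. \<sigma> i = LV j) \<Longrightarrow> bnorm (semj J \<rho> \<sigma>)"
proof (induction M and J arbitrary: \<rho> \<sigma> K and \<rho> \<sigma>)
  have ups: "\<exists>j. ups \<rho> i = LV j" and rs: "\<exists>j. ren Suc (\<rho> i) = LV j"
    if "\<And>i. \<exists>j. \<rho> i = LV j" for \<rho> i
    using that by (auto simp: ups_def split: nat.split) (metis ren.simps(1))+
  {
    case (Var i)
    then show ?case by (metis bnorm.simps(1,3) isLL.simps(2) sem.simps(1) shape.distinct(1) tail.simps(1))
  next
    case (Lam M)
    have "bnorm (sem M (rs (ups \<rho>)) (rs (rs \<sigma>)) (LV 0))"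
      by (rule Lam.IH) (use Lam.prems in \<open>auto intro!: rs ups\<close>)
    then show ?case using Lam.prems by auto
  next
    case (App M N)
    then obtain i where M: "M = Var i" and N: "isval N" "nf_t N" by auto
    obtain j where j: "\<rho> i = LV j" using App.prems by blast
    \<comment> \<open>The variable is a dummy continuation: normality of \<open>star N\<close> is
      read off as the argument in \<open>LA (LV 0) (star N \<rho> \<sigma>)\<close>.\<close>
    have "bnorm (sem N \<rho> \<sigma> (LV 0))"
      by (rule App.IH(2)) (use App.prems in auto)
    then show ?case using M N j App.prems by (simp add: sem_val)
  next
    case (Whr L M)
    have "bnorm (sem L (ups \<rho>) (rs \<sigma>) (ren Suc K))"
      by (rule Whr.IH(1)) (use Whr.prems in \<open>auto intro!: ups rs\<close>)
    then have "bnorm (sem M \<rho> \<sigma> (LL (sem L (ups \<rho>) (rs \<sigma>) (ren Suc K))))"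
      by (intro Whr.IH(2)) (use Whr.prems in auto)
    then show ?case by simp
  next
    case (Mu J)
    then have "\<exists>j. case_nat K \<sigma> i = LV j" for i by (auto split: nat.split)
    then show ?case using Mu by auto
  next
    case (Jmp k M)
    then show ?case by (metis (no_types, lifting) bnorm.simps(1) isLL.simps(2) nf_j.simps(1) semj.simps(1))
  next
    case (JWhr J M)
    have "bnorm (semj J (ups \<rho>) (rs \<sigma>))"
      by (rule JWhr.IH(1)) (use JWhr.prems in \<open>auto intro!: ups rs\<close>)
    then have "bnorm (sem M \<rho> \<sigma> (LL (semj J (ups \<rho>) (rs \<sigma>))))"
      by (intro JWhr.IH(2)) (use JWhr.prems in auto)
    then show ?case by simp
  }
qed

lemma normalizable_imp_has_be_nf:
  assumes "normalizable M"
  shows "has_be_nf (cps_top M)"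
proof -
  obtain N where N: "red\<^sup>*\<^sup>* M N" "nf_t N"
    using assms by (auto simp: normalizable_def normal_src_iff_nf)
  let ?r = "\<lambda>i. LV (Suc (2 * i))" and ?s = "\<lambda>i. LV (Suc (2 * i + 1))"
  have "cps_top M \<approx> LL (sem M ?r ?s (LV 0))"
    unfolding cps_top_def by (intro conv_LL cps_conv_sem)
  also have "\<dots> \<approx> LL (sem N ?r ?s (LV 0))"
    by (intro conv_LL red_sem N)
  finally have "cps_top M \<approx> LL (sem N ?r ?s (LV 0))" .
  moreover have "bnorm (LL (sem N ?r ?s (LV 0)))"
    using nf_sem_bnorm(1)[OF N(2), of "LV 0" ?r ?s] by simp
  ultimately show ?thesis using has_be_nf_conv bnorm_has_be_nf by blast
qed

section \<open>Reading target terms back as source terms\<close>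

datatype slot = X nat | C nat | H

primrec smap :: "(nat \<Rightarrow> nat) \<Rightarrow> (nat \<Rightarrow> nat) \<Rightarrow> slot \<Rightarrow> slot" where
  "smap a b (X j) = X (a j)"
| "smap a b (C j) = C (b j)"
| "smap a b H = H"

definition extX :: "(nat \<Rightarrow> slot) \<Rightarrow> nat \<Rightarrow> slot" where
  "extX \<gamma> = case_nat (X 0) (\<lambda>i. smap Suc id (\<gamma> i))"

definition extC :: "(nat \<Rightarrow> slot) \<Rightarrow> nat \<Rightarrow> slot" where
  "extC \<gamma> = case_nat (C 0) (\<lambda>i. smap id Suc (\<gamma> i))"

definition extH :: "(nat \<Rightarrow> slot) \<Rightarrow> nat \<Rightarrow> slot" where
  "extH \<gamma> = case_nat H \<gamma>"

lemma ext_simps [simp]: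
  "extX \<gamma> 0 = X 0" "extX \<gamma> (Suc i) = smap Suc id (\<gamma> i)"
  "extC \<gamma> 0 = C 0" "extC \<gamma> (Suc i) = smap id Suc (\<gamma> i)"
  "extH \<gamma> 0 = H" "extH \<gamma> (Suc i) = \<gamma> i"
  by (simp_all add: extX_def extC_def extH_def)

lemma smap_eq_iff:
  "smap a b s = X j \<longleftrightarrow> (\<exists>i. s = X i \<and> j = a i)"
  "smap a b s = C j \<longleftrightarrow> (\<exists>i. s = C i \<and> j = b i)"
  "smap a b s = H \<longleftrightarrow> s = H"
  by (cases s; auto)+

text \<open>A context \<open>\<gamma>\<close> says which source variable a target variable stands for; \<open>H\<close> marks a target
variable without source counterpart. In \<open>RE \<gamma> h q M\<close> the command \<open>q\<close> is \<open>M\<close> run with the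
continuation variable \<open>h\<close>, whether or not \<open>\<gamma> h\<close> is \<open>H\<close>. Rule \<open>T2\<close> reads \<open>\<lambda>k.q\<close> back as \<open>M\<close> rather than
as the expansion \<open>\<mu>k.[k]M\<close>; otherwise a source term would not reduce to the read-back of its
translation.\<close>

inductive RT :: "(nat \<Rightarrow> slot) \<Rightarrow> lt \<Rightarrow> trm \<Rightarrow> bool"
  and RW :: "(nat \<Rightarrow> slot) \<Rightarrow> lt \<Rightarrow> trm \<Rightarrow> bool"
  and RE :: "(nat \<Rightarrow> slot) \<Rightarrow> nat \<Rightarrow> lt \<Rightarrow> trm \<Rightarrow> bool"
  and RK :: "(nat \<Rightarrow> slot) \<Rightarrow> nat \<Rightarrow> lt \<Rightarrow> trm option \<Rightarrow> bool" where
  T1: "RE (extC \<gamma>) h q M \<Longrightarrow> extC \<gamma> h = C j \<Longrightarrow> RT \<gamma> (LL q) (Mu (Jmp j M))"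
| T2: "RE (extH \<gamma>) 0 q M \<Longrightarrow> RT \<gamma> (LL q) M"
| T3: "RW \<gamma> w V \<Longrightarrow> RW \<gamma> w' V' \<Longrightarrow> RT \<gamma> (LA w w') (App V V')"
| W1: "\<gamma> i = X j \<Longrightarrow> RW \<gamma> (LV i) (Var j)"
| W2: "RT (extX \<gamma>) t M \<Longrightarrow> RW \<gamma> (LL t) (Lam M)"
| Q1: "RK \<gamma> h K c \<Longrightarrow> RW \<gamma> w V \<Longrightarrow> RE \<gamma> h (LA K w) (plug c V)"
| Q2: "RT \<gamma> t M \<Longrightarrow> RK \<gamma> h K c \<Longrightarrow> RE \<gamma> h (LA t K) (plug c M)"
| K1: "RK \<gamma> h (LV h) None"
| K2: "RE (extX \<gamma>) (Suc h) q L \<Longrightarrow> RK \<gamma> h (LL q) (Some L)"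

lemmas R_induct = RT_RW_RE_RK.inducts

inductive_cases RT_LL: "RT \<gamma> (LL q) M"
inductive_cases RT_LA: "RT \<gamma> (LA s t) M"
inductive_cases RT_LV [elim!]: "RT \<gamma> (LV i) M"
inductive_cases RW_LV: "RW \<gamma> (LV i) V"
inductive_cases RW_LL: "RW \<gamma> (LL t) V"
inductive_cases RW_LA [elim!]: "RW \<gamma> (LA s t) V"
inductive_cases RE_LA: "RE \<gamma> h (LA s t) M"
inductive_cases RE_LV [elim!]: "RE \<gamma> h (LV i) M"
inductive_cases RE_LL [elim!]: "RE \<gamma> h (LL t) M"
inductive_cases RK_LV: "RK \<gamma> h (LV i) c"
inductive_cases RK_LL: "RK \<gamma> h (LL q) c"
inductive_cases RK_LA [elim!]: "RK \<gamma> h (LA s t) c"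

lemma RW_isval: "RW \<gamma> w V \<Longrightarrow> isval V"
  by (erule RW.cases) auto

section \<open>Renaming and strengthening of read-backs\<close>

abbreviation liftc :: "trm option \<Rightarrow> trm option" where
  "liftc \<equiv> map_option (ren_t (up Suc) id)"

lemma ren_plug: "ren_t a b (plug c M) = plug (map_option (ren_t (up a) b) c) (ren_t a b M)"
  by (cases c) auto

text \<open>Slots \<open>H\<close> are exempt since reading back never consults them. A renaming may
  therefore send a hole to any variable, in particular identify it with a real continuation
  variable.\<close>

definition match where
  "match \<gamma> \<gamma>' f a b \<longleftrightarrow> (\<forall>i. \<gamma> i = H \<or> \<gamma>' (f i) = smap a b (\<gamma> i))"

lemma smap_smap: "smap a b (smap a' b' s) = smap (a \<circ> a') (b \<circ> b') s"
  by (cases s) auto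

lemma match_ext:
  assumes "match \<gamma> \<gamma>' f a b"
  shows "match (extX \<gamma>) (extX \<gamma>') (up f) (up a) b"
    and "match (extC \<gamma>) (extC \<gamma>') (up f) a (up b)"
    and "match (extH \<gamma>) (extH \<gamma>') (up f) a b"
proof -
  have *: "\<gamma> i = H \<or> \<gamma>' (f i) = smap a b (\<gamma> i)" for i
    using assms by (simp add: match_def)
  show "match (extX \<gamma>) (extX \<gamma>') (up f) (up a) b"
    unfolding match_def
  proof
    fix i show "extX \<gamma> i = H \<or> extX \<gamma>' (up f i) = smap (up a) b (extX \<gamma> i)"
      using *[of "i - 1"] by (cases i; cases "\<gamma> (i - 1)") auto
  qed
  show "match (extC \<gamma>) (extC \<gamma>') (up f) a (up b)"
    unfolding match_def
  proof
    fix i show "extC \<gamma> i = H \<or> extC \<gamma>' (up f i) = smap a (up b) (extC \<gamma> i)"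
      using *[of "i - 1"] by (cases i; cases "\<gamma> (i - 1)") auto
  qed
  show "match (extH \<gamma>) (extH \<gamma>') (up f) a b"
    unfolding match_def
  proof
    fix i show "extH \<gamma> i = H \<or> extH \<gamma>' (up f i) = smap a b (extH \<gamma> i)"
      using *[of "i - 1"] by (cases i) auto
  qed
qed

lemma matchD: "match \<gamma> \<gamma>' f a b \<Longrightarrow> \<gamma> i = X j \<Longrightarrow> \<gamma>' (f i) = X (a j)"
    "match \<gamma> \<gamma>' f a b \<Longrightarrow> \<gamma> i = C j \<Longrightarrow> \<gamma>' (f i) = C (b j)"
  unfolding match_def by (metis slot.distinct smap.simps)+

lemma R_ren:
  "RT \<gamma> t M \<Longrightarrow> match \<gamma> \<gamma>' f a b \<Longrightarrow> RT \<gamma>' (ren f t) (ren_t a b M)"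
  "RW \<gamma> w V \<Longrightarrow> match \<gamma> \<gamma>' f a b \<Longrightarrow> RW \<gamma>' (ren f w) (ren_t a b V)"
  "RE \<gamma> h q M \<Longrightarrow> match \<gamma> \<gamma>' f a b \<Longrightarrow> RE \<gamma>' (f h) (ren f q) (ren_t a b M)"
  "RK \<gamma> h K c \<Longrightarrow> match \<gamma> \<gamma>' f a b \<Longrightarrow>
    RK \<gamma>' (f h) (ren f K) (map_option (ren_t (up a) b) c)"
proof (induction arbitrary: \<gamma>' f a b and \<gamma>' f a b and \<gamma>' f a b and \<gamma>' f a b rule: R_induct)
  case (T1 \<gamma> h q M j)
  have "RE (extC \<gamma>') (up f h) (ren (up f) q) (ren_t a (up b) M)"
    using T1 match_ext by blast
  moreover have "extC \<gamma>' (up f h) = C (up b j)"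
    by (rule matchD(2)[OF match_ext(2)[OF T1.prems] T1.hyps(2)])
  ultimately show ?case by (auto intro: RT_RW_RE_RK.T1)
next
  case (T2 \<gamma> q M)
  have "RE (extH \<gamma>') (up f 0) (ren (up f) q) (ren_t a b M)"
    using T2 match_ext by blast
  then show ?case by (auto intro: RT_RW_RE_RK.T2)
next
  case (W1 \<gamma> i j)
  then show ?case using matchD(1)[OF W1.prems W1.hyps] by (auto intro: RT_RW_RE_RK.W1)
next
  case (W2 \<gamma> t M)
  then show ?case using match_ext(1) by (auto intro: RT_RW_RE_RK.W2)
next
  case (K2 \<gamma> h q L)
  have "RE (extX \<gamma>') (up f (Suc h)) (ren (up f) q) (ren_t (up a) b L)"
    using K2 match_ext by blast
  then show ?case by (auto intro: RT_RW_RE_RK.K2)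
qed (auto simp: ren_plug intro: RT_RW_RE_RK.intros)

lemma match_id [simp]:
  "match \<gamma> (extX \<gamma>) Suc Suc id" "match \<gamma> (extC \<gamma>) Suc id Suc" "match \<gamma> (extH \<gamma>) Suc id id"
proof -
  have "smap id id s = s" for s by (cases s) auto
  then show "match \<gamma> (extX \<gamma>) Suc Suc id" "match \<gamma> (extC \<gamma>) Suc id Suc" "match \<gamma> (extH \<gamma>) Suc id id"
    by (auto simp: match_def)
qed

lemma liftx_0: "liftx_t 0 M = ren_t Suc id M" and liftx_1: "liftx_t 1 M = ren_t (up Suc) id M"
  and liftk_0: "liftk_t 0 M = ren_t id Suc M"
  using up_skip[of 0] by (simp_all add: liftx_conv_ren liftk_conv_ren)

text \<open>Unlike \<open>match\<close> this constrains every index, \<open>H\<close> included,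
  because slots met after renaming have to be traced back to slots before it.\<close>

definition pull where
  "pull \<gamma> f a b \<gamma>' \<longleftrightarrow> (\<forall>i. \<gamma> (f i) = smap a b (\<gamma>' i))"

lemma pull_ext:
  assumes "pull \<gamma> f a b \<gamma>'"
  shows "pull (extX \<gamma>) (up f) (up a) b (extX \<gamma>')"
    and "pull (extC \<gamma>) (up f) a (up b) (extC \<gamma>')"
    and "pull (extH \<gamma>) (up f) a b (extH \<gamma>')"
proof -
  have "extX \<gamma> (up f i) = smap (up a) b (extX \<gamma>' i)"
    and "extC \<gamma> (up f i) = smap a (up b) (extC \<gamma>' i)"
    and "extH \<gamma> (up f i) = smap a b (extH \<gamma>' i)" for i
    using assms unfolding pull_def by (cases i; cases "\<gamma>' (i - 1)"; auto)+
  then show "pull (extX \<gamma>) (up f) (up a) b (extX \<gamma>')"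
    and "pull (extC \<gamma>) (up f) a (up b) (extC \<gamma>')"
    and "pull (extH \<gamma>) (up f) a b (extH \<gamma>')"
    unfolding pull_def by blast+
qed

lemma pull_Suc [simp]:
  "pull (extX \<gamma>) Suc Suc id \<gamma>" "pull (extC \<gamma>) Suc id Suc \<gamma>" "pull (extH \<gamma>) Suc id id \<gamma>"
proof -
  have "smap id id s = s" for s by (cases s) auto
  then show "pull (extX \<gamma>) Suc Suc id \<gamma>" "pull (extC \<gamma>) Suc id Suc \<gamma>" "pull (extH \<gamma>) Suc id id \<gamma>"
    by (auto simp: pull_def)
qed

text \<open>Strengthening, used for the eta rules: a target term avoiding the newest variable has a
  read-back avoiding it too, which is the side condition of the corresponding source rule.\<close>

lemma R_unren:
  "RT \<gamma> t' M \<Longrightarrow> t' = ren f t \<Longrightarrow> pull \<gamma> f a b \<gamma>' \<Longrightarrow> \<exists>M'. M = ren_t a b M' \<and> RT \<gamma>' t M'"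
  "RW \<gamma> w' V \<Longrightarrow> w' = ren f w \<Longrightarrow> pull \<gamma> f a b \<gamma>' \<Longrightarrow> \<exists>V'. V = ren_t a b V' \<and> RW \<gamma>' w V'"
  "RE \<gamma> h q' M \<Longrightarrow> q' = ren f q \<Longrightarrow> pull \<gamma> f a b \<gamma>' \<Longrightarrow>
    \<exists>M' h'. h = f h' \<and> M = ren_t a b M' \<and> RE \<gamma>' h' q M'"
  "RK \<gamma> h K' c \<Longrightarrow> K' = ren f K \<Longrightarrow> pull \<gamma> f a b \<gamma>' \<Longrightarrow>
    \<exists>c' h'. h = f h' \<and> c = map_option (ren_t (up a) b) c' \<and> RK \<gamma>' h' K c'"
proof (induction arbitrary: \<gamma>' f a b t and \<gamma>' f a b w and \<gamma>' f a b q and \<gamma>' f a b K rule: R_induct)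
  {
    case (T1 \<gamma> h q M j)
    from T1.prems(1) obtain q' where t: "t = LL q'" "q = ren (up f) q'" by (cases t) auto
    obtain M' h' where h': "h = up f h'" "M = ren_t a (up b) M'" "RE (extC \<gamma>') h' q' M'"
      using T1.IH[OF t(2) pull_ext(2)] T1.prems(2) by blast
    obtain j' where "extC \<gamma>' h' = C j'" "j = up b j'"
      using T1.hyps(2) pull_ext(2)[OF T1.prems(2)] h'(1) by (auto simp: pull_def smap_eq_iff)
    then show ?case using h' t by (intro exI[of _ "Mu (Jmp j' M')"]) (auto intro: RT_RW_RE_RK.T1)
  next
    case (T2 \<gamma> q M)
    from T2.prems(1) obtain q' where t: "t = LL q'" "q = ren (up f) q'" by (cases t) auto
    obtain M' h' where h': "0 = up f h'" "M = ren_t a b M'" "RE (extH \<gamma>') h' q' M'"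
      using T2.IH[OF t(2) pull_ext(3)] T2.prems(2) by blast
    then show ?case using t by (auto intro: RT_RW_RE_RK.T2)
  next
    case (T3 \<gamma> w V w' V')
    from T3.prems(1) obtain u u' where t: "t = LA u u'" "w = ren f u" "w' = ren f u'" by (cases t) auto
    obtain V1 where "V = ren_t a b V1" "RW \<gamma>' u V1" using T3.IH(1)[OF t(2)] T3.prems by blast
    moreover obtain V2 where "V' = ren_t a b V2" "RW \<gamma>' u' V2" using T3.IH(2)[OF t(3)] T3.prems by blast
    ultimately show ?case using t by (intro exI[of _ "App V1 V2"]) (auto intro: RT_RW_RE_RK.T3)
  next
    case (W1 \<gamma> i j)
    from W1.prems(1) obtain i' where w: "w = LV i'" "i = f i'" by (cases w) auto
    then obtain j' where "\<gamma>' i' = X j'" "j = a j'" using W1 by (auto simp: pull_def smap_eq_iff)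
    then show ?case using w by (intro exI[of _ "Var j'"]) (auto intro: RT_RW_RE_RK.W1)
  next
    case (W2 \<gamma> t M)
    from W2.prems(1) obtain t' where w: "w = LL t'" "t = ren (up f) t'" by (cases w) auto
    obtain M' where "M = ren_t (up a) b M'" "RT (extX \<gamma>') t' M'"
      using W2.IH[OF w(2) pull_ext(1)] W2.prems(2) by blast
    then show ?case using w by (intro exI[of _ "Lam M'"]) (auto intro: RT_RW_RE_RK.W2)
  next
    case (Q1 \<gamma> h K c w V)
    from Q1.prems(1) obtain K' w' where q: "q = LA K' w'" "K = ren f K'" "w = ren f w'" by (cases q) auto
    obtain c' h' where "h = f h'" "c = map_option (ren_t (up a) b) c'" "RK \<gamma>' h' K' c'"
      using Q1.IH(1)[OF q(2)] Q1.prems by blast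
    moreover obtain V' where "V = ren_t a b V'" "RW \<gamma>' w' V'" using Q1.IH(2)[OF q(3)] Q1.prems by blast
    ultimately show ?case using q
      by (intro exI[of _ "plug c' V'"] exI[of _ h']) (auto simp: ren_plug intro: RT_RW_RE_RK.Q1)
  next
    case (Q2 \<gamma> t M h K c)
    from Q2.prems(1) obtain K' t' where q: "q = LA t' K'" "K = ren f K'" "t = ren f t'" by (cases q) auto
    obtain c' h' where "h = f h'" "c = map_option (ren_t (up a) b) c'" "RK \<gamma>' h' K' c'"
      using Q2.IH(2)[OF q(2)] Q2.prems by blast
    moreover obtain M' where "M = ren_t a b M'" "RT \<gamma>' t' M'" using Q2.IH(1)[OF q(3)] Q2.prems by blast
    ultimately show ?case using q
      by (intro exI[of _ "plug c' M'"] exI[of _ h']) (auto simp: ren_plug intro: RT_RW_RE_RK.Q2)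
  next
    case (K1 \<gamma> h)
    from K1.prems(1) obtain i' where "K = LV i'" "h = f i'" by (cases K) auto
    then show ?case by (intro exI[of _ None] exI[of _ i']) (auto intro: RT_RW_RE_RK.K1)
  next
    case (K2 \<gamma> h q L)
    from K2.prems(1) obtain q' where t: "K = LL q'" "q = ren (up f) q'" by (cases K) auto
    obtain L' h' where h': "Suc h = up f h'" "L = ren_t (up a) b L'" "RE (extX \<gamma>') h' q' L'"
      using K2.IH[OF t(2) pull_ext(1)] K2.prems(2) by blast
    then obtain h'' where "h' = Suc h''" "h = f h''" by (auto simp: up_eq_Suc)
    then show ?case using h' t
      by (intro exI[of _ "Some L'"] exI[of _ h'']) (auto intro: RT_RW_RE_RK.K2)
  }
qed

text \<open>Prepares the change of reading from \<open>T1\<close> to \<open>T2\<close>: if the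
  read-back does not mention k, the slot of k may become \<open>H\<close>.\<close>

lemma R_drop:
  "RT \<gamma> t M \<Longrightarrow> (\<And>i. \<gamma>' i = \<gamma> i \<or> (\<exists>k. \<gamma> i = C k \<and> k \<notin> fk_t M)) \<Longrightarrow> RT \<gamma>' t M"
  "RW \<gamma> w V \<Longrightarrow> (\<And>i. \<gamma>' i = \<gamma> i \<or> (\<exists>k. \<gamma> i = C k \<and> k \<notin> fk_t V)) \<Longrightarrow> RW \<gamma>' w V"
  "RE \<gamma> h q M \<Longrightarrow> (\<And>i. \<gamma>' i = \<gamma> i \<or> (\<exists>k. \<gamma> i = C k \<and> k \<notin> fk_t M)) \<Longrightarrow> RE \<gamma>' h q M"
  "RK \<gamma> h K c \<Longrightarrow> (\<And>i. \<gamma>' i = \<gamma> i \<or> (\<exists>k. \<gamma> i = C k \<and> (\<forall>L. c = Some L \<longrightarrow> k \<notin> fk_t L))) \<Longrightarrow> RK \<gamma>' h K c"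
proof (induction arbitrary: \<gamma>' and \<gamma>' and \<gamma>' and \<gamma>' rule: R_induct)
  case (T1 \<gamma> h q M j)
  have *: "extC \<gamma>' i = extC \<gamma> i \<or> (\<exists>k. extC \<gamma> i = C k \<and> k \<notin> fk_t M \<and> k \<noteq> j)" for i
    using T1.prems[of "i - 1"] by (cases i) auto
  then have "RE (extC \<gamma>') h q M" by (intro T1.IH) blast
  moreover have "extC \<gamma>' h = C j" using *[of h] T1.hyps by auto
  ultimately show ?case by (rule RT_RW_RE_RK.T1)
next
  case (T2 \<gamma> q M)
  have "RE (extH \<gamma>') 0 q M"
  proof (rule T2.IH)
    fix i show "extH \<gamma>' i = extH \<gamma> i \<or> (\<exists>k. extH \<gamma> i = C k \<and> k \<notin> fk_t M)"
      using T2.prems[of "i - 1"] by (cases i) auto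
  qed
  then show ?case by (rule RT_RW_RE_RK.T2)
next
  case (T3 \<gamma> w V w' V')
  have "RW \<gamma>' w V" by (rule T3.IH(1)) (use T3.prems in force)
  moreover have "RW \<gamma>' w' V'" by (rule T3.IH(2)) (use T3.prems in force)
  ultimately show ?case by (rule RT_RW_RE_RK.T3)
next
  case (W1 \<gamma> i j)
  then show ?case by (metis RT_RW_RE_RK.W1 slot.distinct(1))
next
  case (W2 \<gamma> t M)
  have "RT (extX \<gamma>') t M"
  proof (rule W2.IH)
    fix i show "extX \<gamma>' i = extX \<gamma> i \<or> (\<exists>k. extX \<gamma> i = C k \<and> k \<notin> fk_t M)"
      using W2.prems[of "i - 1"] by (cases i) auto
  qed
  then show ?case by (rule RT_RW_RE_RK.W2)
next
  case (Q1 \<gamma> h K c w V)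
  have "RK \<gamma>' h K c" by (rule Q1.IH(1)) (use Q1.prems in \<open>cases c; force\<close>)
  moreover have "RW \<gamma>' w V" by (rule Q1.IH(2)) (use Q1.prems in \<open>cases c; force\<close>)
  ultimately show ?case by (rule RT_RW_RE_RK.Q1)
next
  case (Q2 \<gamma> t M h K c)
  have "RK \<gamma>' h K c" by (rule Q2.IH(2)) (use Q2.prems in \<open>cases c; force\<close>)
  moreover have "RT \<gamma>' t M" by (rule Q2.IH(1)) (use Q2.prems in \<open>cases c; force\<close>)
  ultimately show ?case by (intro RT_RW_RE_RK.Q2)
next
  case (K1 \<gamma> h)
  then show ?case by (intro RT_RW_RE_RK.K1)
next
  case (K2 \<gamma> h q L)
  have "RE (extX \<gamma>') (Suc h) q L"
  proof (rule K2.IH)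
    fix i show "extX \<gamma>' i = extX \<gamma> i \<or> (\<exists>k. extX \<gamma> i = C k \<and> k \<notin> fk_t L)"
      using K2.prems[of "i - 1"] by (cases i) auto
  qed
  then show ?case by (rule RT_RW_RE_RK.K2)
qed

text \<open>A variable in an \<open>H\<close> slot can occur only as the tail. Hence in lambda k.(t
  k) read by \<open>T2\<close>, k is not free in t and the term is an eta redex.\<close>

lemma R_fv:
  "RT \<gamma> t M \<Longrightarrow> i \<in> fv t \<Longrightarrow> \<gamma> i \<noteq> H"
  "RW \<gamma> w V \<Longrightarrow> i \<in> fv w \<Longrightarrow> \<gamma> i \<noteq> H"
  "RE \<gamma> h q M \<Longrightarrow> i \<in> fv q \<Longrightarrow> i \<noteq> h \<Longrightarrow> \<gamma> i \<noteq> H"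
  "RK \<gamma> h K c \<Longrightarrow> i \<in> fv K \<Longrightarrow> i \<noteq> h \<Longrightarrow> \<gamma> i \<noteq> H"
proof (induction arbitrary: i and i and i and i rule: R_induct)
  case (T1 \<gamma> h q M j)
  then have "extC \<gamma> (Suc i) \<noteq> H" by (cases "h = Suc i") (auto simp del: ext_simps)
  then show ?case by (auto simp: smap_eq_iff)
next
  case (T2 \<gamma> q M)
  then show ?case by fastforce
next
  case (W2 \<gamma> t M)
  then have "extX \<gamma> (Suc i) \<noteq> H" by (auto simp del: ext_simps)
  then show ?case by (auto simp: smap_eq_iff)
next
  case (K2 \<gamma> h q L)
  then have "extX \<gamma> (Suc i) \<noteq> H" by (auto simp del: ext_simps)
  then show ?case by (auto simp: smap_eq_iff)
qed auto

text \<open>Exchanges the two innermost target variables. Going under a continuation lambda x.Q puts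
  x inside a tail binder that was added before, while the rules expect the opposite order.\<close>

definition swap :: "nat \<Rightarrow> nat" where
  "swap i = (case i of 0 \<Rightarrow> Suc 0 | Suc 0 \<Rightarrow> 0 | Suc (Suc j) \<Rightarrow> Suc (Suc j))"

lemma swap_simps [simp]: "swap 0 = Suc 0" "swap (Suc 0) = 0" "swap (Suc (Suc i)) = Suc (Suc i)"
  by (simp_all add: swap_def)

lemma ren_case_swap:
  "ren (up (case_nat h id)) (ren swap q) = ren (case_nat (Suc h) id) q"
  unfolding ren_ren by (rule ren_cong) (auto simp: swap_def split: nat.split)

lemma match_swap:
  "match (extH (extX \<gamma>)) (extX (extH \<gamma>)) swap id id"
  "match (extC (extX \<gamma>)) (extX (extC \<gamma>)) swap id id"
proof -
  have "smap id id s = s" for s by (cases s) auto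
  then show "match (extH (extX \<gamma>)) (extX (extH \<gamma>)) swap id id"
    "match (extC (extX \<gamma>)) (extX (extC \<gamma>)) swap id id"
    unfolding match_def by (auto simp: swap_def smap_smap split: nat.split)
qed

text \<open>The variable \<open>h\<close> may occur elsewhere besides being the tail. Here its tail
  occurrence alone is replaced by a fresh hole 0, and identifying 0 with \<open>h\<close> restores
  the original.\<close>

lemma R_split:
  "RE \<gamma> h q M \<Longrightarrow> \<exists>q'. RE (extH \<gamma>) 0 q' M \<and> q = ren (case_nat h id) q'"
  "RK \<gamma> h K c \<Longrightarrow> \<exists>K'. RK (extH \<gamma>) 0 K' c \<and> K = ren (case_nat h id) K'"
proof (induction rule: R_induct(3,4)[where ?P1.0 = "\<lambda>_ _ _. True" and ?P2.0 = "\<lambda>_ _ _. True"])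
  case (Q1 \<gamma> h K c w V)
  then obtain K' where "RK (extH \<gamma>) 0 K' c" "K = ren (case_nat h id) K'" by blast
  moreover have "RW (extH \<gamma>) (ren Suc w) V"
    using R_ren(2)[OF Q1.hyps(2) match_id(3)] by simp
  ultimately show ?case
    by (intro exI[of _ "LA K' (ren Suc w)"]) (auto simp: ren_ren intro: RT_RW_RE_RK.Q1)
next
  case (Q2 \<gamma> t M h K c)
  then obtain K' where "RK (extH \<gamma>) 0 K' c" "K = ren (case_nat h id) K'" by blast
  moreover have "RT (extH \<gamma>) (ren Suc t) M"
    using R_ren(1)[OF Q2.hyps(1) match_id(3)] by simp
  ultimately show ?case
    by (intro exI[of _ "LA (ren Suc t) K'"]) (auto simp: ren_ren intro: RT_RW_RE_RK.Q2)
next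
  case (K1 \<gamma> h)
  show ?case by (intro exI[of _ "LV 0"]) (auto intro: RT_RW_RE_RK.K1)
next
  case (K2 \<gamma> h q L)
  then obtain q' where q': "RE (extH (extX \<gamma>)) 0 q' L" "q = ren (case_nat (Suc h) id) q'" by blast
  have "RE (extX (extH \<gamma>)) (Suc 0) (ren swap q') L"
    using R_ren(3)[OF q'(1) match_swap(1)] by simp
  then show ?case using q'(2)
    by (intro exI[of _ "LL (ren swap q')"]) (auto simp: ren_case_swap intro: RT_RW_RE_RK.K2)
qed auto

section \<open>Substitution in read-backs\<close>

definition good where
  "good \<gamma> \<gamma>' \<theta> a \<kappa> \<longleftrightarrow>
    (\<forall>i j. \<gamma> i = X j \<longrightarrow> RW \<gamma>' (\<theta> i) (a j)) \<and>
    (\<forall>i j. \<gamma> i = C j \<longrightarrow> (\<exists>h. \<gamma>' h = C (fst (\<kappa> j)) \<and> RK \<gamma>' h (\<theta> i) (snd (\<kappa> j))))"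

lemma goodD: "good \<gamma> \<gamma>' \<theta> a \<kappa> \<Longrightarrow> \<gamma> i = C j \<Longrightarrow> \<exists>h. \<gamma>' h = C (fst (\<kappa> j)) \<and> RK \<gamma>' h (\<theta> i) (snd (\<kappa> j))"
  by (simp add: good_def)

lemma goodX:
  assumes "good \<gamma> \<gamma>' \<theta> a \<kappa>"
  shows "good (extX \<gamma>) (extX \<gamma>') (ups \<theta>) (ax a) (kx \<kappa>)"
  unfolding good_def
proof (intro conjI allI impI)
  fix i j assume i: "extX \<gamma> i = X j"
  show "RW (extX \<gamma>') (ups \<theta> i) (ax a j)"
  proof (cases i)
    case 0
    then show ?thesis using i by (auto simp: ax_def intro: W1)
  next
    case (Suc i')
    then obtain j' where "\<gamma> i' = X j'" "j = Suc j'" using i by (auto simp: smap_eq_iff)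
    then show ?thesis using assms Suc R_ren(2)[OF _ match_id(1)]
      by (auto simp: good_def ax_def liftx_0)
  qed
next
  fix i j assume i: "extX \<gamma> i = C j"
  then obtain i' where i': "i = Suc i'" "\<gamma> i' = C j" by (cases i) (auto simp: smap_eq_iff)
  then obtain h where h: "\<gamma>' h = C (fst (\<kappa> j))" "RK \<gamma>' h (\<theta> i') (snd (\<kappa> j))"
    using goodD[OF assms] by blast
  have "RK (extX \<gamma>') (Suc h) (ren Suc (\<theta> i')) (snd (kx \<kappa> j))"
    using R_ren(4)[OF h(2) match_id(1)] by (simp add: kx_def liftx_1[unfolded One_nat_def] cong: map_option_cong)
  then show "\<exists>h. extX \<gamma>' h = C (fst (kx \<kappa> j)) \<and> RK (extX \<gamma>') h (ups \<theta> i) (snd (kx \<kappa> j))"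
    using i' h by (intro exI[of _ "Suc h"]) (auto simp: kx_def)
qed

lemma goodC:
  assumes "good \<gamma> \<gamma>' \<theta> a \<kappa>"
  shows "good (extC \<gamma>) (extC \<gamma>') (ups \<theta>) (\<lambda>i. liftk_t 0 (a i)) (kk \<kappa>)"
  unfolding good_def
proof (intro conjI allI impI)
  fix i j assume i: "extC \<gamma> i = X j"
  then obtain i' where i': "i = Suc i'" "\<gamma> i' = X j" by (cases i) (auto simp: smap_eq_iff)
  then show "RW (extC \<gamma>') (ups \<theta> i) (liftk_t 0 (a j))"
    using assms R_ren(2)[OF _ match_id(2)] by (auto simp: good_def liftk_0)
next
  fix i j assume i: "extC \<gamma> i = C j"
  show "\<exists>h. extC \<gamma>' h = C (fst (kk \<kappa> j)) \<and> RK (extC \<gamma>') h (ups \<theta> i) (snd (kk \<kappa> j))"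
  proof (cases i)
    case 0
    then show ?thesis using i by (intro exI[of _ 0]) (auto simp: kk_def intro: K1)
  next
    case (Suc i')
    then obtain j' where j': "\<gamma> i' = C j'" "j = Suc j'" using i by (auto simp: smap_eq_iff)
    then obtain h where h: "\<gamma>' h = C (fst (\<kappa> j'))" "RK \<gamma>' h (\<theta> i') (snd (\<kappa> j'))"
      using goodD[OF assms] by blast
    have "RK (extC \<gamma>') (Suc h) (ren Suc (\<theta> i')) (snd (kk \<kappa> j))"
      using R_ren(4)[OF h(2) match_id(2)] j' by (simp add: kk_def liftk_0 cong: map_option_cong)
    then show ?thesis using Suc h j' by (intro exI[of _ "Suc h"]) (auto simp: kk_def)
  qed
qed

lemma goodH:
  assumes "good \<gamma> \<gamma>' \<theta> a \<kappa>"
  shows "good (extH \<gamma>) (extH \<gamma>') (ups \<theta>) a \<kappa>"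
  unfolding good_def
proof (intro conjI allI impI)
  fix i j assume i: "extH \<gamma> i = X j"
  then obtain i' where i': "i = Suc i'" "\<gamma> i' = X j" by (cases i) auto
  then have "RW \<gamma>' (\<theta> i') (a j)" using assms by (auto simp: good_def)
  from R_ren(2)[OF this match_id(3)] show "RW (extH \<gamma>') (ups \<theta> i) (a j)"
    using i' by simp
next
  fix i j assume i: "extH \<gamma> i = C j"
  then obtain i' where i': "i = Suc i'" "\<gamma> i' = C j" by (cases i) auto
  then obtain h where h: "\<gamma>' h = C (fst (\<kappa> j))" "RK \<gamma>' h (\<theta> i') (snd (\<kappa> j))"
    using goodD[OF assms] by blast
  have "RK (extH \<gamma>') (Suc h) (ren Suc (\<theta> i')) (snd (\<kappa> j))"
    using R_ren(4)[OF h(2) match_id(3)] by (simp add: option.map_ident_strong)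
  then show "\<exists>h. extH \<gamma>' h = C (fst (\<kappa> j)) \<and> RK (extH \<gamma>') h (ups \<theta> i) (snd (\<kappa> j))"
    using i' h by (intro exI[of _ "Suc h"]) auto
qed

lemma eqv_plug: "eqv_t M N \<Longrightarrow> eqv_t (plug c M) (plug c N)"
  by (cases c) (auto intro: cWhr refl_t)

lemma eqv_plug_Whr: "eqv_t (plug c (Whr L M)) (Whr (plug (liftc c) L) M)"
  using E1_t by (cases c) (auto simp flip: liftx_1 intro: refl_t)

lemma msub_plug: "msub_t a \<kappa> (plug c M) = plug (map_option (msub_t (ax a) (kx \<kappa>)) c) (msub_t a \<kappa> M)"
  by (cases c) auto

text \<open>\<open>good\<close> says nothing about \<open>H\<close> slots, so a separate premise
  gives the continuation that replaces the tail; its read-back \<open>c'\<close> is put around the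
  whole term. The result holds up to congruence because replacing the tail of lambda x.q leads to
  \<open>plug c' (Whr L M)\<close>, which (E1) regroups into a single where with body read from
  q.\<close>

lemma R_sub:
  "RT \<gamma> t M \<Longrightarrow> good \<gamma> \<gamma>' \<theta> a \<kappa> \<Longrightarrow> \<exists>M'. eqv_t (msub_t a \<kappa> M) M' \<and> RT \<gamma>' (psub \<theta> t) M'"
  "RW \<gamma> w V \<Longrightarrow> good \<gamma> \<gamma>' \<theta> a \<kappa> \<Longrightarrow> \<exists>V'. eqv_t (msub_t a \<kappa> V) V' \<and> RW \<gamma>' (psub \<theta> w) V'"
  "RE \<gamma> h q M \<Longrightarrow> good \<gamma> \<gamma>' \<theta> a \<kappa> \<Longrightarrow> RK \<gamma>' h' (\<theta> h) c' \<Longrightarrow>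
    \<exists>M'. eqv_t (plug c' (msub_t a \<kappa> M)) M' \<and> RE \<gamma>' h' (psub \<theta> q) M'"
  "RK \<gamma> h K c \<Longrightarrow> good \<gamma> \<gamma>' \<theta> a \<kappa> \<Longrightarrow> RK \<gamma>' h' (\<theta> h) c' \<Longrightarrow>
    \<exists>c''. (\<forall>M. eqv_t (plug c' (plug (map_option (msub_t (ax a) (kx \<kappa>)) c) M)) (plug c'' M)) \<and>
      RK \<gamma>' h' (psub \<theta> K) c''"
proof (induction arbitrary: \<gamma>' \<theta> a \<kappa> and \<gamma>' \<theta> a \<kappa> and \<gamma>' \<theta> a \<kappa> h' c' and \<gamma>' \<theta> a \<kappa> h' c' rule: R_induct)
  case (T1 \<gamma> h q M j)
  let ?a = "\<lambda>i. liftk_t 0 (a i)"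
  note g = goodC[OF T1.prems]
  obtain h' where h': "extC \<gamma>' h' = C (fst (kk \<kappa> j))" "RK (extC \<gamma>') h' (ups \<theta> h) (snd (kk \<kappa> j))"
    using goodD[OF g T1.hyps(2)] by blast
  obtain M' where M': "eqv_t (plug (snd (kk \<kappa> j)) (msub_t ?a (kk \<kappa>) M)) M'" "RE (extC \<gamma>') h' (psub (ups \<theta>) q) M'"
    using T1.IH[OF g h'(2)] by blast
  have "RT \<gamma>' (LL (psub (ups \<theta>) q)) (Mu (Jmp (fst (kk \<kappa> j)) M'))"
    using M'(2) h'(1) by (rule RT_RW_RE_RK.T1)
  then show ?case using M'(1) by (intro exI[of _ "Mu (Jmp (fst (kk \<kappa> j)) M')"]) (auto intro: cMu cJmp)
next
  case (T2 \<gamma> q M)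
  obtain M' where "eqv_t (plug None (msub_t a \<kappa> M)) M'" "RE (extH \<gamma>') 0 (psub (ups \<theta>) q) M'"
    using T2.IH[OF goodH[OF T2.prems], of 0 None] by (auto intro: K1)
  then show ?case by (auto intro: RT_RW_RE_RK.T2)
next
  case (T3 \<gamma> w V w' V')
  then show ?case by (metis RT_RW_RE_RK.T3 cApp msub_t.simps(3) psub.simps(3))
next
  case (W1 \<gamma> i j)
  then show ?case by (auto simp: good_def intro: refl_t)
next
  case (W2 \<gamma> t M)
  obtain M' where "eqv_t (msub_t (ax a) (kx \<kappa>) M) M'" "RT (extX \<gamma>') (psub (ups \<theta>) t) M'"
    using W2.IH[OF goodX[OF W2.prems]] by blast
  then show ?case by (auto intro: RT_RW_RE_RK.W2 cLam)
next
  case (Q1 \<gamma> h K c w V)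
  obtain c'' where c'': "\<And>M. eqv_t (plug c' (plug (map_option (msub_t (ax a) (kx \<kappa>)) c) M)) (plug c'' M)"
      "RK \<gamma>' h' (psub \<theta> K) c''"
    using Q1.IH(1)[OF Q1.prems] by blast
  obtain V' where V': "eqv_t (msub_t a \<kappa> V) V'" "RW \<gamma>' (psub \<theta> w) V'"
    using Q1.IH(2)[OF Q1.prems(1)] by blast
  have "eqv_t (plug c' (msub_t a \<kappa> (plug c V))) (plug c'' V')"
    unfolding msub_plug using c''(1) eqv_plug[OF V'(1)] by (rule trans_t)
  then show ?case using c''(2) V'(2) by (auto intro: RT_RW_RE_RK.Q1)
next
  case (Q2 \<gamma> t M h K c)
  obtain c'' where c'': "\<And>M. eqv_t (plug c' (plug (map_option (msub_t (ax a) (kx \<kappa>)) c) M)) (plug c'' M)"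
      "RK \<gamma>' h' (psub \<theta> K) c''"
    using Q2.IH(2)[OF Q2.prems] by blast
  obtain M' where M': "eqv_t (msub_t a \<kappa> M) M'" "RT \<gamma>' (psub \<theta> t) M'"
    using Q2.IH(1)[OF Q2.prems(1)] by blast
  have "eqv_t (plug c' (msub_t a \<kappa> (plug c M))) (plug c'' M')"
    unfolding msub_plug using c''(1) eqv_plug[OF M'(1)] by (rule trans_t)
  then show ?case using c''(2) M'(2) by (auto intro: RT_RW_RE_RK.Q2)
next
  case (K1 \<gamma> h)
  then show ?case by (intro exI[of _ c']) (auto intro: refl_t)
next
  case (K2 \<gamma> h q L)
  have "RK (extX \<gamma>') (Suc h') (ups \<theta> (Suc h)) (liftc c')"
    using R_ren(4)[OF K2.prems(2) match_id(1)] by simp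
  then obtain L' where L': "eqv_t (plug (liftc c') (msub_t (ax a) (kx \<kappa>) L)) L'"
      "RE (extX \<gamma>') (Suc h') (psub (ups \<theta>) q) L'"
    using K2.IH[OF goodX[OF K2.prems(1)]] by blast
  have "eqv_t (plug c' (Whr (msub_t (ax a) (kx \<kappa>) L) M)) (Whr L' M)" for M
    by (rule trans_t[OF eqv_plug_Whr cWhr[OF L'(1) refl_t]])
  then show ?case using L'(2) by (intro exI[of _ "Some L'"]) (auto intro: RT_RW_RE_RK.K2)
qed

lemma good_val:
  assumes "RW \<gamma> w V"
  shows "good (extX \<gamma>) \<gamma> (case_nat w LV) (sx 0 V) (\<lambda>k. (k, None))"
  unfolding good_def sx_0
proof (intro conjI allI impI)
  fix i j assume "extX \<gamma> i = X j"
  then show "RW \<gamma> (case_nat w LV i) (case_nat V Var j)"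
    using assms by (cases i) (auto simp: smap_eq_iff intro: W1)
next
  fix i j assume "extX \<gamma> i = C j"
  then show "\<exists>h. \<gamma> h = C (fst (j, None)) \<and> RK \<gamma> h (case_nat w LV i) (snd (j, None))"
    by (cases i) (auto simp: smap_eq_iff intro: K1)
qed

lemma good_hole: "good (extH \<gamma>) \<gamma> (case_nat K LV) Var (\<lambda>k. (k, None))"
  unfolding good_def
proof (intro conjI allI impI)
  fix i j assume "extH \<gamma> i = X j"
  then show "RW \<gamma> (case_nat K LV i) (Var j)"
    by (cases i) (auto intro: W1)
next
  fix i j assume "extH \<gamma> i = C j"
  then show "\<exists>h. \<gamma> h = C (fst (j, None)) \<and> RK \<gamma> h (case_nat K LV i) (snd (j, None))"
    by (cases i) (auto intro: K1)
qed

text \<open>\<open>K\<close> is read with tail 0, the mu-bound variable itself, so a jump [k]Q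
  becomes [k](L where x:=Q) under the same mu.\<close>

lemma good_cont:
  assumes "RK (extC \<gamma>) 0 K (Some L)"
  shows "good (extC \<gamma>) (extC \<gamma>) (case_nat K (\<lambda>i. LV (Suc i))) Var (cx 0 L)"
  unfolding good_def
proof (intro conjI allI impI)
  fix i j assume "extC \<gamma> i = X j"
  then show "RW (extC \<gamma>) (case_nat K (\<lambda>i. LV (Suc i)) i) (Var j)"
    by (cases i) (auto intro: W1)
next
  fix i j assume i: "extC \<gamma> i = C j"
  show "\<exists>h. extC \<gamma> h = C (fst (cx 0 L j)) \<and> RK (extC \<gamma>) h (case_nat K (\<lambda>i. LV (Suc i)) i) (snd (cx 0 L j))"
  proof (cases i)
    case 0
    then show ?thesis using i assms by (intro exI[of _ 0]) (auto simp: cx_def)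
  next
    case (Suc i')
    then show ?thesis using i by (intro exI[of _ i]) (auto simp: cx_def smap_eq_iff intro: K1)
  qed
qed

lemma msub_id [simp]: "msub_t Var (\<lambda>k. (k, None)) M = M" "msub_j Var (\<lambda>k. (k, None)) J = J"
  by (induction M and J) auto

lemma RT_subst_val:
  "RT (extX \<gamma>) t M \<Longrightarrow> RW \<gamma> w V \<Longrightarrow> \<exists>M'. eqv_t (substx_t M 0 V) M' \<and> RT \<gamma> (psub (case_nat w LV) t) M'"
  using R_sub(1)[OF _ good_val] by (simp add: substx_conv_msub)

lemma RE_subst_val:
  "RE (extX \<gamma>) (Suc h) q M \<Longrightarrow> RW \<gamma> w V \<Longrightarrow>
    \<exists>M'. eqv_t (substx_t M 0 V) M' \<and> RE \<gamma> h (psub (case_nat w LV) q) M'"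
  using R_sub(3)[OF _ good_val, of \<gamma> "Suc h" q M w V h None] by (auto simp: substx_conv_msub intro: K1)

lemma RE_subst_hole:
  "RE (extH \<gamma>) 0 q M \<Longrightarrow> RK \<gamma> h K c \<Longrightarrow> \<exists>M'. eqv_t (plug c M) M' \<and> RE \<gamma> h (psub (case_nat K LV) q) M'"
  using R_sub(3)[OF _ good_hole, of \<gamma> 0 q M h K c] by auto

text \<open>In the source, \<open>\<mu>k.J\<close> survives the structural reduction, so \<open>k\<close> takes over the role of the
tail \<open>h\<close> of the substituted continuation.\<close>

lemma RE_subst_cont:
  assumes "RE (extC \<gamma>) h1 q P" "extC \<gamma> h1 = C j" "RK \<gamma> h K (Some L)"
  shows "\<exists>q0 h' j' L'. psub (case_nat K LV) q = ren (case_nat h id) q0 \<and> RE (extC \<gamma>) h' q0 L' \<and>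
    extC \<gamma> h' = C j' \<and> eqv_j (ctx_j (Jmp j P) 0 (liftk_t 0 L)) (Jmp j' L')"
proof -
  obtain K' where K': "RK (extH \<gamma>) 0 K' (Some L)" "K = ren (case_nat h id) K'"
    using R_split(2)[OF assms(3)] by blast
  \<comment> \<open>The hole that replaced the tail of \<open>K\<close> becomes the mu-bound
    variable, and the other continuation variables are shifted past it.\<close>
  have "match (extH \<gamma>) (extC \<gamma>) id id Suc"
    by (auto simp: match_def extH_def extC_def split: nat.split)
  from R_ren(4)[OF K'(1) this] have "RK (extC \<gamma>) 0 K' (Some (liftk_t 0 L))"
    by (simp add: liftk_0)
  note g = good_cont[OF this]
  let ?\<theta> = "case_nat K' (\<lambda>i. LV (Suc i))" and ?\<kappa> = "cx 0 (liftk_t 0 L)"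
  obtain h' where h': "extC \<gamma> h' = C (fst (?\<kappa> j))" "RK (extC \<gamma>) h' (?\<theta> h1) (snd (?\<kappa> j))"
    using g assms(2) unfolding good_def by blast
  obtain L' where L': "eqv_t (plug (snd (?\<kappa> j)) (msub_t Var ?\<kappa> P)) L'" "RE (extC \<gamma>) h' (psub ?\<theta> q) L'"
    using R_sub(3)[OF assms(1) g h'(2)] by blast
  have "psub (case_nat K LV) q = ren (case_nat h id) (psub ?\<theta> q)"
    unfolding ren_psub K'(2) by (rule psub_cong) (auto split: nat.split)
  moreover have "eqv_j (ctx_j (Jmp j P) 0 (liftk_t 0 L)) (Jmp (fst (?\<kappa> j)) L')"
    using L'(1) unfolding ctx_conv_msub by (auto intro: cJmp)
  ultimately show ?thesis using L'(2) h'(1) by blast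
qed

section \<open>Reduction modulo the congruence\<close>

definition sred :: "trm \<Rightarrow> trm \<Rightarrow> bool" where
  "sred = (\<lambda>M N. step_t M N \<or> eqv_t M N)\<^sup>*\<^sup>*"

lemma sred_refl [simp, intro]: "sred M M"
  by (simp add: sred_def)

lemma sred_step: "step_t M N \<Longrightarrow> sred M N"
  by (auto simp: sred_def)

lemma sred_eqv: "eqv_t M N \<Longrightarrow> sred M N"
  by (auto simp: sred_def)

lemma sred_trans [trans]: "sred M N \<Longrightarrow> sred N P \<Longrightarrow> sred M P"
  by (auto simp: sred_def)

lemma sred_map:
  assumes "sred M N"
    and "\<And>M N. step_t M N \<Longrightarrow> step_t (f M) (f N)" and "\<And>M N. eqv_t M N \<Longrightarrow> eqv_t (f M) (f N)"
  shows "sred (f M) (f N)"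
  using assms(1) unfolding sred_def
  by (induction rule: rtranclp_induct) (auto intro: rtranclp.rtrancl_into_rtrancl assms(2,3))

lemma sred_Lam: "sred M N \<Longrightarrow> sred (Lam M) (Lam N)"
  by (erule sred_map) (auto intro: s_Lam cLam)

lemma sred_App: "sred M M' \<Longrightarrow> sred N N' \<Longrightarrow> sred (App M N) (App M' N')"
proof -
  assume "sred M M'"
  then have "sred (App M N) (App M' N)" by (rule sred_map[where f = "\<lambda>M. App M N"]) (auto intro: s_App1 cApp refl_t)
  moreover assume "sred N N'"
  then have "sred (App M' N) (App M' N')" by (rule sred_map) (auto intro: s_App2 cApp refl_t)
  ultimately show ?thesis by (rule sred_trans)
qed

lemma sred_Whr: "sred M M' \<Longrightarrow> sred N N' \<Longrightarrow> sred (Whr M N) (Whr M' N')"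
proof -
  assume "sred M M'"
  then have "sred (Whr M N) (Whr M' N)" by (rule sred_map[where f = "\<lambda>M. Whr M N"]) (auto intro: s_Whr1 cWhr refl_t)
  moreover assume "sred N N'"
  then have "sred (Whr M' N) (Whr M' N')" by (rule sred_map) (auto intro: s_Whr2 cWhr refl_t)
  ultimately show ?thesis by (rule sred_trans)
qed

lemma sred_MuJmp: "sred M N \<Longrightarrow> sred (Mu (Jmp j M)) (Mu (Jmp j N))"
  by (rule sred_map[where f = "\<lambda>M. Mu (Jmp j M)"]) (auto intro: s_Mu s_Jmp cMu cJmp)

lemma sred_plug: "sred M N \<Longrightarrow> sred (plug c M) (plug c N)"
  by (cases c) (auto intro: sred_Whr)

text \<open>Each \<open>red\<close> contains a genuine step, so a chain made only of congruence
  moves need not be a \<open>red\<close> chain and is listed separately.\<close>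

lemma sred_imp_red: "sred M N \<Longrightarrow> eqv_t M N \<or> red\<^sup>*\<^sup>* M N"
  unfolding sred_def
proof (induction rule: rtranclp_induct)
  case base
  then show ?case by (auto intro: refl_t)
next
  case (step N P)
  have *: "red M' P" if "red M' N'" "eqv_t N' P" for M' N'
    using that unfolding red_def by (blast intro: trans_t)
  show ?case
  proof (cases "eqv_t N P")
    case True
    show ?thesis
    proof (cases "red\<^sup>*\<^sup>* M N")
      case red: True
      then show ?thesis
      proof (cases rule: rtranclp.cases)
        case rtrancl_refl
        then show ?thesis using True by simp
      next
        case (rtrancl_into_rtrancl N0)
        then show ?thesis using * True by (meson rtranclp.rtrancl_into_rtrancl)
      qed
    next
      case False
      then show ?thesis using step True by (blast intro: trans_t)
    qed
  next
    case False
    then have "step_t N P" using step by blast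
    then show ?thesis using step.IH
      by (metis (no_types, lifting) red_def refl_t rtranclp.rtrancl_into_rtrancl rtranclp.rtrancl_refl)
  qed
qed

lemma sred_nf_normalizable:
  assumes "sred M N" "nf_t N"
  shows "normalizable M"
proof -
  consider "eqv_t M N" | "red\<^sup>*\<^sup>* M N" using sred_imp_red[OF assms(1)] by blast
  then show ?thesis
  proof cases
    case 1
    then have "nf_t M" using assms(2) eqv_invariants(1) by blast
    then show ?thesis unfolding normalizable_def normal_src_iff_nf by blast
  next
    case 2
    then show ?thesis using assms(2) unfolding normalizable_def normal_src_iff_nf by blast
  qed
qed

section \<open>A source term reduces to a read-back of its translation\<close>

text \<open>\<open>a\<close> and \<open>b\<close> absorb the shifts that source variables undergo
  below the wheres created while reducing towards the read-back.\<close>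

definition compat where
  "compat \<gamma> r s a b \<longleftrightarrow> (\<forall>i. \<gamma> (r i) = X (a i)) \<and> (\<forall>k. \<gamma> (s k) = C (b k))"

lemma compat_shift: "compat \<gamma> r s a b \<Longrightarrow> compat (extX \<gamma>) (Suc \<circ> r) (Suc \<circ> s) (\<lambda>i. Suc (a i)) b"
  by (auto simp: compat_def)

lemma compat_extX: "compat \<gamma> r s a b \<Longrightarrow> compat (extX \<gamma>) (ext0 r) (Suc \<circ> s) (up a) b"
  by (auto simp: compat_def ext0_def up_def split: nat.split)

lemma compat_extC: "compat \<gamma> r s a b \<Longrightarrow> compat (extC \<gamma>) (Suc \<circ> r) (ext0 s) a (up b)"
  by (auto simp: compat_def ext0_def up_def split: nat.split)

text \<open>The k of lambda x k gets slot \<open>H\<close>, so that \<open>T2\<close> reads the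
  translated body directly as a body of the source lambda, without a mu.\<close>

lemma compat_Lam:
  "compat \<gamma> r s a b \<Longrightarrow> compat (extH (extX \<gamma>)) (\<lambda>i. case i of 0 \<Rightarrow> 1 | Suc j \<Rightarrow> r j + 2) (\<lambda>i. s i + 2) (up a) b"
  by (auto simp: compat_def up_def split: nat.split)

lemma RK_liftX: "RK \<gamma> h K c \<Longrightarrow> RK (extX \<gamma>) (Suc h) (ren Suc K) (liftc c)"
  using R_ren(4)[OF _ match_id(1)] by blast

lemma ren_shift: "ren_t (\<lambda>i. Suc (a i)) b M = liftx_t 0 (ren_t a b M)"
  by (simp add: liftx_0 ren_ren_t)

lemma sred_plug_Whr: "sred (plug c (Whr L M)) (Whr (plug (liftc c) L) M)"
  by (rule sred_eqv[OF eqv_plug_Whr])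

text \<open>The let-rules name each non-value part of an application in the evaluation order of the
  translation. Then (E1) moves the surrounding context \<open>c\<close>, the read-back of
  \<open>K\<close>, into the body of the new where, just as the translation places \<open>K\<close>
  inside lambda x.Q. A jump enters as \<open>body_j J\<close> because its tail is the image of
  \<open>hd_j J\<close>.\<close>

lemma RE_cps:
  "compat \<gamma> r s a b \<Longrightarrow> RK \<gamma> h K c \<Longrightarrow> \<exists>M'. sred (plug c (ren_t a b M)) M' \<and> RE \<gamma> h (cps M r s K) M'"
  "isval V \<Longrightarrow> compat \<gamma> r s a b \<Longrightarrow> \<exists>V'. sred (ren_t a b V) V' \<and> RW \<gamma> (vstar V r s) V'"
  "compat \<gamma> r s a b \<Longrightarrow> \<exists>h M'. \<gamma> h = C (b (hd_j J)) \<and> sred (ren_t a b (body_j J)) M' \<and> RE \<gamma> h (cpsj J r s) M'"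
proof (induction M r s K and V r s and J r s arbitrary: \<gamma> a b h c and \<gamma> a b and \<gamma> a b rule: cps_vstar_cpsj.induct)
  have Lam: "\<exists>V'. sred (ren_t a b (Lam M)) V' \<and>
      RW \<gamma> (LL (LL (cps M (\<lambda>i. case i of 0 \<Rightarrow> 1 | Suc j \<Rightarrow> r j + 2) (\<lambda>i. s i + 2) (LV 0)))) V'"
    if IH: "\<And>\<gamma> a b h c. compat \<gamma> (\<lambda>i. case i of 0 \<Rightarrow> 1 | Suc j \<Rightarrow> r j + 2) (\<lambda>i. s i + 2) a b \<Longrightarrow> RK \<gamma> h (LV 0) c \<Longrightarrow>
        \<exists>M'. sred (plug c (ren_t a b M)) M' \<and>
          RE \<gamma> h (cps M (\<lambda>i. case i of 0 \<Rightarrow> 1 | Suc j \<Rightarrow> r j + 2) (\<lambda>i. s i + 2) (LV 0)) M'"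
      and cm: "compat \<gamma> r s a b" for M r s \<gamma> a b
  proof -
    obtain M' where "sred (plug None (ren_t (up a) b M)) M'"
      "RE (extH (extX \<gamma>)) 0 (cps M (\<lambda>i. case i of 0 \<Rightarrow> 1 | Suc j \<Rightarrow> r j + 2) (\<lambda>i. s i + 2) (LV 0)) M'"
      using IH[OF compat_Lam[OF cm] K1] by blast
    then show ?thesis by (intro exI[of _ "Lam M'"]) (auto intro: sred_Lam W2 T2)
  qed
  {
    case (1 i r s)
    then show ?case by (auto simp: compat_def intro: W1)
  next
    case (2 M r s)
    then show ?case using Lam[of r s M \<gamma> a b] by simp
  next
    case (6 i r s K)
    then have "RE \<gamma> h (LA K (LV (r i))) (plug c (Var (a i)))"
      by (intro Q1 W1) (auto simp: compat_def)
    then show ?case by auto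
  next
    case (7 M r s K)
    then obtain V' where "sred (ren_t a b (Lam M)) V'"
        "RW \<gamma> (LL (LL (cps M (\<lambda>i. case i of 0 \<Rightarrow> 1 | Suc j \<Rightarrow> r j + 2) (\<lambda>i. s i + 2) (LV 0)))) V'"
      using Lam[of r s M \<gamma> a b] by blast
    then show ?case using 7 unfolding cps.simps by (blast intro: sred_plug Q1)
  next
    case (8 M N r s K)
    note sh = compat_shift[OF "8.prems"(1)]
    let ?M = "ren_t a b M" and ?N = "ren_t a b N"
    consider "isval M" "isval N" | "isval M" "\<not> isval N" | "\<not> isval M" "isval N" | "\<not> isval M" "\<not> isval N"
      by blast
    then show ?case
    proof cases
      case 1
      then obtain V W where "sred ?M V" "RW \<gamma> (vstar M r s) V" "sred ?N W" "RW \<gamma> (vstar N r s) W"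
        using "8.IH"(1)[of \<gamma> a b] "8.IH"(2)[of \<gamma> a b] "8.prems"(1) by auto
      then show ?thesis using 1 "8.prems"(2)
        by (intro exI[of _ "plug c (App V W)"]) (auto intro!: sred_plug sred_App Q2 T3)
    next
      case 2
      obtain V where V: "sred (liftx_t 0 ?M) V" "RW (extX \<gamma>) (vstar M (Suc \<circ> r) (Suc \<circ> s)) V"
        using "8.IH"(3)[OF _ _ _ sh] 2 by (auto simp: ren_shift comp_def)
      let ?L = "plug (liftc c) (App V (Var 0))"
      let ?K = "LL (LA (LA (vstar M (Suc \<circ> r) (Suc \<circ> s)) (LV 0)) (ren Suc K))"
      have K: "RK \<gamma> h ?K (Some ?L)"
        by (intro K2 Q2 T3 V W1 RK_liftX "8.prems"(2)) simp
      then obtain M' where M': "sred (Whr ?L ?N) M'" "RE \<gamma> h (cps N r s ?K) M'"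
        using "8.IH"(4)[OF _ _ "8.prems"(1), of h "Some ?L"] 2 by auto
      have "sred (plug c (App ?M ?N)) (plug c (Whr (App (liftx_t 0 ?M) (Var 0)) ?N))"
        using 2 by (intro sred_plug sred_step r_appV) auto
      also have "sred \<dots> (plug c (Whr (App V (Var 0)) ?N))"
        by (intro sred_plug sred_Whr sred_App V sred_refl)
      also have "sred \<dots> (Whr ?L ?N)" by (rule sred_plug_Whr)
      also have "sred \<dots> M'" by (rule M')
      finally show ?thesis using 2 M'(2) by auto
    next
      case 3
      obtain V where V: "sred (liftx_t 0 ?N) V" "RW (extX \<gamma>) (vstar N (Suc \<circ> r) (Suc \<circ> s)) V"
        using "8.IH"(5)[OF _ _ _ _ sh] 3 by (auto simp: ren_shift comp_def)
      let ?L = "plug (liftc c) (App (Var 0) V)"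
      let ?K = "LL (LA (LA (LV 0) (vstar N (Suc \<circ> r) (Suc \<circ> s))) (ren Suc K))"
      have K: "RK \<gamma> h ?K (Some ?L)"
        by (intro K2 Q2 T3 V W1 RK_liftX "8.prems"(2)) simp
      then obtain M' where M': "sred (Whr ?L ?M) M'" "RE \<gamma> h (cps M r s ?K) M'"
        using "8.IH"(6)[OF _ _ _ "8.prems"(1), of h "Some ?L"] 3 by auto
      have "sred (plug c (App ?M ?N)) (plug c (Whr (App (Var 0) (liftx_t 0 ?N)) ?M))"
        using 3 by (intro sred_plug sred_step r_appN) auto
      also have "sred \<dots> (plug c (Whr (App (Var 0) V) ?M))"
        by (intro sred_plug sred_Whr sred_App V sred_refl)
      also have "sred \<dots> (Whr ?L ?M)" by (rule sred_plug_Whr)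
      also have "sred \<dots> M'" by (rule M')
      finally show ?thesis using 3 M'(2) by auto
    next
      case 4
      let ?K2 = "LL (LA (LA (LV 1) (LV 0)) (ren Suc (ren Suc K)))"
      let ?L2 = "plug (liftc (liftc c)) (App (Var 1) (Var 0))"
      let ?K = "LL (cps N (Suc \<circ> r) (Suc \<circ> s) ?K2)"
      have "RK (extX \<gamma>) (Suc h) ?K2 (Some ?L2)"
        by (intro K2 Q2 T3 W1 RK_liftX "8.prems"(2)) simp_all
      then obtain L' where L': "sred (Whr ?L2 (liftx_t 0 ?N)) L'"
          "RE (extX \<gamma>) (Suc h) (cps N (Suc \<circ> r) (Suc \<circ> s) ?K2) L'"
        using "8.IH"(7)[OF _ _ _ sh, of "Suc h" "Some ?L2"] 4 by (auto simp: ren_shift comp_def)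
      then obtain M' where M': "sred (Whr L' ?M) M'" "RE \<gamma> h (cps M r s ?K) M'"
        using "8.IH"(8)[OF _ _ _ "8.prems"(1), of h "Some L'"] 4 K2 by auto
      have "sred (plug c (App ?M ?N)) (plug c (Whr (App (Var 0) (liftx_t 0 ?N)) ?M))"
        using 4 by (intro sred_plug sred_step r_appN) auto
      \<comment> \<open>The function part is now the value \<open>Var 0\<close>, so the argument is
        named by the rule for values; its where is nested inside that of the function part.\<close>
      also have "sred \<dots> (plug c (Whr (Whr (App (Var 1) (Var 0)) (liftx_t 0 ?N)) ?M))"
        using 4 r_appV[of "Var 0" "liftx_t 0 ?N"]
        by (intro sred_plug sred_Whr sred_refl sred_step) (simp add: liftx_0)
      also have "sred \<dots> (Whr (plug (liftc c) (Whr (App (Var 1) (Var 0)) (liftx_t 0 ?N))) ?M)"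
        by (rule sred_plug_Whr)
      also have "sred \<dots> (Whr (Whr ?L2 (liftx_t 0 ?N)) ?M)"
        by (intro sred_Whr sred_plug_Whr sred_refl)
      also have "sred \<dots> (Whr L' ?M)" by (intro sred_Whr L' sred_refl)
      also have "sred \<dots> M'" by (rule M')
      finally show ?thesis using 4 M'(2) by auto
    qed
  next
    case (9 L M r s K)
    obtain L' where L': "sred (plug (liftc c) (ren_t (up a) b L)) L'"
      "RE (extX \<gamma>) (Suc h) (cps L (ext0 r) (Suc \<circ> s) (ren Suc K)) L'"
      using 9(1)[OF compat_extX[OF 9(3)], of "Suc h" "liftc c"] RK_liftX[OF 9(4)] by (auto simp: comp_def)
    obtain M' where M': "sred (Whr L' (ren_t a b M)) M'"
      "RE \<gamma> h (cps M r s (LL (cps L (ext0 r) (Suc \<circ> s) (ren Suc K)))) M'"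
      using 9(2)[OF 9(3), of h "Some L'"] K2[OF L'(2)] by (auto simp: comp_def)
    have "sred (plug c (Whr (ren_t (up a) b L) (ren_t a b M))) (Whr (plug (liftc c) (ren_t (up a) b L)) (ren_t a b M))"
      by (rule sred_plug_Whr)
    also have "sred \<dots> (Whr L' (ren_t a b M))" by (intro sred_Whr L' sred_refl)
    also have "sred \<dots> M'" by (rule M')
    finally show ?case using M'(2) by auto
  next
    case (10 J r s K)
    obtain h' M' where M': "extC \<gamma> h' = C (up b (hd_j J))" "sred (ren_t a (up b) (body_j J)) M'"
      "RE (extC \<gamma>) h' (cpsj J (Suc \<circ> r) (ext0 s)) M'"
      using 10(1)[OF compat_extC[OF 10(2)]] by blast
    have "sred (Mu (ren_j a (up b) J)) (Mu (Jmp (up b (hd_j J)) (ren_t a (up b) (body_j J))))"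
      using eqv_jmp_body[of "ren_j a (up b) J"] by (intro sred_eqv cMu) simp
    also have "sred \<dots> (Mu (Jmp (up b (hd_j J)) M'))" by (intro sred_MuJmp M')
    finally show ?case using M' 10(3)
      by (intro exI[of _ "plug c (Mu (Jmp (up b (hd_j J)) M'))"]) (auto intro!: sred_plug Q2 T1)
  next
    case (11 k M r s)
    then show ?case
      using 11(1)[OF 11(2) K1] by (auto simp: compat_def)
  next
    case (12 J M r s)
    obtain h M' where M': "extX \<gamma> h = C (b (hd_j J))" "sred (ren_t (up a) b (body_j J)) M'"
      "RE (extX \<gamma>) h (cpsj J (ext0 r) (Suc \<circ> s)) M'"
      using 12(1)[OF compat_extX[OF 12(3)]] by blast
    then obtain h' where h': "h = Suc h'" "\<gamma> h' = C (b (hd_j J))"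
      by (cases h) (auto simp: smap_eq_iff)
    obtain N' where "sred (Whr M' (ren_t a b M)) N'"
      "RE \<gamma> h' (cps M r s (LL (cpsj J (ext0 r) (Suc \<circ> s)))) N'"
      using 12(2)[OF 12(3), of h' "Some M'"] K2 M' h' by (auto simp: comp_def)
    moreover have "sred (Whr (ren_t (up a) b (body_j J)) (ren_t a b M)) (Whr M' (ren_t a b M))"
      by (intro sred_Whr M' sred_refl)
    ultimately show ?case using h' by (auto intro: sred_trans)
  }
qed auto

section \<open>Target reductions are simulated by source reductions\<close>

lemma beta_eta_LL:
  "beta_eta (LL t) u \<Longrightarrow> (\<exists>t'. beta_eta t t' \<and> u = LL t') \<or> t = LA (ren Suc u) (LV 0)"
  by (erule beta_eta.cases) auto

lemma beta_eta_LA: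
  "beta_eta (LA s t) u \<Longrightarrow> (\<exists>r. s = LL r \<and> u = psub (case_nat t LV) r) \<or>
    (\<exists>s'. beta_eta s s' \<and> u = LA s' t) \<or> (\<exists>t'. beta_eta t t' \<and> u = LA s t')"
  by (erule beta_eta.cases) (auto simp: subst_0)

lemma beta_eta_LV [simp]: "\<not> beta_eta (LV i) u"
  by (auto elim: beta_eta.cases)

text \<open>Contracting \<open>[h]\<mu>k.J\<close> can change the tail of a command. The second alternative records
this, with \<open>k\<close> not yet identified with \<open>h\<close>, so that it makes sense also if \<open>h\<close> has no source
counterpart.\<close>

definition simE where
  "simE \<gamma> h q M \<longleftrightarrow> (\<exists>M'. sred M M' \<and> RE \<gamma> h q M') \<or>
    (\<exists>q0 h' j L. q = ren (case_nat h id) q0 \<and> RE (extC \<gamma>) h' q0 L \<and> extC \<gamma> h' = C j \<and> sred M (Mu (Jmp j L)))"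

text \<open>The same dichotomy for contexts. The plugged term is lifted since it comes to stand
  below the new mu.\<close>

definition simK where
  "simK \<gamma> h K c \<longleftrightarrow> (\<exists>c'. (\<forall>M. sred (plug c M) (plug c' M)) \<and> RK \<gamma> h K c') \<or>
    (\<exists>K0 h' j c0. K = ren (case_nat h id) K0 \<and> RK (extC \<gamma>) h' K0 c0 \<and> extC \<gamma> h' = C j \<and>
      (\<forall>M. sred (plug c M) (Mu (Jmp j (plug c0 (liftk_t 0 M))))))"

lemma simE_refl: "sred M M' \<Longrightarrow> RE \<gamma> h q M' \<Longrightarrow> simE \<gamma> h q M"
  unfolding simE_def by blast

lemma simE_tail:
  "q = ren (case_nat h id) q0 \<Longrightarrow> RE (extC \<gamma>) h' q0 L \<Longrightarrow> extC \<gamma> h' = C j \<Longrightarrow> sred M (Mu (Jmp j L)) \<Longrightarrow>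
    simE \<gamma> h q M"
  unfolding simE_def by blast

lemma simE_of_simK_W:
  assumes "simK \<gamma> h K c" "RW \<gamma> w V"
  shows "simE \<gamma> h (LA K w) (plug c V)"
  using assms(1) unfolding simK_def
proof (elim disjE exE conjE)
  fix c' assume "\<forall>M. sred (plug c M) (plug c' M)" "RK \<gamma> h K c'"
  then show ?thesis using assms(2) by (blast intro: simE_refl Q1)
next
  fix K0 h' j c0
  assume *: "K = ren (case_nat h id) K0" "RK (extC \<gamma>) h' K0 c0" "extC \<gamma> h' = C j"
    "\<forall>M. sred (plug c M) (Mu (Jmp j (plug c0 (liftk_t 0 M))))"
  have "RW (extC \<gamma>) (ren Suc w) (liftk_t 0 V)"
    using R_ren(2)[OF assms(2) match_id(2)] by (simp add: liftk_0)
  then have "RE (extC \<gamma>) h' (LA K0 (ren Suc w)) (plug c0 (liftk_t 0 V))" using *(2) by (intro Q1)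
  moreover have "LA K w = ren (case_nat h id) (LA K0 (ren Suc w))" using *(1) by (simp add: ren_ren)
  ultimately show ?thesis using *(3,4) unfolding simE_def by blast
qed

lemma simE_of_simK_T:
  assumes "simK \<gamma> h K c" "RT \<gamma> t M"
  shows "simE \<gamma> h (LA t K) (plug c M)"
  using assms(1) unfolding simK_def
proof (elim disjE exE conjE)
  fix c' assume "\<forall>M. sred (plug c M) (plug c' M)" "RK \<gamma> h K c'"
  then show ?thesis using assms(2) by (blast intro: simE_refl Q2)
next
  fix K0 h' j c0
  assume *: "K = ren (case_nat h id) K0" "RK (extC \<gamma>) h' K0 c0" "extC \<gamma> h' = C j"
    "\<forall>M. sred (plug c M) (Mu (Jmp j (plug c0 (liftk_t 0 M))))"
  have "RT (extC \<gamma>) (ren Suc t) (liftk_t 0 M)"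
    using R_ren(1)[OF assms(2) match_id(2)] by (simp add: liftk_0)
  then have "RE (extC \<gamma>) h' (LA (ren Suc t) K0) (plug c0 (liftk_t 0 M))" using *(2) by (intro Q2)
  moreover have "LA t K = ren (case_nat h id) (LA (ren Suc t) K0)" using *(1) by (simp add: ren_ren)
  ultimately show ?thesis using *(3,4) unfolding simE_def by blast
qed

text \<open>If \<open>L\<close> reduces to a mu, (E2) moves that mu out of the where and (E3)
  restores the form [j](L' where x:=M).\<close>

lemma simK_of_simE:
  assumes "simE (extX \<gamma>) (Suc h) q L"
  shows "simK \<gamma> h (LL q) (Some L)"
  using assms unfolding simE_def
proof (elim disjE exE conjE)
  fix L' assume "sred L L'" "RE (extX \<gamma>) (Suc h) q L'"
  then have "\<forall>M. sred (plug (Some L) M) (plug (Some L') M)" "RK \<gamma> h (LL q) (Some L')"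
    by (auto intro: sred_Whr K2)
  then show ?thesis unfolding simK_def by blast
next
  fix q0 h' j L'
  assume *: "q = ren (case_nat (Suc h) id) q0" "RE (extC (extX \<gamma>)) h' q0 L'"
    "extC (extX \<gamma>) h' = C j" "sred L (Mu (Jmp j L'))"
  have E: "RE (extX (extC \<gamma>)) (swap h') (ren swap q0) L'"
    using R_ren(3)[OF *(2) match_swap(2)] by simp
  have "extX (extC \<gamma>) (swap h') = C j"
    using matchD(2)[OF match_swap(2) *(3)] by simp
  then obtain h'' where h'': "swap h' = Suc h''" "extC \<gamma> h'' = C j"
    by (cases "swap h'") (auto simp: smap_eq_iff)
  have "RK (extC \<gamma>) h'' (LL (ren swap q0)) (Some L')" using E h''(1) by (auto intro: K2)
  moreover have "LL q = ren (case_nat h id) (LL (ren swap q0))" using *(1) by (simp add: ren_case_swap)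
  moreover have "sred (Whr L M) (Mu (Jmp j (Whr L' (liftk_t 0 M))))" for M
  proof -
    have "sred (Whr L M) (Whr (Mu (Jmp j L')) M)" by (intro sred_Whr *(4) sred_refl)
    also have "sred \<dots> (Mu (JWhr (Jmp j L') (liftk_t 0 M)))" by (intro sred_eqv E2)
    also have "sred \<dots> (Mu (Jmp j (Whr L' (liftk_t 0 M))))" by (intro sred_eqv cMu sym_j[OF E3])
    finally show ?thesis .
  qed
  ultimately show ?thesis using h''(2) unfolding simK_def by fastforce
qed

lemma RE_beta_val:
  assumes "RK \<gamma> h (LL q) c" "RW \<gamma> w V"
  shows "simE \<gamma> h (psub (case_nat w LV) q) (plug c V)"
proof -
  obtain L where L: "c = Some L" "RE (extX \<gamma>) (Suc h) q L" using assms(1) by (auto elim: RK_LL)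
  then obtain M' where "eqv_t (substx_t L 0 V) M'" "RE \<gamma> h (psub (case_nat w LV) q) M'"
    using RE_subst_val assms(2) by blast
  moreover have "sred (Whr L V) (substx_t L 0 V)"
    using RW_isval[OF assms(2)] by (intro sred_step r_whrV)
  ultimately show ?thesis using L(1) by (auto intro: simE_refl sred_trans sred_eqv)
qed

text \<open>Under \<open>T2\<close> the redex is administrative and costs only congruence. Under
  \<open>T1\<close> with \<open>K\<close> a variable no source step is taken; the identification of
  k with \<open>h\<close> stays pending in the second form of \<open>simE\<close>. Under
  \<open>T1\<close> with \<open>K\<close> an abstraction it is structural reduction.\<close>

lemma RE_beta_cont:
  assumes "RT \<gamma> (LL q) M" "RK \<gamma> h K c"
  shows "simE \<gamma> h (psub (case_nat K LV) q) (plug c M)"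
proof -
  consider (1) h1 P j where "M = Mu (Jmp j P)" "RE (extC \<gamma>) h1 q P" "extC \<gamma> h1 = C j"
    | (2) "RE (extH \<gamma>) 0 q M"
    using assms(1) by (auto elim: RT_LL)
  then show ?thesis
  proof cases
    case 2
    then show ?thesis using RE_subst_hole[OF _ assms(2)] by (blast intro: simE_refl sred_eqv)
  next
    case (1 h1 P j)
    show ?thesis
    proof (cases c)
      case None
      then have "K = LV h" using assms(2) by (auto elim: RK.cases)
      then have "psub (case_nat K LV) q = ren (case_nat h id) q"
        unfolding ren_conv_psub by (intro psub_cong) (auto split: nat.split)
      then show ?thesis using 1 None by (auto intro: simE_tail)
    next
      case (Some L)
      obtain q0 h' j' L' where *: "psub (case_nat K LV) q = ren (case_nat h id) q0" "RE (extC \<gamma>) h' q0 L'"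
        "extC \<gamma> h' = C j'" "eqv_j (ctx_j (Jmp j P) 0 (liftk_t 0 L)) (Jmp j' L')"
        using RE_subst_cont 1 assms(2) Some by blast
      have "sred (Whr L (Mu (Jmp j P))) (Mu (ctx_j (Jmp j P) 0 (liftk_t 0 L)))"
        by (intro sred_step r_whrMu)
      also have "sred \<dots> (Mu (Jmp j' L'))" by (intro sred_eqv cMu *(4))
      finally show ?thesis using * 1 Some by (auto intro: simE_tail)
    qed
  qed
qed

lemma simulation:
  "RT \<gamma> t M \<Longrightarrow> beta_eta t t' \<Longrightarrow> \<exists>M'. sred M M' \<and> RT \<gamma> t' M'"
  "RW \<gamma> w V \<Longrightarrow> beta_eta w w' \<Longrightarrow> \<exists>V'. sred V V' \<and> RW \<gamma> w' V'"
  "RE \<gamma> h q M \<Longrightarrow> beta_eta q q' \<Longrightarrow> simE \<gamma> h q' M"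
  "RK \<gamma> h K c \<Longrightarrow> beta_eta K K' \<Longrightarrow> simK \<gamma> h K' c"
proof (induction arbitrary: t' and w' and q' and K' rule: R_induct)
  case (T1 \<gamma> h q M j)
  from beta_eta_LL[OF T1.prems] show ?case
  proof (elim disjE exE conjE)
    fix q' assume q': "beta_eta q q'" "t' = LL q'"
    from T1.IH[OF q'(1)] show ?thesis unfolding simE_def
    proof (elim disjE exE conjE)
      fix M' assume "sred M M'" "RE (extC \<gamma>) h q' M'"
      then show ?thesis using T1.hyps(2) q'(2) by (blast intro: sred_MuJmp RT_RW_RE_RK.T1)
    next
      \<comment> \<open>The pending mu now stands below a jump to the known \<open>j\<close>, so
        [j]mu.[j']L can be contracted. Accordingly the pending index 0 is merged with
        \<open>h\<close> in the target and with \<open>j\<close> in the source.\<close>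
      fix q0 h' j' L
      assume *: "q' = ren (case_nat h id) q0" "RE (extC (extC \<gamma>)) h' q0 L"
        "extC (extC \<gamma>) h' = C j'" "sred M (Mu (Jmp j' L))"
      have m: "match (extC (extC \<gamma>)) (extC \<gamma>) (case_nat h id) id (merge 0 j)"
        unfolding match_def
      proof
        fix i show "extC (extC \<gamma>) i = H \<or> extC \<gamma> (case_nat h id i) = smap id (merge 0 j) (extC (extC \<gamma>) i)"
        proof (cases i)
          case (Suc i')
          then show ?thesis by (cases "extC \<gamma> i'") (auto simp: merge_def)
        qed (use T1.hyps(2) in \<open>auto simp: merge_def\<close>)
      qed
      have "RT \<gamma> t' (Mu (Jmp (merge 0 j j') (ren_t id (merge 0 j) L)))"
        using R_ren(3)[OF *(2) m] matchD(2)[OF m *(3)] *(1) q'(2) by (auto intro: RT_RW_RE_RK.T1)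
      moreover have "sred (Mu (Jmp j M)) (Mu (Jmp (merge 0 j j') (ren_t id (merge 0 j) L)))"
      proof -
        have "sred (Mu (Jmp j M)) (Mu (Jmp j (Mu (Jmp j' L))))" by (intro sred_MuJmp *(4))
        also have "sred \<dots> (Mu (renk_j (Jmp j' L) 0 j))" by (intro sred_step s_Mu r_jmpMu)
        finally show ?thesis by (simp add: renk_conv_ren)
      qed
      ultimately show ?thesis by blast
    qed
  next
    assume q: "q = LA (ren Suc t') (LV 0)"
    from T1.hyps(1)[unfolded q] obtain c M1 where
      M1: "M = plug c M1" "RT (extC \<gamma>) (ren Suc t') M1" "RK (extC \<gamma>) h (LV 0) c"
      by (auto elim!: RE_LA elim: RW_LV)
    then have c: "c = None" "h = 0" by (auto elim: RK_LV)
    obtain M' where M': "M1 = ren_t id Suc M'" "RT \<gamma> t' M'"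
      using R_unren(1)[OF M1(2) refl pull_Suc(2)] by blast
    have "j = 0" using T1.hyps(2) c by simp
    then have "sred (Mu (Jmp j M)) M'"
      using M1(1) M'(1) c r_muJmp[of M'] by (auto simp: liftk_0 intro: sred_step)
    then show ?thesis using M'(2) by blast
  qed
next
  case (T2 \<gamma> q M)
  from beta_eta_LL[OF T2.prems] show ?case
  proof (elim disjE exE conjE)
    fix q' assume q': "beta_eta q q'" "t' = LL q'"
    from T2.IH[OF q'(1)] show ?thesis unfolding simE_def
    proof (elim disjE exE conjE)
      fix M' assume "sred M M'" "RE (extH \<gamma>) 0 q' M'"
      then show ?thesis using q'(2) by (blast intro: RT_RW_RE_RK.T2)
    next
      \<comment> \<open>The tail was a hole, so there is no jump to contract. The pending mu becomes
        the binder itself: the reading switches from \<open>T2\<close> to \<open>T1\<close>, with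
        the old hole sent to the same variable.\<close>
      fix q0 h' j L
      assume *: "q' = ren (case_nat 0 id) q0" "RE (extC (extH \<gamma>)) h' q0 L"
        "extC (extH \<gamma>) h' = C j" "sred M (Mu (Jmp j L))"
      have m: "match (extC (extH \<gamma>)) (extC \<gamma>) (case_nat 0 id) id id"
        unfolding match_def
      proof
        fix i show "extC (extH \<gamma>) i = H \<or> extC \<gamma> (case_nat 0 id i) = smap id id (extC (extH \<gamma>) i)"
        proof (cases i)
          case (Suc i')
          then show ?thesis by (cases i') (auto simp: smap_smap)
        qed auto
      qed
      have "RT \<gamma> t' (Mu (Jmp j L))"
        using R_ren(3)[OF *(2) m] matchD(2)[OF m *(3)] *(1) q'(2) by (auto intro: RT_RW_RE_RK.T1)
      then show ?thesis using *(4) by blast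
    qed
  next
    assume q: "q = LA (ren Suc t') (LV 0)"
    from T2.hyps(1)[unfolded q] obtain c M1 where
      M1: "M = plug c M1" "RT (extH \<gamma>) (ren Suc t') M1" "RK (extH \<gamma>) 0 (LV 0) c"
      by (auto elim!: RE_LA elim: RW_LV)
    then have c: "c = None" by (auto elim: RK_LV)
    obtain M' where "M1 = ren_t id id M'" "RT \<gamma> t' M'"
      using R_unren(1)[OF M1(2) refl pull_Suc(3)] by blast
    then show ?thesis using M1(1) c by auto
  qed
next
  case (T3 \<gamma> w V w' V')
  from beta_eta_LA[OF T3.prems] show ?case
  proof (elim disjE exE conjE)
    fix r assume r: "w = LL r" "t' = psub (case_nat w' LV) r"
    then obtain M where M: "V = Lam M" "RT (extX \<gamma>) r M" using T3.hyps(1) by (auto elim: RW_LL)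
    obtain M' where M': "eqv_t (substx_t M 0 V') M'" "RT \<gamma> t' M'"
      using RT_subst_val[OF M(2) T3.hyps(2)] r(2) by blast
    have "sred (App (Lam M) V') (Whr M V')"
      using RW_isval[OF T3.hyps(2)] by (intro sred_step r_beta)
    also have "sred \<dots> (substx_t M 0 V')"
      using RW_isval[OF T3.hyps(2)] by (intro sred_step r_whrV)
    also have "sred \<dots> M'" by (intro sred_eqv M')
    finally show ?thesis using M(1) M'(2) by blast
  next
    fix s' assume "beta_eta w s'" "t' = LA s' w'"
    then show ?thesis using T3.IH(1) T3.hyps(2) by (blast intro: sred_App RT_RW_RE_RK.T3)
  next
    fix s' assume "beta_eta w' s'" "t' = LA w s'"
    then show ?thesis using T3.IH(2) T3.hyps(1) by (blast intro: sred_App RT_RW_RE_RK.T3)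
  qed
next
  case (W1 \<gamma> i j)
  then show ?case by simp
next
  case (W2 \<gamma> t M)
  from beta_eta_LL[OF W2.prems] show ?case
  proof (elim disjE exE conjE)
    fix t' assume "beta_eta t t'" "w' = LL t'"
    then show ?thesis using W2.IH by (blast intro: sred_Lam RT_RW_RE_RK.W2)
  next
    assume t: "t = LA (ren Suc w') (LV 0)"
    from W2.hyps[unfolded t] obtain V where V: "M = App V (Var 0)" "RW (extX \<gamma>) (ren Suc w') V"
      by (auto elim!: RT_LA elim: RW_LV)
    obtain V' where V': "V = ren_t Suc id V'" "RW \<gamma> w' V'"
      using R_unren(2)[OF V(2) refl pull_Suc(1)] by blast
    have "sred (Lam M) V'"
      using V(1) V'(1) r_eta[OF RW_isval[OF V'(2)]] by (auto simp: liftx_0 intro: sred_step)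
    then show ?thesis using V'(2) by blast
  qed
next
  case (Q1 \<gamma> h K c w V)
  from beta_eta_LA[OF Q1.prems] show ?case
  proof (elim disjE exE conjE)
    fix r assume "K = LL r" "q' = psub (case_nat w LV) r"
    then show ?thesis using RE_beta_val Q1.hyps by blast
  next
    fix K' assume "beta_eta K K'" "q' = LA K' w"
    then show ?thesis using Q1.IH(1) simE_of_simK_W Q1.hyps(2) by blast
  next
    fix w' assume "beta_eta w w'" "q' = LA K w'"
    then show ?thesis using Q1.IH(2) Q1.hyps(1) by (blast intro: simE_refl sred_plug RT_RW_RE_RK.Q1)
  qed
next
  case (Q2 \<gamma> t M h K c)
  from beta_eta_LA[OF Q2.prems] show ?case
  proof (elim disjE exE conjE)
    fix r assume "t = LL r" "q' = psub (case_nat K LV) r"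
    then show ?thesis using RE_beta_cont Q2.hyps by blast
  next
    fix t' assume "beta_eta t t'" "q' = LA t' K"
    then show ?thesis using Q2.IH(1) Q2.hyps(2) by (blast intro: simE_refl sred_plug RT_RW_RE_RK.Q2)
  next
    fix K' assume "beta_eta K K'" "q' = LA t K'"
    then show ?thesis using Q2.IH(2) simE_of_simK_T Q2.hyps(1) by blast
  qed
next
  case (K1 \<gamma> h)
  then show ?case by simp
next
  case (K2 \<gamma> h q L)
  from beta_eta_LL[OF K2.prems] show ?case
  proof (elim disjE exE conjE)
    fix q' assume "beta_eta q q'" "K' = LL q'"
    then show ?thesis using K2.IH simK_of_simE by blast
  next
    assume q: "q = LA (ren Suc K') (LV 0)"
    from K2.hyps[unfolded q] obtain c where c: "L = plug c (Var 0)" "RK (extX \<gamma>) (Suc h) (ren Suc K') c"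
      by (auto elim!: RE_LA elim: RW_LV RK_LV)
    show ?thesis
    proof (cases K')
      case (LV i)
      then have "i = h" "c = None" using c(2) by (auto elim: RK_LV)
      then have "RK \<gamma> h K' None" "\<forall>M. sred (plug (Some L) M) (plug None M)"
        using LV c(1) by (auto intro: RT_RW_RE_RK.K1 sred_step r_whrvar)
      then show ?thesis unfolding simK_def by blast
    next
      \<comment> \<open>If \<open>K'\<close> is an abstraction, contracting eta in lambda x.K' x has
        the same result as contracting the beta redex K' x below the binder, and the induction
        hypothesis covers that step.\<close>
      case (LL u)
      have "psub (case_nat (LV 0) LV) (ren (up Suc) u) = psub LV u"
        unfolding psub_ren by (rule psub_cong) (auto simp: up_def split: nat.split)
      then have "beta_eta q u"
        using be_beta[of "ren (up Suc) u" "LV 0"] q LL by simp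
      then show ?thesis using K2.IH simK_of_simE LL by blast
    next
      case (LA u v)
      then show ?thesis using c(2) by auto
    qed
  qed
qed

lemma simulation_rtrancl:
  "beta_eta\<^sup>*\<^sup>* t t' \<Longrightarrow> RT \<gamma> t M \<Longrightarrow> \<exists>M'. sred M M' \<and> RT \<gamma> t' M'"
  by (induction rule: rtranclp_induct) (blast intro: sred_trans dest: simulation(1))+

section \<open>Normal target terms are read back to normalizable source terms\<close>

abbreviation nrm :: "lt \<Rightarrow> bool" where
  "nrm t \<equiv> \<not> (\<exists>t'. beta_eta t t')"

lemma nrm_LL: "nrm (LL t) \<Longrightarrow> nrm t"
  by (blast intro: beta_eta.cL)

lemma nrm_LA: "nrm (LA s t) \<Longrightarrow> nrm s \<and> nrm t \<and> \<not> isLL s"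
  by (cases s) (auto intro: beta_eta.intros)

lemma nrm_eta: "nrm (LL (LA t (LV 0))) \<Longrightarrow> 0 \<in> fv t"
  using be_eta[of "dn t"] ren_Suc_dn[of t] by fastforce

text \<open>Target normality excludes every source redex except mu k.[k]M, since lambda k.q has both
  readings; such redexes are contracted, replacing \<open>T1\<close> by \<open>T2\<close>. Commands
  never end in a mu because the T of a normal T K is an application, read as one; this is what the
  where and jump clauses of \<open>nf_t\<close> ask for.\<close>

lemma R_nrm:
  "RT \<gamma> t M \<Longrightarrow> nrm t \<Longrightarrow> \<exists>M'. sred M M' \<and> RT \<gamma> t M' \<and> nf_t M' \<and> (\<not> isLL t \<longrightarrow> tail M' = SApp)"
  "RW \<gamma> w V \<Longrightarrow> nrm w \<Longrightarrow> \<exists>V'. sred V V' \<and> RW \<gamma> w V' \<and> nf_t V'"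
  "RE \<gamma> h q M \<Longrightarrow> nrm q \<Longrightarrow> \<exists>M'. sred M M' \<and> RE \<gamma> h q M' \<and> nf_t M' \<and> tail M' \<noteq> SMu"
  "RK \<gamma> h K c \<Longrightarrow> nrm K \<Longrightarrow> \<exists>c'. (\<forall>M. sred (plug c M) (plug c' M)) \<and> RK \<gamma> h K c' \<and>
    (\<forall>L. c' = Some L \<longrightarrow> nf_t L \<and> tail L \<noteq> SMu \<and> \<not> isv0 L)"
proof (induction rule: R_induct)
  case (T1 \<gamma> h q M j)
  obtain M' where M': "sred M M'" "RE (extC \<gamma>) h q M'" "nf_t M'" "tail M' \<noteq> SMu"
    using T1.IH nrm_LL[OF T1.prems] by blast
  show ?case
  proof (cases "j = 0 \<and> 0 \<notin> fk_t M'")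
    case True
    let ?N = "ren_t id (\<lambda>i. i - Suc 0) M'"
    have N: "liftk_t 0 ?N = M'" using True not_free_liftk by blast
    have h: "h = 0" using T1.hyps(2) True by (cases h) (auto simp: smap_eq_iff)
    \<comment> \<open>The slot of k is first turned into \<open>H\<close> without renumbering;
      afterwards the remaining continuation indices are lowered by the renaming.\<close>
    have "RE (extH (\<lambda>i. smap id Suc (\<gamma> i))) 0 q M'"
    proof (rule R_drop(3)[OF M'(2)[unfolded h]])
      fix i
      show "extH (\<lambda>i. smap id Suc (\<gamma> i)) i = extC \<gamma> i \<or> (\<exists>k. extC \<gamma> i = C k \<and> k \<notin> fk_t M')"
        using True by (cases i) auto
    qed
    moreover have "match (extH (\<lambda>i. smap id Suc (\<gamma> i))) (extH \<gamma>) id id (\<lambda>i. i - Suc 0)"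
      unfolding match_def
    proof
      fix i
      show "extH (\<lambda>i. smap id Suc (\<gamma> i)) i = H \<or>
          extH \<gamma> (id i) = smap id (\<lambda>i. i - Suc 0) (extH (\<lambda>i. smap id Suc (\<gamma> i)) i)"
        by (cases i; cases "\<gamma> (i - 1)") auto
    qed
    ultimately have "RE (extH \<gamma>) (id 0) (ren id q) ?N" by (rule R_ren(3))
    then have "RT \<gamma> (LL q) ?N" by (auto intro: RT_RW_RE_RK.T2)
    moreover have "sred (Mu (Jmp j M)) ?N"
      using sred_trans[OF sred_MuJmp[OF M'(1)] sred_step] r_muJmp[of ?N] N True by simp
    ultimately show ?thesis using M'(3) by auto
  next
    case False
    then have "nf_t (Mu (Jmp j M'))" using M' by auto
    then show ?thesis using M' T1.hyps(2) sred_MuJmp[OF M'(1)] RT_RW_RE_RK.T1[OF M'(2) T1.hyps(2)]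
      by (intro exI[of _ "Mu (Jmp j M')"]) simp
  qed
next
  case (T2 \<gamma> q M)
  then obtain M' where "sred M M'" "RE (extH \<gamma>) 0 q M'" "nf_t M'"
    using nrm_LL by blast
  then show ?case by (auto intro: RT_RW_RE_RK.T2)
next
  case (T3 \<gamma> w V w' V')
  have n: "nrm w" "nrm w'" "\<not> isLL w" using nrm_LA[OF T3.prems] by auto
  obtain U U' where U: "sred V U" "RW \<gamma> w U" "sred V' U'" "RW \<gamma> w' U'" "nf_t U'"
    using T3.IH n by blast
  have "\<exists>i. U = Var i" using U(2) n(3) by (auto elim: RW.cases)
  then have "nf_t (App U U')" using U RW_isval by auto
  then show ?case using U by (intro exI[of _ "App U U'"]) (auto intro: sred_App RT_RW_RE_RK.T3)
next
  case (W1 \<gamma> i j)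
  then show ?case by (intro exI[of _ "Var j"]) (auto intro: RT_RW_RE_RK.W1)
next
  case (W2 \<gamma> t M)
  obtain M' where M': "sred M M'" "RT (extX \<gamma>) t M'" "nf_t M'"
    using W2.IH nrm_LL[OF W2.prems] by blast
  \<comment> \<open>Such a body is read either from an application of two variables or, through
    \<open>T2\<close>, from lambda k.(s k). In the first case \<open>LL t\<close>, in the second
    \<open>t\<close> itself, would be an eta redex.\<close>
  have "False" if M'_eq: "M' = App (Var (Suc i)) (Var 0)" for i
    using M'(2)
  proof (cases rule: RT.cases)
    case (T1 h q P j)
    then show ?thesis using M'_eq by simp
  next
    case (T2 q)
    from T2(2) show ?thesis
    proof (cases rule: RE.cases)
      case (Q1 K c w V)
      then show ?thesis using M'_eq RW_isval[OF Q1(4)] by (cases c) auto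
    next
      case (Q2 s P K c)
      then have "c = None" using M'_eq by (cases c) auto
      then have "K = LV 0" using Q2(4) by (auto elim: RK.cases)
      then have "0 \<in> fv s" using nrm_eta nrm_LL[OF W2.prems] T2(1) Q2(1) by blast
      then show ?thesis using R_fv(1)[OF Q2(3)] by fastforce
    qed
  next
    case (T3 w V w' V')
    then have "RW (extX \<gamma>) w (Var (Suc i))" "RW (extX \<gamma>) w' (Var 0)" using M'_eq by auto
    then obtain k k' where k: "w = LV k" "extX \<gamma> k = X (Suc i)" "w' = LV k'" "extX \<gamma> k' = X 0"
      by (auto elim!: RW.cases)
    then have "k' = 0" by (cases k') (auto simp: smap_eq_iff)
    moreover have "k \<noteq> 0" using k(2) by (cases k) auto
    ultimately show ?thesis using nrm_eta[of "LV k"] W2.prems k T3(1) by auto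
  qed
  then have "nf_t (Lam M')" using M'(3) by auto
  then show ?case using M' by (intro exI[of _ "Lam M'"]) (auto intro: sred_Lam RT_RW_RE_RK.W2)
next
  case (Q1 \<gamma> h K c w V)
  have n: "nrm K" "nrm w" "\<not> isLL K" using nrm_LA[OF Q1.prems] by auto
  then have K: "K = LV h" "c = None" using Q1.hyps(1) by (auto elim: RK.cases)
  obtain V' where V': "sred V V'" "RW \<gamma> w V'" "nf_t V'" using Q1.IH(2) n by blast
  have "tail V' \<noteq> SMu" using RW_isval[OF V'(2)] by (cases V') auto
  moreover have "RE \<gamma> h (LA K w) (plug None V')"
    unfolding K by (intro RT_RW_RE_RK.Q1 RT_RW_RE_RK.K1 V')
  ultimately show ?case using K V' by auto
next
  case (Q2 \<gamma> t M h K c)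
  have n: "nrm K" "nrm t" "\<not> isLL t" using nrm_LA[OF Q2.prems] by auto
  obtain M' where M': "sred M M'" "RT \<gamma> t M'" "nf_t M'" "tail M' = SApp"
    using Q2.IH(1) n by blast
  obtain c' where c': "\<And>M. sred (plug c M) (plug c' M)" "RK \<gamma> h K c'"
    "\<And>L. c' = Some L \<Longrightarrow> nf_t L \<and> tail L \<noteq> SMu \<and> \<not> isv0 L"
    using Q2.IH(2) n by blast
  have "nf_t (plug c' M')" "tail (plug c' M') \<noteq> SMu"
    using c'(3) M' by (cases c'; auto)+
  moreover have "sred (plug c M) (plug c' M')"
    using sred_trans[OF sred_plug[OF M'(1)] c'(1)] .
  ultimately show ?case using RT_RW_RE_RK.Q2[OF M'(2) c'(2)] by blast
next
  case (K1 \<gamma> h)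
  then show ?case by (intro exI[of _ None]) (auto intro: RT_RW_RE_RK.K1)
next
  case (K2 \<gamma> h q L)
  have n: "nrm q" by (rule nrm_LL[OF K2.prems])
  obtain L' where L': "sred L L'" "RE (extX \<gamma>) (Suc h) q L'" "nf_t L'" "tail L' \<noteq> SMu"
    using K2.IH n by blast
  \<comment> \<open>Reading the bound variable forces \<open>q\<close> to be the tail applied to x,
    making \<open>LL q\<close> an eta redex, or else an abstraction applied to a continuation, a
    beta redex.\<close>
  have "False" if L'_eq: "L' = Var 0"
    using L'(2)
  proof (cases rule: RE.cases)
    case (Q1 K c w V)
    then have c: "c = None" "V = Var 0" using L'_eq by (cases c; auto)+
    then have "K = LV (Suc h)" using Q1(3) by (auto elim: RK.cases)
    moreover obtain k where "w = LV k" "extX \<gamma> k = X 0" using Q1(4) c by (auto elim: RW.cases)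
    moreover have "k = 0" using calculation by (cases k) (auto simp: smap_eq_iff)
    ultimately show ?thesis using nrm_eta[of "LV (Suc h)"] K2.prems Q1(1) by auto
  next
    case (Q2 t P K c)
    then have "P = Var 0" using L'_eq by (cases c) auto
    then have "isLL t" using Q2(3) by (auto elim: RT.cases)
    then show ?thesis using nrm_LA n Q2(1) by blast
  qed
  then have "\<not> isv0 L'" using L'(4) by (auto simp: isv0_def)
  then show ?case using L' by (intro exI[of _ "Some L'"]) (auto intro: sred_Whr RT_RW_RE_RK.K2)
qed

lemma has_be_nf_imp_normalizable:
  assumes "has_be_nf (cps_top M)"
  shows "normalizable M"
proof -
  \<comment> \<open>This inverts the even/odd coding of the free variables in
    \<open>cps_top\<close>.\<close>
  let ?\<gamma> = "\<lambda>i. if even i then X (i div 2) else C (i div 2)"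
  let ?r = "\<lambda>i. Suc (2 * i)" and ?s = "\<lambda>j. Suc (2 * j + 1)"
  \<comment> \<open>The outermost k gets slot \<open>H\<close>, so \<open>T2\<close> reads the
    translation as a reduct of \<open>M\<close> itself instead of mu k.[k]M.\<close>
  have "compat (extH ?\<gamma>) ?r ?s id id" by (auto simp: compat_def)
  then obtain M1 where "sred (plug None (ren_t id id M)) M1" "RE (extH ?\<gamma>) 0 (cps M ?r ?s (LV 0)) M1"
    using RE_cps(1)[OF _ K1] by blast
  then have M1: "sred M M1" "RT ?\<gamma> (cps_top M) M1"
    unfolding cps_top_def by (auto intro: T2)
  obtain t where t: "beta_eta\<^sup>*\<^sup>* (cps_top M) t" "nrm t"
    using assms unfolding has_be_nf_def by blast
  obtain M2 where M2: "sred M1 M2" "RT ?\<gamma> t M2"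
    using simulation_rtrancl[OF t(1) M1(2)] by blast
  obtain N where "sred M2 N" "nf_t N" using R_nrm(1)[OF M2(2) t(2)] by blast
  then show ?thesis using M1(1) M2(1) sred_nf_normalizable sred_trans by meson
qed

theorem theorem2p11:
  shows "normalizable M \<longleftrightarrow> has_be_nf (cps_top M)"
  using normalizable_imp_has_be_nf has_be_nf_imp_normalizable by blast

end
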